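(* Let $c$ be a finite positive constant and let $N_S,N_T\to\infty$ with $N_S/N_T=c$. Then the sensing mutual information $I_s=\mathbb{E}_{\mathbf S}\log\left|\mathbf I+\sigma_s^{-2}\left(\mathbf R_R\otimes \mathbf R_T^{1/2}\mathbf F\mathbf S\mathbf S^{\mathrm H}\mathbf F^{\mathrm H}\mathbf R_T^{1/2}\right)\right|$ satisfies $$I_s=\sum_{j=1}^{K}\bar\varrho_j(\mathbf\Phi)+\mathcal O\left(\frac1{N_S}\right),$$ where $\mathbf\Phi=\mathbf F\mathbf F^{\mathrm H}$, $\mathbf T(\mathbf\Phi)=\mathbf R_T^{1/2}\mathbf\Phi\mathbf R_T^{1/2}$, $$\bar\varrho_j(\mathbf\Phi)=\log\left|\mathbf I_{N_T}+\frac{\lambda_{R,j}}{1+\lambda_{R,j}\delta(\lambda_{R,j})}\mathbf T(\mathbf\Phi)\right|+N_S\log\left(1+\lambda_{R,j}\delta(\lambda_{R,j})\right)-N_S\frac{\lambda_{R,j}\delta(\lambda_{R,j})}{1+\lambda_{R,j}\delta(\lambda_{R,j})},$$ $\{\lambda_{R,j}\}_{j=1}^K$ are the eigenvalues of $\sigma_s^{-2}\mathbf R_R$, and, for each $\rho$, $\delta(\rho)$ is the (nonnegative) solution of $$\delta(\rho)=\frac1{N_S}\operatorname{tr}\left(\mathbf T(\mathbf\Phi)\left(\mathbf I_{N_T}+\frac{\rho}{1+\rho\,\delta(\rho)}\mathbf T(\mathbf\Phi)\right)^{-1}\right).$$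
   Context: Sensing model: $\mathbf Y_s=\mathbf H_s\mathbf X+\mathbf N_s\in\mathbb C^{N_R\times N_S}$ with transmitted signal $\mathbf X=\mathbf F\mathbf S$, where $\mathbf F\in\mathbb C^{N_T\times N_T}$ is a deterministic precoding matrix and $\mathbf S\in\mathbb C^{N_T\times N_S}$ is random with i.i.d. circularly symmetric complex Gaussian entries of mean zero and variance $1/N_S$ (so $\mathbb E(\mathbf S\mathbf S^{\mathrm H})=\mathbf I$), and $N_S\ge N_T$. The noise has i.i.d. $\mathcal{CN}(0,\sigma_s^2)$ entries, $\sigma_s^2>0$. The vector $\mathbf h_s=\mathrm{vec}(\mathbf H_s^{\mathrm H})\sim\mathcal{CN}(\mathbf 0,\mathbf R)$ is independent of $\mathbf S$ and of the noise, with $\mathbf R=\mathbf R_R\otimes\mathbf R_T$, where $\mathbf R_R\in\mathbb C^{N_R\times N_R}$ and $\mathbf R_T\in\mathbb C^{N_T\times N_T}$ are Hermitian positive semidefinite with $\mathrm{rank}(\mathbf R_R)\le K$ and $\mathrm{rank}(\mathbf R_T)\le K$; $K$ is the number of sensing targets. The quantity $I_s$ equals the conditional mutual information $I(\mathbf h_s;\mathbf y_s|\mathbf S)$ with $\mathbf y_s=\mathrm{vec}(\mathbf Y_s^{\mathrm H})$. Notation: $|\cdot|$ is the determinant, $\log$ the natural logarithm, $\otimes$ the Kronecker product, $(\cdot)^{1/2}$ the Hermitian positive semidefinite square root. The list $\{\lambda_{R,j}\}_{j=1}^K$ consists of the $K$ largest eigenvalues of $\sigma_s^{-2}\mathbf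 R_R$ with multiplicity (padded with zeros if needed); it contains all nonzero eigenvalues. In the asymptotic regime only $N_S$ and $N_T$ (and with them $\mathbf F$, $\mathbf R_T$) vary; $K$, $N_R$, $\mathbf R_R$, $\sigma_s^2$ are held fixed. *)

theory Defs
  imports
    "HOL-Probability.Probability"
    "HOL-Library.Landau_Symbols"
    "Jordan_Normal_Form.Schur_Decomposition"
    "Jordan_Normal_Form.Gauss_Jordan_Elimination"
    "Jordan_Normal_Form.DL_Rank"
begin

(* The matrix dimensions vary with the sequence index, so matrices are elements of the
   dimension-carrying type 'a mat rather than of the type-indexed 'a ^ 'n ^ 'm.  The names mat
   and det exist for both representations and are therefore qualified. *)

definition mat_trace :: "'a :: comm_monoid_add mat \<Rightarrow> 'a" where
  "mat_trace A = (\<Sum>i<dim_row A. A $$ (i, i))"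

definition kronecker :: "'a :: times mat \<Rightarrow> 'a mat \<Rightarrow> 'a mat" where
  "kronecker A B = Matrix.mat (dim_row A * dim_row B) (dim_col A * dim_col B)
     (\<lambda>(i, j). A $$ (i div dim_row B, j div dim_col B) * B $$ (i mod dim_row B, j mod dim_col B))"

definition hermitian_psd :: "nat \<Rightarrow> complex mat \<Rightarrow> bool" where
  "hermitian_psd n A \<longleftrightarrow> A \<in> carrier_mat n n \<and> mat_adjoint A = A \<and>
     (\<forall>v \<in> carrier_vec n. 0 \<le> Re ((A *\<^sub>v v) \<bullet>c v))"

definition psd_sqrt :: "complex mat \<Rightarrow> complex mat" where
  "psd_sqrt A = (THE B. hermitian_psd (dim_row A) B \<and> B * B = A)"

(* The real parts lose nothing for Hermitian A.  For positive semidefinite A all eigenvalues are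
   nonnegative, so that padding with zeros at the end keeps the list decreasing. *)
definition largest_eigenvalues :: "nat \<Rightarrow> complex mat \<Rightarrow> real list" where
  "largest_eigenvalues K A =
     take K (rev (sorted_list_of_multiset (image_mset Re (proots (char_poly A)))) @ replicate K 0)"

text \<open>The circularly symmetric complex Gaussian law with mean zero and variance \<open>v > 0\<close>
  (variance meaning \<open>E |Z|\<^sup>2\<close>): real and imaginary part are independent, each normal
  with mean zero and variance \<open>v / 2\<close>.\<close>

definition complex_gaussian :: "'a measure \<Rightarrow> real \<Rightarrow> ('a \<Rightarrow> complex) \<Rightarrow> bool" where
  "complex_gaussian M v Z \<longleftrightarrow>
     prob_space.indep_var M borel (\<lambda>\<omega>. Re (Z \<omega>)) borel (\<lambda>\<omega>. Im (Z \<omega>)) \<and>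
     distributed M lborel (\<lambda>\<omega>. Re (Z \<omega>)) (normal_density 0 (sqrt (v / 2))) \<and>
     distributed M lborel (\<lambda>\<omega>. Im (Z \<omega>)) (normal_density 0 (sqrt (v / 2)))"

definition iid_gaussian_mat ::
    "'a measure \<Rightarrow> real \<Rightarrow> nat \<Rightarrow> nat \<Rightarrow> ('a \<Rightarrow> complex mat) \<Rightarrow> bool" where
  "iid_gaussian_mat M v m k S \<longleftrightarrow>
     (\<forall>\<omega> \<in> space M. S \<omega> \<in> carrier_mat m k) \<and>
     prob_space.indep_vars M (\<lambda>_. borel) (\<lambda>ij \<omega>. S \<omega> $$ ij) ({..<m} \<times> {..<k}) \<and>
     (\<forall>i<m. \<forall>j<k. complex_gaussian M v (\<lambda>\<omega>. S \<omega> $$ (i, j)))"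

(* The determinants below are real and positive, being those of matrices that exceed the identity
   by a Hermitian positive semidefinite matrix; Re only changes the type. *)

text \<open>The sensing mutual information (in nats); \<open>s2\<close> is the noise variance.\<close>

definition sensing_mi :: "'a measure \<Rightarrow> real \<Rightarrow> complex mat \<Rightarrow> complex mat \<Rightarrow> complex mat
    \<Rightarrow> ('a \<Rightarrow> complex mat) \<Rightarrow> real" where
  "sensing_mi M s2 RR RT F S =
     (LINT \<omega>|M. ln (Re (Determinant.det (1\<^sub>m (dim_row RR * dim_row RT) +
        complex_of_real (1 / s2) \<cdot>\<^sub>m
          kronecker RR (psd_sqrt RT * F * S \<omega> * mat_adjoint (S \<omega>) * mat_adjoint F * psd_sqrt RT)))))"

definition T_mat :: "complex mat \<Rightarrow> complex mat \<Rightarrow> complex mat" where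
  "T_mat RT \<Phi> = psd_sqrt RT * \<Phi> * psd_sqrt RT"

(* For Hermitian positive semidefinite T, N > 0 and \<rho> \<ge> 0 the fixed-point equation has exactly one
   nonnegative solution, and the inverse exists for every candidate d \<ge> 0. *)
definition delta :: "nat \<Rightarrow> complex mat \<Rightarrow> real \<Rightarrow> real" where
  "delta N T \<rho> = (THE d. 0 \<le> d \<and>
     complex_of_real d = 1 / of_nat N *
       mat_trace (T * the (mat_inverse
         (1\<^sub>m (dim_row T) + complex_of_real (\<rho> / (1 + \<rho> * d)) \<cdot>\<^sub>m T))))"

definition rho_bar :: "nat \<Rightarrow> complex mat \<Rightarrow> real \<Rightarrow> real" where
  "rho_bar N T l =
     ln (Re (Determinant.det
       (1\<^sub>m (dim_row T) + complex_of_real (l / (1 + l * delta N T l)) \<cdot>\<^sub>m T)))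
     + real N * ln (1 + l * delta N T l)
     - real N * (l * delta N T l / (1 + l * delta N T l))"

end

theory Submission
  imports Defs
begin

text \<open>
  Diagonalizing \<open>RR\<close> splits the log-determinant into terms \<open>E ln det (I + A S S\<^sup>H A\<^sup>H)\<close>, one for
  each eigenvalue \<open>l\<close> of \<open>RR / s2\<close>, with \<open>A = sqrt l RT\<^sup>1\<^sup>/\<^sup>2 F\<close>.  Both this expectation and the
  deterministic equivalent turn out to lie within \<open>K\<^sup>2 / (N - K)\<close> of \<open>ln det (I + A A\<^sup>H)\<close>, uniformly in
  \<open>F\<close> and \<open>RT\<close>; only the rank bound enters.

  Everything rests on \<open>ln det X - ln det Y \<le> tr (Y\<^sup>-\<^sup>1 X) - n\<close>.  With \<open>X = I + A S S\<^sup>H A\<^sup>H\<close> and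
  \<open>Y = I + A A\<^sup>H\<close> it gives the upper bound, since \<open>E S S\<^sup>H = I\<close>.  With the roles exchanged it gives the lower
  bound \<open>E (t - m)\<close>, where \<open>t = tr (I - X\<^sup>-\<^sup>1) \<in> [0, K]\<close> and \<open>m = tr (A\<^sup>H X\<^sup>-\<^sup>1 A)\<close>.  Gaussian
  integration by parts in each entry of \<open>S\<close>, where \<open>X\<^sup>-\<^sup>1\<close> is made explicit by the Sherman--Morrison
  formula for the column of that entry, sums up to \<open>E t = E (m (N - t)) / N\<close>.  Hence \<open>E m \<le> K N / (N - K)\<close>
  and \<open>E (t - m) = - E (m t) / N \<ge> - K\<^sup>2 / (N - K)\<close>.

  On the deterministic side, the fixed-point equation says \<open>N y = tr (I - (I + a T)\<^sup>-\<^sup>1) \<le> K\<close> for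
  \<open>y = l \<delta> / (1 + l \<delta>)\<close> and \<open>a = l / (1 + l \<delta>)\<close>, so all corrections are at most \<open>N l \<delta> y\<close>.
\<close>

(* Both vector libraries use the infix dollar sign for components. *)
unbundle no vec_syntax

section \<open>Complex matrices\<close>

text \<open>\<open>F\<close> and \<open>RT\<close> obey no norm bound, so the estimates cannot run
  through operator norms and have to come from the rank alone. This can work because S S^H,
  compressed to a space of dimension at most K, is close to the identity; the random and the
  deterministic side are therefore both small corrections of one benchmark and need never be
  compared directly. The delicate quantity is m, whose only obvious bound tr (A^H A) may grow
  freely. That bound serves integrability alone; the one that enters the constant comes out of
  Stein's identity itself, as m (N - K) \<le> m (N - t). Differentiating an inverse matrix is
  avoided: with all entries but one frozen, the entry of A^H X^-1 A S is a rational function of one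
  complex variable whose denominator is 1 plus a nonnegative quadratic, and calculus on the real
  line suffices.\<close>

lemma mat_adjoint_dim [simp]:
  "dim_row (mat_adjoint A) = dim_col A" "dim_col (mat_adjoint A) = dim_row A"
  by (simp_all add: mat_adjoint_def)

lemma mat_adjoint_carrier [simp]: "A \<in> carrier_mat n m \<Longrightarrow> mat_adjoint A \<in> carrier_mat m n"
  by (auto simp: mat_adjoint_def)

lemma mat_adjoint_index [simp]:
  fixes A :: "complex mat"
  shows "i < dim_col A \<Longrightarrow> j < dim_row A \<Longrightarrow> mat_adjoint A $$ (i, j) = cnj (A $$ (j, i))"
  by (simp add: mat_adjoint_def mat_of_rows_def)

lemma mat_adjoint_adjoint [simp]: "mat_adjoint (mat_adjoint A) = (A :: complex mat)"
  by (rule eq_matI) auto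

lemma mat_adjoint_one [simp]: "mat_adjoint (1\<^sub>m n) = (1\<^sub>m n :: complex mat)"
  by (rule eq_matI) auto

lemma mat_adjoint_add:
  fixes A B :: "complex mat"
  assumes "A \<in> carrier_mat n m" "B \<in> carrier_mat n m"
  shows "mat_adjoint (A + B) = mat_adjoint A + mat_adjoint B"
  using assms by (intro eq_matI) auto

lemma mat_adjoint_mult:
  fixes A B :: "complex mat"
  assumes "A \<in> carrier_mat n m" "B \<in> carrier_mat m k"
  shows "mat_adjoint (A * B) = mat_adjoint B * mat_adjoint A"
  using assms by (intro eq_matI) (auto simp: scalar_prod_def mult.commute intro!: sum.cong)

lemma mat_adjoint_smult:
  fixes A :: "complex mat"
  shows "mat_adjoint (c \<cdot>\<^sub>m A) = cnj c \<cdot>\<^sub>m mat_adjoint A"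
  by (intro eq_matI) auto

lemma cscalar_prod_adjoint:
  fixes A :: "complex mat"
  assumes A: "A \<in> carrier_mat n m" and v: "v \<in> carrier_vec m" and w: "w \<in> carrier_vec n"
  shows "(A *\<^sub>v v) \<bullet>c w = v \<bullet>c (mat_adjoint A *\<^sub>v w)"
proof -
  have "(A *\<^sub>v v) \<bullet>c w = (\<Sum>i<n. \<Sum>j<m. A $$ (i,j) * v $ j * cnj (w $ i))"
    using assms by (auto simp: scalar_prod_def lessThan_atLeast0 sum_distrib_right intro!: sum.cong)
  also have "\<dots> = (\<Sum>j<m. \<Sum>i<n. A $$ (i,j) * v $ j * cnj (w $ i))" by (rule sum.swap)
  also have "\<dots> = v \<bullet>c (mat_adjoint A *\<^sub>v w)"
    using assms by (auto simp: scalar_prod_def lessThan_atLeast0 sum_distrib_left ac_simps intro!: sum.cong)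
  finally show ?thesis .
qed

lemma cscalar_prod_self:
  fixes v :: "complex vec"
  shows "v \<bullet>c v = complex_of_real (\<Sum>i<dim_vec v. (cmod (v $ i))\<^sup>2)"
  by (simp add: scalar_prod_def lessThan_atLeast0 complex_norm_square flip: of_real_power)

lemma cscalar_prod_self_Re:
  fixes v :: "complex vec"
  shows "Re (v \<bullet>c v) \<ge> 0" "Im (v \<bullet>c v) = 0"
  by (simp_all only: cscalar_prod_self) (auto simp: sum_nonneg)

lemma cscalar_prod_self_eq_0:
  fixes v :: "complex vec"
  assumes "v \<in> carrier_vec n" "Re (v \<bullet>c v) = 0"
  shows "v = 0\<^sub>v n"
  using assms conjugate_square_eq_0_vec[of v n] cscalar_prod_self_Re(2)[of v]
  by (simp add: complex_eq_iff)

section \<open>Traces and matrix algebra by dimensions\<close>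

lemma mat_trace_eq: "A \<in> carrier_mat n m \<Longrightarrow> mat_trace A = (\<Sum>i<n. A $$ (i, i))"
  by (auto simp: mat_trace_def)

lemma mat_trace_mult_comm:
  fixes A B :: "'a :: comm_semiring_0 mat"
  assumes "A \<in> carrier_mat n m" "B \<in> carrier_mat m n"
  shows "mat_trace (A * B) = mat_trace (B * A)"
proof -
  have "mat_trace (A * B) = (\<Sum>i<n. \<Sum>j<m. A $$ (i,j) * B $$ (j,i))"
    using assms by (auto simp: mat_trace_def scalar_prod_def lessThan_atLeast0 intro!: sum.cong)
  also have "\<dots> = (\<Sum>j<m. \<Sum>i<n. A $$ (i,j) * B $$ (j,i))" by (rule sum.swap)
  also have "\<dots> = mat_trace (B * A)"
    using assms by (auto simp: mat_trace_def scalar_prod_def lessThan_atLeast0 mult.commute intro!: sum.cong)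
  finally show ?thesis .
qed

lemma mat_trace_add:
  assumes "A \<in> carrier_mat n n" "B \<in> carrier_mat n n"
  shows "mat_trace (A + B) = mat_trace A + mat_trace B"
  using assms by (auto simp: mat_trace_def sum.distrib)

lemma mat_trace_diff:
  fixes A B :: "'a :: ab_group_add mat"
  assumes "A \<in> carrier_mat n n" "B \<in> carrier_mat n n"
  shows "mat_trace (A - B) = mat_trace A - mat_trace B"
  using assms by (auto simp: mat_trace_def sum_subtractf)

lemma mat_trace_smult:
  fixes A :: "'a :: comm_semiring_0 mat"
  assumes "A \<in> carrier_mat n n"
  shows "mat_trace (c \<cdot>\<^sub>m A) = c * mat_trace A"
  using assms by (auto simp: mat_trace_def sum_distrib_left)

lemma mat_trace_one [simp]: "mat_trace (1\<^sub>m n :: 'a :: semiring_1 mat) = of_nat n"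
  by (simp add: mat_trace_def)

lemma one_mult_dim [simp]:
  fixes A :: "'a :: semiring_1 mat"
  shows "dim_row A = n \<Longrightarrow> 1\<^sub>m n * A = A" "dim_col A = n \<Longrightarrow> A * 1\<^sub>m n = A"
  by (metis carrier_mat_triv left_mult_one_mat) (metis carrier_mat_triv right_mult_one_mat)

lemma assoc_mult_dim:
  fixes A :: "'a :: semiring_0 mat"
  shows "dim_col A = dim_row B \<Longrightarrow> dim_col B = dim_row C \<Longrightarrow> A * B * C = A * (B * C)"
  by (rule assoc_mult_mat[of _ "dim_row A" "dim_col A" _ "dim_col B" _ "dim_col C"]; metis carrier_mat_triv)

lemma assoc_mult_vec_dim:
  fixes A :: "'a :: semiring_0 mat"
  shows "dim_col A = dim_row B \<Longrightarrow> dim_col B = dim_vec v \<Longrightarrow> A * B *\<^sub>v v = A *\<^sub>v (B *\<^sub>v v)"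
  by (rule assoc_mult_mat_vec[of _ "dim_row A" "dim_col A" _ "dim_col B"]; metis carrier_mat_triv carrier_vec_dim_vec)

lemma add_mult_dim:
  fixes A :: "'a :: semiring_0 mat"
  shows "dim_row A = dim_row B \<Longrightarrow> dim_col A = dim_col B \<Longrightarrow> dim_col B = dim_row C \<Longrightarrow>
    (A + B) * C = A * C + B * C"
  by (rule add_mult_distrib_mat[of _ "dim_row A" "dim_col A" _ _ "dim_col C"]; metis carrier_mat_triv)

lemma mult_add_dim:
  fixes A :: "'a :: semiring_0 mat"
  shows "dim_row C = dim_row B \<Longrightarrow> dim_col C = dim_col B \<Longrightarrow> dim_col A = dim_row C \<Longrightarrow>
    A * (B + C) = A * B + A * C"
  by (rule mult_add_distrib_mat[of _ "dim_row A" "dim_col A" _ "dim_col B"]; metis carrier_mat_triv)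

lemma mat_adjoint_mult_dim:
  fixes A B :: "complex mat"
  shows "dim_col A = dim_row B \<Longrightarrow> mat_adjoint (A * B) = mat_adjoint B * mat_adjoint A"
  by (rule mat_adjoint_mult[of _ "dim_row A" "dim_col A" _ "dim_col B"]; metis carrier_mat_triv)

text \<open>Cramer's rule. Each entry is a polynomial in the entries of \<open>A\<close> divided by
  the determinant, which makes the inverse of a random matrix visibly measurable.\<close>

definition minv :: "'a :: field mat \<Rightarrow> 'a mat" where
  "minv A = inverse (Determinant.det A) \<cdot>\<^sub>m adj_mat A"

lemma minv:
  assumes "A \<in> carrier_mat n n" "Determinant.det A \<noteq> 0"
  shows "minv A \<in> carrier_mat n n" "A * minv A = 1\<^sub>m n" "minv A * A = 1\<^sub>m n"
proof -
  note adj = adj_mat[OF assms(1)]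
  show "minv A \<in> carrier_mat n n" using adj(1) by (simp add: minv_def)
  show "A * minv A = 1\<^sub>m n"
    unfolding minv_def using assms adj by (subst mult_smult_distrib[OF assms(1) adj(1)]) auto
  show "minv A * A = 1\<^sub>m n"
    unfolding minv_def using assms adj by (subst mult_smult_assoc_mat[OF adj(1) assms(1)]) auto
qed

lemma mat_inverse_unique:
  fixes A :: "'a :: field mat"
  assumes "A \<in> carrier_mat n n" "B \<in> carrier_mat n n" "C \<in> carrier_mat n n"
    and "A * B = 1\<^sub>m n" "A * C = 1\<^sub>m n"
  shows "B = C"
proof -
  have "B * A = 1\<^sub>m n" by (rule mat_mult_left_right_inverse[OF assms(1,2,4)])
  then have "C = B * A * C" using assms(3) by simp
  also have "\<dots> = B * (A * C)" using assms by (intro assoc_mult_mat) auto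
  also have "\<dots> = B" using assms(2,5) by simp
  finally show ?thesis by (rule sym)
qed

text \<open>Connects the inverse in the definition of \<open>delta\<close> with the explicit one.
  The result \<open>None\<close> is excluded because \<open>minv A\<close> exhibits \<open>A\<close>
  as a unit of the matrix ring.\<close>

lemma mat_inverse_eq_minv:
  assumes A: "A \<in> carrier_mat n n" and d: "Determinant.det A \<noteq> 0"
  shows "the (mat_inverse A) = minv A"
proof (cases "mat_inverse A")
  case None
  from mat_inverse(1)[OF A this, where b = undefined] have "A \<notin> Units (ring_mat TYPE('a) n undefined)" .
  with minv[OF A d] A show ?thesis by (auto simp: Units_def ring_mat_simps)
next
  case (Some B)
  from mat_inverse(2)[OF A this] show ?thesis
    using mat_inverse_unique[OF A _ minv(1)[OF A d] _ minv(2)[OF A d], of B] Some by simp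
qed

section \<open>Hermitian positive semidefinite matrices\<close>

lemma hermitian_psd_carrier: "hermitian_psd n A \<Longrightarrow> A \<in> carrier_mat n n"
  by (simp add: hermitian_psd_def)

lemma hermitian_psd_adjoint: "hermitian_psd n A \<Longrightarrow> mat_adjoint A = A"
  by (simp add: hermitian_psd_def)

lemma hermitian_psd_form: "hermitian_psd n A \<Longrightarrow> v \<in> carrier_vec n \<Longrightarrow> 0 \<le> Re ((A *\<^sub>v v) \<bullet>c v)"
  by (simp add: hermitian_psd_def)

lemma cscalar_prod_cnj:
  fixes v w :: "complex vec"
  assumes "dim_vec v = dim_vec w"
  shows "cnj (v \<bullet>c w) = w \<bullet>c v"
  using assms by (simp add: scalar_prod_def mult.commute)

lemma hermitian_form_cnj:
  fixes A :: "complex mat"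
  assumes "A \<in> carrier_mat n n" "mat_adjoint A = A" "v \<in> carrier_vec n" "w \<in> carrier_vec n"
  shows "cnj ((A *\<^sub>v v) \<bullet>c w) = (A *\<^sub>v w) \<bullet>c v"
proof -
  have "cnj ((A *\<^sub>v v) \<bullet>c w) = w \<bullet>c (A *\<^sub>v v)"
    using assms by (intro cscalar_prod_cnj) auto
  also have "\<dots> = (A *\<^sub>v w) \<bullet>c v"
    using cscalar_prod_adjoint[of A n n w v] assms by simp
  finally show ?thesis .
qed

lemma hermitian_form_Im:
  fixes A :: "complex mat"
  assumes "A \<in> carrier_mat n n" "mat_adjoint A = A" "v \<in> carrier_vec n"
  shows "Im ((A *\<^sub>v v) \<bullet>c v) = 0"
  using hermitian_form_cnj[OF assms(1,2,3,3)] by (simp add: complex_eq_iff)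

text \<open>The form of the new matrix at v is the form of \<open>A\<close> at \<open>C v\<close>.
  Gram matrices, conjugates by unitary matrices and sandwiched resolvents all get their
  semidefiniteness from here.\<close>

lemma hermitian_psd_congruence:
  assumes "hermitian_psd n A" "C \<in> carrier_mat n m"
  shows "hermitian_psd m (mat_adjoint C * A * C)"
proof -
  have [simp]: "A \<in> carrier_mat n n" "mat_adjoint A = A" "C \<in> carrier_mat n m" "mat_adjoint C \<in> carrier_mat m n"
    "dim_row A = n" "dim_col A = n" "dim_row C = n" "dim_col C = m"
    using assms by (auto simp: hermitian_psd_def)
  have "(mat_adjoint C * A * C *\<^sub>v v) \<bullet>c v = (A *\<^sub>v (C *\<^sub>v v)) \<bullet>c (C *\<^sub>v v)"
    if v: "v \<in> carrier_vec m" for v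
  proof -
    have [simp]: "C *\<^sub>v v \<in> carrier_vec n" using v by (intro mult_mat_vec_carrier[of _ _ m]; simp)
    have [simp]: "A *\<^sub>v (C *\<^sub>v v) \<in> carrier_vec n" by (rule mult_mat_vec_carrier[of _ n n]) simp_all
    have "mat_adjoint C * A \<in> carrier_mat m n" by (intro mult_carrier_mat[of _ _ n]; simp)
    then have "mat_adjoint C * A * C *\<^sub>v v = mat_adjoint C *\<^sub>v (A *\<^sub>v (C *\<^sub>v v))"
      using v by (simp add: assoc_mult_mat_vec[of _ m n _ m] assoc_mult_mat_vec[of _ m n _ n])
    then show ?thesis
      using cscalar_prod_adjoint[of "mat_adjoint C" m n "A *\<^sub>v (C *\<^sub>v v)" v] v by simp
  qed
  moreover have CA: "mat_adjoint C * A \<in> carrier_mat m n" by (intro mult_carrier_mat[of _ _ n]; simp)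
  then have "mat_adjoint (mat_adjoint C * A * C) = mat_adjoint C * A * C"
    by (simp add: mat_adjoint_mult_dim assoc_mult_dim)
  moreover have "mat_adjoint C * A * C \<in> carrier_mat m m" by (rule mult_carrier_mat[OF CA]) simp
  moreover have "0 \<le> Re ((A *\<^sub>v (C *\<^sub>v v)) \<bullet>c (C *\<^sub>v v))" if "v \<in> carrier_vec m" for v
    by (intro hermitian_psd_form[OF assms(1)] mult_mat_vec_carrier[OF assms(2) that])
  ultimately show ?thesis unfolding hermitian_psd_def by simp
qed

lemma cscalar_prod_add:
  fixes u v w :: "complex vec"
  assumes "v \<in> carrier_vec n" "w \<in> carrier_vec n" "u \<in> carrier_vec n"
  shows "(v + w) \<bullet>c u = v \<bullet>c u + w \<bullet>c u"
  using assms by (intro add_scalar_prod_distrib[of _ n]) auto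

lemma hermitian_psd_add:
  assumes "hermitian_psd n A" "hermitian_psd n B"
  shows "hermitian_psd n (A + B)"
proof -
  note [simp] = hermitian_psd_carrier[OF assms(1)] hermitian_psd_carrier[OF assms(2)]
  have "((A + B) *\<^sub>v v) \<bullet>c v = (A *\<^sub>v v) \<bullet>c v + (B *\<^sub>v v) \<bullet>c v" if "v \<in> carrier_vec n" for v
    using that mult_mat_vec_carrier[of A n n v] mult_mat_vec_carrier[of B n n v]
    by (simp add: add_mult_distrib_mat_vec[of _ n n] cscalar_prod_add)
  then show ?thesis using hermitian_psd_form[OF assms(1)] hermitian_psd_form[OF assms(2)]
      hermitian_psd_adjoint[OF assms(1)] hermitian_psd_adjoint[OF assms(2)]
    by (simp add: hermitian_psd_def mat_adjoint_add[of _ n n])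
qed

lemma hermitian_psd_one: "hermitian_psd n (1\<^sub>m n)"
  using cscalar_prod_self_Re(1) by (auto simp: hermitian_psd_def)

lemma smult_mat_mult_vec:
  fixes A :: "'a :: comm_ring_1 mat"
  assumes "A \<in> carrier_mat n m" "v \<in> carrier_vec m"
  shows "(c \<cdot>\<^sub>m A) *\<^sub>v v = c \<cdot>\<^sub>v (A *\<^sub>v v)"
  using assms by (intro eq_vecI) (auto simp: scalar_prod_def sum_distrib_left ac_simps intro!: sum.cong)

lemma hermitian_psd_smult:
  assumes "hermitian_psd n A" "0 \<le> c"
  shows "hermitian_psd n (complex_of_real c \<cdot>\<^sub>m A)"
proof -
  note [simp] = hermitian_psd_carrier[OF assms(1)]
  have "((complex_of_real c \<cdot>\<^sub>m A) *\<^sub>v v) \<bullet>c v = complex_of_real c * ((A *\<^sub>v v) \<bullet>c v)"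
    if "v \<in> carrier_vec n" for v
    using that mult_mat_vec_carrier[of A n n v]
    by (simp add: smult_mat_mult_vec[of _ n n] smult_scalar_prod_distrib[of _ n])
  then show ?thesis
    using hermitian_psd_form[OF assms(1)] hermitian_psd_adjoint[OF assms(1)] assms(2)
    by (simp add: hermitian_psd_def mat_adjoint_smult)
qed

lemma hermitian_psd_adjoint_mult:
  assumes "C \<in> carrier_mat n m"
  shows "hermitian_psd m (mat_adjoint C * C)"
  using hermitian_psd_congruence[OF hermitian_psd_one assms] carrier_matD[OF assms] by simp

lemma hermitian_psd_mult_adjoint:
  assumes "C \<in> carrier_mat n m"
  shows "hermitian_psd n (C * mat_adjoint C)"
  using hermitian_psd_adjoint_mult[OF mat_adjoint_carrier[OF assms]] by simp

lemma mat_unit_vec_cscalar: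
  fixes A :: "complex mat"
  assumes "A \<in> carrier_mat n m" "i < n" "j < m"
  shows "(A *\<^sub>v unit_vec m j) \<bullet>c unit_vec n i = A $$ (i, j)"
proof -
  have "conjugate (unit_vec n i) = (unit_vec n i :: complex vec)"
    by (rule eq_vecI) (auto simp: unit_vec_def)
  then show ?thesis using assms by simp
qed

lemma hermitian_psd_diag:
  assumes "hermitian_psd n A" "i < n"
  shows "Re (A $$ (i, i)) \<ge> 0" "Im (A $$ (i, i)) = 0"
  using assms hermitian_psd_form[OF assms(1), of "unit_vec n i"]
    hermitian_form_Im[of A n "unit_vec n i"] mat_unit_vec_cscalar[of A n n i i]
  by (auto simp: hermitian_psd_def)

lemma hermitian_psd_trace:
  assumes "hermitian_psd n A"
  shows "Re (mat_trace A) \<ge> 0" "Im (mat_trace A) = 0"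
  using hermitian_psd_diag[OF assms] hermitian_psd_carrier[OF assms]
  by (auto simp: mat_trace_eq[of A n n] intro!: sum_nonneg)

section \<open>The resolvent of a positive semidefinite matrix\<close>

lemma one_plus_psd_det:
  assumes "hermitian_psd n H"
  shows "Determinant.det (1\<^sub>m n + H) \<noteq> 0"
proof
  note [simp] = hermitian_psd_carrier[OF assms]
  assume "Determinant.det (1\<^sub>m n + H) = 0"
  then obtain v where v [simp]: "v \<in> carrier_vec n" "v \<noteq> 0\<^sub>v n" and "(1\<^sub>m n + H) *\<^sub>v v = 0\<^sub>v n"
    using det_0_iff_vec_prod_zero_field[of "1\<^sub>m n + H" n] by auto
  then have "(v + H *\<^sub>v v) \<bullet>c v = 0"
    by (simp add: add_mult_distrib_mat_vec[of _ n n])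
  then have "Re (v \<bullet>c v) + Re ((H *\<^sub>v v) \<bullet>c v) = 0"
    using cscalar_prod_add[OF v(1) mult_mat_vec_carrier[of H n n v] v(1)] by (simp add: complex_eq_iff)
  with hermitian_psd_form[OF assms v(1)] cscalar_prod_self_Re(1)[of v] have "Re (v \<bullet>c v) = 0"
    by linarith
  with cscalar_prod_self_eq_0[OF v(1)] v(2) show False by simp
qed

lemma mat_add_diff_cancel:
  fixes A B :: "'a :: ab_group_add mat"
  assumes "A \<in> carrier_mat n m" "B \<in> carrier_mat n m"
  shows "A + B - A = B"
  using assms by (intro eq_matI) auto

lemma
  assumes H: "hermitian_psd n H"
  defines "Q \<equiv> minv (1\<^sub>m n + H)"
  shows minv_one_plus_psd: "Q \<in> carrier_mat n n" "(1\<^sub>m n + H) * Q = 1\<^sub>m n" "Q * (1\<^sub>m n + H) = 1\<^sub>m n"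
    and hermitian_psd_minv: "hermitian_psd n Q"
    and hermitian_psd_one_minus_minv: "hermitian_psd n (1\<^sub>m n - Q)"
    and one_minus_minv: "1\<^sub>m n - Q = H * Q" "1\<^sub>m n - Q = Q * H"
proof -
  have H' [simp]: "H \<in> carrier_mat n n" "mat_adjoint H = H" "dim_row H = n" "dim_col H = n" using H by (auto simp: hermitian_psd_def)
  let ?X = "1\<^sub>m n + H"
  have X [simp]: "?X \<in> carrier_mat n n" by simp
  show Q [simp]: "Q \<in> carrier_mat n n" and XQ: "?X * Q = 1\<^sub>m n" and QX: "Q * ?X = 1\<^sub>m n"
    unfolding Q_def by (rule minv[OF X one_plus_psd_det[OF H]])+
  have aX: "mat_adjoint ?X = ?X" by (simp add: mat_adjoint_add[of _ n n])
  have "?X * mat_adjoint Q = mat_adjoint (Q * ?X)"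
    by (simp add: mat_adjoint_mult[OF Q X] aX)
  then have "?X * mat_adjoint Q = 1\<^sub>m n" by (simp add: QX)
  then have aQ [simp]: "mat_adjoint Q = Q"
    using mat_inverse_unique[OF X _ Q _ XQ] by simp
  have "hermitian_psd n (mat_adjoint Q * ?X * Q)"
    by (rule hermitian_psd_congruence[OF hermitian_psd_add[OF hermitian_psd_one H] Q])
  then show psdQ: "hermitian_psd n Q" using Q by (simp add: QX)
  have HQ: "H * Q \<in> carrier_mat n n" "Q * H \<in> carrier_mat n n"
    by (intro mult_carrier_mat[of _ _ n]; simp)+
  have "1\<^sub>m n = Q + H * Q" using XQ left_mult_one_mat[OF Q] by (simp add: add_mult_distrib_mat[of _ n n _ _ n])
  then show eq1: "1\<^sub>m n - Q = H * Q"
    using HQ Q mat_add_diff_cancel by metis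
  have "1\<^sub>m n = Q + Q * H" using QX right_mult_one_mat[OF Q] by (simp add: mult_add_distrib_mat[of _ n n _ n])
  then show eq2: "1\<^sub>m n - Q = Q * H"
    using HQ Q mat_add_diff_cancel by metis
  \<comment> \<open>I - Q is the sum of the two semidefinite matrices Q H Q and (H Q)^H (H Q),
    because both together are Q (I + H) H Q = H Q.\<close>
  have "mat_adjoint Q * H * Q + mat_adjoint (H * Q) * (H * Q) = Q * ((1\<^sub>m n + H) * (H * Q))"
    using HQ left_mult_one_mat[OF HQ(1)] mult_carrier_mat[OF Q HQ(1)] mult_carrier_mat[OF H'(1) HQ(1)]
    by (simp add: mat_adjoint_mult[of _ n n _ n] assoc_mult_mat[of _ n n _ n _ n]
        add_mult_distrib_mat[of _ n n _ _ n] mult_add_distrib_mat[of _ n n _ n])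
  also have "\<dots> = 1\<^sub>m n - Q"
    using HQ QX by (simp add: eq1 assoc_mult_mat[OF Q X HQ(1), symmetric])
  finally show "hermitian_psd n (1\<^sub>m n - Q)"
    using hermitian_psd_add[OF hermitian_psd_congruence[OF H Q] hermitian_psd_adjoint_mult[OF HQ(1)]] by simp
qed

section \<open>The trace bound for log-determinants\<close>

lemma ex_schur_triangular:
  fixes M :: "complex mat"
  assumes "M \<in> carrier_mat n n"
  obtains es where "length es = n" "\<And>e. e \<in> set es \<Longrightarrow> eigenvalue M e"
    "char_poly M = (\<Prod>a\<leftarrow>es. [:- a, 1:])"
    "Determinant.det M = prod_list es" "mat_trace M = sum_list es"
proof -
  obtain es where es: "char_poly M = (\<Prod>a\<leftarrow>es. [:- a, 1:])" "length es = n"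
    using char_poly_factorized[OF assms] by auto
  obtain B P Q where schur: "schur_decomposition M es = (B, P, Q)" by (cases "schur_decomposition M es") auto
  from schur_decomposition[OF assms es(1) schur]
  have sim: "similar_mat_wit M B P Q" and ut: "upper_triangular B" and diag: "diag_mat B = es" by auto
  note w = similar_mat_witD2[OF assms sim]
  have "Determinant.det M = prod_list es"
    using det_similar[of M B] sim det_upper_triangular[OF ut w(5)] diag by (auto simp: similar_mat_def)
  moreover have "mat_trace M = mat_trace (Q * (P * B))"
    using w mat_trace_mult_comm[of "P * B" n n Q] by simp
  then have "mat_trace M = mat_trace B"
    using w by (simp flip: assoc_mult_mat[of Q n n P n B n])
  then have "mat_trace M = sum_list es"
    using w diag by (simp add: mat_trace_eq[of B n n] diag_mat_def interv_sum_list_conv_sum_set_nat flip: diag)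
      (simp add: lessThan_atLeast0)
  moreover have "eigenvalue M e" if "e \<in> set es" for e
    using that es by (auto simp: eigenvalue_root_char_poly[OF assms] poly_prod_list prod_list_zero_iff)
  ultimately show ?thesis using that es by blast
qed

text \<open>The scalar inequality \<open>ln x \<le> x - 1\<close>, summed. Realness is carried
  through the induction, since otherwise the real part of the product would not be the product of
  the real parts.\<close>

lemma ln_prod_list_le:
  fixes es :: "complex list"
  assumes "\<And>e. e \<in> set es \<Longrightarrow> Im e = 0 \<and> Re e > 0"
  shows "Im (prod_list es) = 0 \<and> Re (prod_list es) > 0 \<and>
    ln (Re (prod_list es)) \<le> Re (sum_list es) - real (length es)"
  using assms
proof (induction es)
  case (Cons e es)
  then have IH: "Im (prod_list es) = 0" "Re (prod_list es) > 0"
    "ln (Re (prod_list es)) \<le> Re (sum_list es) - real (length es)" and e: "Im e = 0" "Re e > 0" by auto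
  then show ?case using ln_le_minus_one[of "Re e"] by (simp add: ln_mult)
qed simp

lemma pos_eigenvalues_ln_det_le:
  fixes M :: "complex mat"
  assumes M: "M \<in> carrier_mat n n" and "\<And>e. eigenvalue M e \<Longrightarrow> Im e = 0 \<and> Re e > 0"
  shows "Im (Determinant.det M) = 0" "Re (Determinant.det M) > 0"
    "ln (Re (Determinant.det M)) \<le> Re (mat_trace M) - real n"
proof -
  obtain es where es: "length es = n" "\<And>e. e \<in> set es \<Longrightarrow> eigenvalue M e"
    "Determinant.det M = prod_list es" "mat_trace M = sum_list es"
    using ex_schur_triangular[OF M] by metis
  have "Im (prod_list es) = 0 \<and> Re (prod_list es) > 0 \<and>
    ln (Re (prod_list es)) \<le> Re (sum_list es) - real (length es)"
    using es(2) assms(2) by (intro ln_prod_list_le) blast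
  with es show "Im (Determinant.det M) = 0" "Re (Determinant.det M) > 0"
    "ln (Re (Determinant.det M)) \<le> Re (mat_trace M) - real n" by auto
qed

lemma one_plus_psd_form_pos:
  assumes H: "hermitian_psd n H" and v: "v \<in> carrier_vec n" "v \<noteq> 0\<^sub>v n"
  shows "Re (((1\<^sub>m n + H) *\<^sub>v v) \<bullet>c v) > 0" "Im (((1\<^sub>m n + H) *\<^sub>v v) \<bullet>c v) = 0"
proof -
  note [simp] = hermitian_psd_carrier[OF H]
  have "((1\<^sub>m n + H) *\<^sub>v v) \<bullet>c v = v \<bullet>c v + (H *\<^sub>v v) \<bullet>c v"
    using v cscalar_prod_add[OF v(1) mult_mat_vec_carrier[of H n n v] v(1)]
    by (simp add: add_mult_distrib_mat_vec[of _ n n])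
  moreover have "Re (v \<bullet>c v) > 0"
    using cscalar_prod_self_eq_0[OF v(1)] cscalar_prod_self_Re(1)[of v] v(2) by force
  ultimately show "Re (((1\<^sub>m n + H) *\<^sub>v v) \<bullet>c v) > 0" "Im (((1\<^sub>m n + H) *\<^sub>v v) \<bullet>c v) = 0"
    using hermitian_psd_form[OF H v(1)] cscalar_prod_self_Re(2)[of v]
      hermitian_form_Im[of H n v] hermitian_psd_adjoint[OF H] v by auto
qed

text \<open>The matrix Y^-1 X need not be Hermitian, but its determinant and trace are still the
  product and the sum of its eigenvalues. An eigenpair satisfies X v = e Y v, so e is a quotient of
  two positive forms at v, and \<open>ln x \<le> x - 1\<close> applies to each eigenvalue.\<close>

lemma ln_det_le_trace:
  assumes X: "hermitian_psd n H" and Y: "hermitian_psd n G"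
  shows "ln (Re (Determinant.det (1\<^sub>m n + H))) - ln (Re (Determinant.det (1\<^sub>m n + G)))
      \<le> Re (mat_trace (minv (1\<^sub>m n + G) * (1\<^sub>m n + H))) - real n"
proof -
  note [simp] = hermitian_psd_carrier[OF X] hermitian_psd_carrier[OF Y] carrier_matD[OF hermitian_psd_carrier[OF X]]
  have eig: "Im e = 0 \<and> Re e > 0"
    if e: "eigenvalue (minv (1\<^sub>m n + K) * (1\<^sub>m n + H)) e" and K: "hermitian_psd n K" for K e
  proof -
    note [simp] = hermitian_psd_carrier[OF K]
    note mi = minv_one_plus_psd[OF K]
    have car: "minv (1\<^sub>m n + K) * (1\<^sub>m n + H) \<in> carrier_mat n n"
      using mi by (auto intro!: mult_carrier_mat)
    obtain v where v [simp]: "v \<in> carrier_vec n" "v \<noteq> 0\<^sub>v n"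
      and ev: "minv (1\<^sub>m n + K) * (1\<^sub>m n + H) *\<^sub>v v = e \<cdot>\<^sub>v v"
      using e unfolding eigenvalue_def eigenvector_def carrier_matD(1)[OF car] by auto
    have Hv [simp]: "(1\<^sub>m n + H) *\<^sub>v v \<in> carrier_vec n" "(1\<^sub>m n + K) *\<^sub>v v \<in> carrier_vec n"
      by (intro mult_mat_vec_carrier[of _ n n]; simp)+
    have "(1\<^sub>m n + H) *\<^sub>v v = (1\<^sub>m n + K) * minv (1\<^sub>m n + K) *\<^sub>v ((1\<^sub>m n + H) *\<^sub>v v)"
      using mi by simp
    also have "\<dots> = (1\<^sub>m n + K) *\<^sub>v (minv (1\<^sub>m n + K) *\<^sub>v ((1\<^sub>m n + H) *\<^sub>v v))"
      using mi by (intro assoc_mult_mat_vec[of _ n n _ n]) auto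
    also have "minv (1\<^sub>m n + K) *\<^sub>v ((1\<^sub>m n + H) *\<^sub>v v) = e \<cdot>\<^sub>v v"
      using ev mi by (subst assoc_mult_mat_vec[of _ n n _ n, symmetric]) auto
    also have "(1\<^sub>m n + K) *\<^sub>v (e \<cdot>\<^sub>v v) = e \<cdot>\<^sub>v ((1\<^sub>m n + K) *\<^sub>v v)"
      by (intro mult_mat_vec[of _ n n]) auto
    finally have "((1\<^sub>m n + H) *\<^sub>v v) \<bullet>c v = e * (((1\<^sub>m n + K) *\<^sub>v v) \<bullet>c v)"
      by (simp add: smult_scalar_prod_distrib[of _ n])
    then show ?thesis
      using one_plus_psd_form_pos[OF X v] one_plus_psd_form_pos[OF K v]
      by (auto simp: complex_eq_iff zero_less_mult_iff)
  qed
  \<comment> \<open>With zero in the place of \<open>K\<close>, \<open>eig\<close> speaks about I +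
    H alone and makes its determinant positive; that of I + G is then positive as a quotient, as
    needed to split the logarithm.\<close>
  have z: "hermitian_psd n (0\<^sub>m n n)"
    using hermitian_psd_smult[OF hermitian_psd_one[of n], of 0]
    by (simp add: smult_mat_def zero_mat_def map_mat_def one_mat_def)
  have "minv (1\<^sub>m n + 0\<^sub>m n n) = (1\<^sub>m n :: complex mat)"
    using minv_one_plus_psd[OF z] by simp
  then have "minv (1\<^sub>m n + 0\<^sub>m n n) * (1\<^sub>m n + H) = 1\<^sub>m n + H" by simp
  then have "Im e = 0 \<and> Re e > 0" if "eigenvalue (1\<^sub>m n + H) e" for e
    using eig[OF _ z] that by metis
  note 1 = pos_eigenvalues_ln_det_le[OF _ this, of "1\<^sub>m n + H" n, simplified]
  note mi = minv_one_plus_psd[OF Y]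
  have car: "minv (1\<^sub>m n + G) * (1\<^sub>m n + H) \<in> carrier_mat n n"
    using mi by (auto intro!: mult_carrier_mat)
  note 2 = pos_eigenvalues_ln_det_le[OF car eig[OF _ Y]]
  have "Determinant.det ((1\<^sub>m n + G) * (minv (1\<^sub>m n + G) * (1\<^sub>m n + H))) = Determinant.det (1\<^sub>m n + H)"
    using mi by (subst assoc_mult_mat[of _ n n _ n _ n, symmetric]) auto
  then have d: "Determinant.det (1\<^sub>m n + H) = Determinant.det (1\<^sub>m n + G) *
      Determinant.det (minv (1\<^sub>m n + G) * (1\<^sub>m n + H))"
    using det_mult[of "1\<^sub>m n + G" n, OF _ car] by simp
  have "Re (Determinant.det (1\<^sub>m n + G)) \<noteq> 0"
    using d 1 2(1) by auto
  then have "Re (Determinant.det (1\<^sub>m n + G)) > 0"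
    using d 1 2(1,2) by (auto simp: zero_less_mult_iff)
  with d 2 show "ln (Re (Determinant.det (1\<^sub>m n + H))) - ln (Re (Determinant.det (1\<^sub>m n + G)))
      \<le> Re (mat_trace (minv (1\<^sub>m n + G) * (1\<^sub>m n + H))) - real n"
    by (simp add: ln_mult)
qed

section \<open>The spectral theorem and its consequences\<close>

definition diagm :: "nat \<Rightarrow> (nat \<Rightarrow> real) \<Rightarrow> complex mat" where
  "diagm n d = Matrix.mat n n (\<lambda>(i, j). if i = j then complex_of_real (d i) else 0)"

definition unitary_mat :: "nat \<Rightarrow> complex mat \<Rightarrow> bool" where
  "unitary_mat n U \<longleftrightarrow> U \<in> carrier_mat n n \<and> mat_adjoint U * U = 1\<^sub>m n \<and> U * mat_adjoint U = 1\<^sub>m n"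

lemma diagm_simps [simp]:
  "diagm n d \<in> carrier_mat n n" "dim_row (diagm n d) = n" "dim_col (diagm n d) = n"
  "i < n \<Longrightarrow> j < n \<Longrightarrow> diagm n d $$ (i, j) = (if i = j then complex_of_real (d i) else 0)"
  by (auto simp: diagm_def)

lemma unitary_matI:
  assumes "U \<in> carrier_mat n n" "mat_adjoint U * U = 1\<^sub>m n"
  shows "unitary_mat n U"
  using assms mat_mult_left_right_inverse[of "mat_adjoint U" n U] by (auto simp: unitary_mat_def)

lemma unitary_matD:
  assumes "unitary_mat n U"
  shows "U \<in> carrier_mat n n" "mat_adjoint U * U = 1\<^sub>m n" "U * mat_adjoint U = 1\<^sub>m n"
    "dim_row U = n" "dim_col U = n"
  using assms by (auto simp: unitary_mat_def)

lemma unitary_mat_mult: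
  assumes "unitary_mat n U" "unitary_mat n V"
  shows "unitary_mat n (U * V)"
proof (rule unitary_matI)
  note [simp] = unitary_matD(1,4,5)[OF assms(1)] unitary_matD(1,4,5)[OF assms(2)]
  show "U * V \<in> carrier_mat n n" by (rule mult_carrier_mat[of _ _ n]) simp_all
  have "mat_adjoint (U * V) * (U * V) = mat_adjoint V * (mat_adjoint U * U) * V"
    by (simp add: mat_adjoint_mult_dim assoc_mult_dim)
  then show "mat_adjoint (U * V) * (U * V) = 1\<^sub>m n"
    by (simp add: unitary_matD(2)[OF assms(1)] unitary_matD(2)[OF assms(2)])
qed

lemma ex_unitary_first_col:
  fixes v :: "complex vec"
  assumes v: "v \<in> carrier_vec n" "v \<noteq> 0\<^sub>v n"
  obtains W c where "unitary_mat n W" "col W 0 = c \<cdot>\<^sub>v v"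
proof -
  interpret cof_vec_space n "TYPE(complex)" .
  define b where "b = basis_completion v"
  define ws where "ws = gram_schmidt n b"
  from basis_completion[OF v, folded b_def]
  have b: "distinct b" "\<not> lin_dep (set b)" "set b \<subseteq> carrier_vec n" "hd b = v" "length b = n"
    by auto
  from gram_schmidt_result[OF b(3,1,2) refl, folded ws_def] b(5)
  have ws: "set ws \<subseteq> carrier_vec n" "corthogonal ws" "length ws = n" by auto
  have n: "0 < n" using v by (cases n) auto
  have hd: "ws ! 0 = v"
  proof -
    obtain vs where "b = v # vs" using b(4,5) n by (cases b) auto
    then have "hd ws = v" using gram_schmidt_hd[OF v(1), of vs] by (simp add: ws_def)
    then show ?thesis using ws(3) n by (cases ws) auto
  qed
  \<comment> \<open>Gram--Schmidt only makes the vectors orthogonal; \<open>r\<close> divides by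
    their lengths. The first vector is kept, so the first column becomes a multiple of
    \<open>v\<close>.\<close>
  define r where "r i = complex_of_real (1 / sqrt (Re (ws ! i \<bullet>c ws ! i)))" for i
  define W where "W = Matrix.mat n n (\<lambda>(i, j). r j * ws ! j $ i)"
  have W [simp]: "W \<in> carrier_mat n n" "dim_row W = n" "dim_col W = n" by (auto simp: W_def)
  have wsc: "ws ! i \<in> carrier_vec n" if "i < n" for i using ws that by auto
  have "mat_adjoint W * W = 1\<^sub>m n"
  proof (rule eq_matI; simp)
    fix i j assume ij: "i < n" "j < n"
    have "row (mat_adjoint W) i \<bullet> col W j = (\<Sum>k<n. cnj (r i * ws ! i $ k) * (r j * ws ! j $ k))"
      using ij by (auto simp: scalar_prod_def lessThan_atLeast0 W_def intro!: sum.cong)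
    also have "\<dots> = cnj (r i) * r j * (ws ! j \<bullet>c ws ! i)"
      using ij wsc[of i] wsc[of j] by (auto simp: scalar_prod_def lessThan_atLeast0 sum_distrib_left ac_simps intro!: sum.cong)
    also have "\<dots> = (if i = j then 1 else 0)"
    proof (cases "i = j")
      case True
      have "ws ! i \<bullet>c ws ! i \<noteq> 0" using corthogonalD[OF ws(2), of i i] ij ws by auto
      then have "Re (ws ! i \<bullet>c ws ! i) > 0"
        using cscalar_prod_self_Re[of "ws ! i"] by (auto simp: complex_eq_iff less_le)
      then have "cnj (r i) * r i * of_real (Re (ws ! i \<bullet>c ws ! i)) = 1"
        by (simp add: r_def flip: of_real_mult)
      moreover have "of_real (Re (ws ! i \<bullet>c ws ! i)) = ws ! i \<bullet>c ws ! i"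
        using cscalar_prod_self_Re[of "ws ! i"] by (simp add: complex_eq_iff)
      ultimately show ?thesis using True by simp
    next
      case False
      then show ?thesis using corthogonalD[OF ws(2), of j i] ij ws by auto
    qed
    finally show "(i = j \<longrightarrow> row (mat_adjoint W) j \<bullet> col W j = 1) \<and>
      (i \<noteq> j \<longrightarrow> row (mat_adjoint W) i \<bullet> col W j = 0)" by auto
  qed
  then have "unitary_mat n W" by (intro unitary_matI) simp_all
  moreover have "col W 0 = r 0 \<cdot>\<^sub>v v"
    using n hd v by (intro eq_vecI) (auto simp: W_def)
  ultimately show ?thesis using that by blast
qed

lemma ex_eigenvector_complex:
  fixes A :: "complex mat"
  assumes "A \<in> carrier_mat n n" "0 < n"
  obtains v e where "v \<in> carrier_vec n" "v \<noteq> 0\<^sub>v n" "A *\<^sub>v v = e \<cdot>\<^sub>v v"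
proof -
  obtain es where "length es = n" "\<And>e. e \<in> set es \<Longrightarrow> eigenvalue A e"
    using ex_schur_triangular[OF assms(1)] by metis
  then have "eigenvalue A (es ! 0)" using assms by auto
  then show ?thesis using that assms by (auto simp: eigenvalue_def eigenvector_def)
qed

text \<open>Deflation. A unitary matrix whose first column is an eigenvector transforms
  \<open>A\<close> so that the first column is a multiple of the first unit vector; the result is
  Hermitian, so its first row has the same shape, and the induction hypothesis handles the remaining
  block.\<close>

theorem hermitian_spectral:
  fixes A :: "complex mat"
  assumes "A \<in> carrier_mat n n" "mat_adjoint A = A"
  shows "\<exists>U d. unitary_mat n U \<and> A = U * diagm n d * mat_adjoint U"
  using assms
proof (induction n arbitrary: A)
  case 0
  then show ?case
    by (intro exI[of _ "1\<^sub>m 0"] exI[of _ "\<lambda>_. 0"]) (auto simp: unitary_mat_def)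
next
  case (Suc n)
  note [simp] = Suc.prems carrier_matD[OF Suc.prems(1)]
  obtain v e where v: "v \<in> carrier_vec (Suc n)" "v \<noteq> 0\<^sub>v (Suc n)" "A *\<^sub>v v = e \<cdot>\<^sub>v v"
    using ex_eigenvector_complex[OF Suc.prems(1)] by auto
  obtain W c where W: "unitary_mat (Suc n) W" and c: "col W 0 = c \<cdot>\<^sub>v v"
    using ex_unitary_first_col[OF v(1,2)] by blast
  note [simp] = unitary_matD(1,4,5)[OF W]
  define B where "B = mat_adjoint W * A * W"
  have B [simp]: "B \<in> carrier_mat (Suc n) (Suc n)" "dim_row B = Suc n" "dim_col B = Suc n"
    unfolding B_def by auto
  have aB: "mat_adjoint B = B" by (simp add: B_def mat_adjoint_mult_dim assoc_mult_dim)
  have "col B 0 = B *\<^sub>v unit_vec (Suc n) 0"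
    by (rule eq_vecI) auto
  also have "\<dots> = mat_adjoint W *\<^sub>v (A *\<^sub>v (W *\<^sub>v unit_vec (Suc n) 0))"
    by (simp add: B_def assoc_mult_vec_dim)
  also have "W *\<^sub>v unit_vec (Suc n) 0 = col W 0" by (rule eq_vecI) auto
  also have "A *\<^sub>v (col W 0) = e \<cdot>\<^sub>v col W 0"
    unfolding c using v by (simp add: mult_mat_vec[of _ "Suc n" "Suc n"] smult_smult_assoc mult.commute)
  also have "mat_adjoint W *\<^sub>v (e \<cdot>\<^sub>v col W 0) = e \<cdot>\<^sub>v col (mat_adjoint W * W) 0"
  proof -
    have cW: "col W 0 \<in> carrier_vec (Suc n)" by (rule carrier_vecI) simp
    have "mat_adjoint W *\<^sub>v (e \<cdot>\<^sub>v col W 0) = e \<cdot>\<^sub>v (mat_adjoint W *\<^sub>v col W 0)"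
      using cW by (intro mult_mat_vec[of _ "Suc n" "Suc n"]) simp_all
    also have "mat_adjoint W *\<^sub>v col W 0 = col (mat_adjoint W * W) 0"
      by (rule eq_vecI) simp_all
    finally show ?thesis .
  qed
  finally have colB: "B $$ (i, 0) = (if i = 0 then e else 0)" if "i < Suc n" for i
    using that by (auto simp: unitary_matD[OF W] vec_eq_iff)
  have hB: "cnj (B $$ (j, i)) = B $$ (i, j)" if "i < Suc n" "j < Suc n" for i j
    using that arg_cong[OF aB, of "\<lambda>M. M $$ (i, j)"] by simp
  have rowB: "B $$ (0, i) = cnj (B $$ (i, 0))" if "i < Suc n" for i
    using that hB[of 0 i] by simp
  have e: "Im e = 0" using rowB[of 0] colB[of 0] by (simp add: complex_eq_iff)
  define B' where "B' = Matrix.mat n n (\<lambda>(i, j). B $$ (Suc i, Suc j))"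
  have "B' \<in> carrier_mat n n" "mat_adjoint B' = B'"
    using hB by (auto simp: B'_def intro!: eq_matI)
  from Suc.IH[OF this] obtain U d where U: "unitary_mat n U" and B'U: "B' = U * diagm n d * mat_adjoint U"
    by blast
  note [simp] = unitary_matD(1,4,5)[OF U]
  define d' where "d' i = (if i = 0 then Re e else d (i - 1))" for i
  define V where "V = four_block_mat (1\<^sub>m 1) (0\<^sub>m 1 n) (0\<^sub>m n 1) U"
  have V [simp]: "V \<in> carrier_mat (Suc n) (Suc n)" "dim_row V = Suc n" "dim_col V = Suc n" by (auto simp: V_def)
  have aV: "mat_adjoint V = four_block_mat (1\<^sub>m 1) (0\<^sub>m 1 n) (0\<^sub>m n 1) (mat_adjoint U)"
    by (rule eq_matI) (auto simp: V_def)
  have "mat_adjoint V * V = 1\<^sub>m (Suc n)"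
    unfolding aV unfolding V_def
    by (subst mult_four_block_mat[of _ 1 1 _ n _ n _ _ 1 _ n]) (auto simp: unitary_matD[OF U])
  then have uV: "unitary_mat (Suc n) V" by (intro unitary_matI) simp_all
  have D: "diagm (Suc n) d' = four_block_mat (Re e \<cdot>\<^sub>m 1\<^sub>m 1) (0\<^sub>m 1 n) (0\<^sub>m n 1) (diagm n d)"
    by (rule eq_matI) (auto simp: d'_def)
  have Bb: "B = four_block_mat (Re e \<cdot>\<^sub>m 1\<^sub>m 1) (0\<^sub>m 1 n) (0\<^sub>m n 1) B'"
    using e colB rowB by (intro eq_matI) (auto simp: B'_def complex_eq_iff)
  have VD: "V * diagm (Suc n) d' = four_block_mat (Re e \<cdot>\<^sub>m 1\<^sub>m 1) (0\<^sub>m 1 n) (0\<^sub>m n 1) (U * diagm n d)"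
    unfolding D V_def
    by (subst mult_four_block_mat[of _ 1 1 _ n _ n _ _ 1 _ n]) auto
  have "V * diagm (Suc n) d' * mat_adjoint V = B"
    unfolding VD aV Bb
    by (subst mult_four_block_mat[of _ 1 1 _ n _ n _ _ 1 _ n]) (auto simp: B'U)
  moreover have "A = (W * mat_adjoint W) * A * (W * mat_adjoint W)"
    by (simp add: unitary_matD[OF W])
  then have "A = W * B * mat_adjoint W"
    by (simp add: B_def assoc_mult_dim)
  ultimately have "A = W * (V * diagm (Suc n) d' * mat_adjoint V) * mat_adjoint W" by simp
  then have "A = (W * V) * diagm (Suc n) d' * mat_adjoint (W * V)"
    by (simp add: mat_adjoint_mult_dim assoc_mult_dim)
  with unitary_mat_mult[OF W uV] show ?case by blast
qed

lemma unitary_diag_col: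
  assumes U: "unitary_mat n U" and A: "A = U * diagm n d * mat_adjoint U" and i: "i < n"
  shows "A *\<^sub>v col U i = complex_of_real (d i) \<cdot>\<^sub>v col U i"
proof -
  note [simp] = unitary_matD(1,4,5)[OF U]
  have "A * U = U * diagm n d" unfolding A
    by (simp add: assoc_mult_dim unitary_matD(2)[OF U])
  then have "col (A * U) i = col (U * diagm n d) i" by simp
  moreover have "col (A * U) i = A *\<^sub>v col U i"
    using i by (intro eq_vecI) (simp_all add: A)
  moreover have "col (U * diagm n d) i = complex_of_real (d i) \<cdot>\<^sub>v col U i"
  proof (rule eq_vecI)
    fix j assume "j < dim_vec (complex_of_real (d i) \<cdot>\<^sub>v col U i)"
    then have j: "j < n" by simp
    have "col (U * diagm n d) i $ j = (\<Sum>k<n. U $$ (j, k) * (if k = i then complex_of_real (d i) else 0))"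
      using i j by (auto simp: scalar_prod_def lessThan_atLeast0 intro!: sum.cong)
    also have "\<dots> = U $$ (j, i) * complex_of_real (d i)"
      using i by (simp add: if_distrib[of "\<lambda>x. _ * x"] cong: if_cong)
    finally show "col (U * diagm n d) i $ j = (complex_of_real (d i) \<cdot>\<^sub>v col U i) $ j"
      using i j by simp
  qed simp
  ultimately show ?thesis by simp
qed

lemma unitary_cscalar_col:
  assumes U: "unitary_mat n U" and "i < n" "j < n"
  shows "col U i \<bullet>c col U j = (if i = j then 1 else 0)"
proof -
  note [simp] = unitary_matD(1,4,5)[OF U]
  have "col U i \<bullet>c col U j = (mat_adjoint U * U) $$ (j, i)"
    using assms by (auto simp: scalar_prod_def mult.commute intro!: sum.cong)
  then show ?thesis using assms unitary_matD(2)[OF U] by auto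
qed

lemma hermitian_psd_spectral:
  assumes "hermitian_psd n A"
  obtains U d where "unitary_mat n U" "A = U * diagm n d * mat_adjoint U" "\<And>i. i < n \<Longrightarrow> 0 \<le> d i"
proof -
  obtain U d where U: "unitary_mat n U" and A: "A = U * diagm n d * mat_adjoint U"
    using hermitian_spectral[of A n] assms by (auto simp: hermitian_psd_def)
  have "0 \<le> d i" if i: "i < n" for i
  proof -
    have "col U i \<in> carrier_vec n" using unitary_matD[OF U] by (intro carrier_vecI) simp
    from hermitian_psd_form[OF assms this] show ?thesis
      using i unitary_diag_col[OF U A i] unitary_cscalar_col[OF U i i] \<open>col U i \<in> carrier_vec n\<close>
      by (simp add: smult_scalar_prod_distrib[of _ n])
  qed
  with that[OF U A] show ?thesis by blast
qed

section \<open>Diagonal matrices and the positive semidefinite square root\<close>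

lemma row_diagm_scalar_prod:
  assumes "i < n" "dim_vec w = n"
  shows "row (diagm n d) i \<bullet> w = complex_of_real (d i) * w $ i"
proof -
  have "row (diagm n d) i \<bullet> w = (\<Sum>k\<in>{0..<n}. if k = i then complex_of_real (d i) * w $ i else 0)"
    unfolding scalar_prod_def assms(2) using assms by (intro sum.cong) auto
  then show ?thesis using assms by simp
qed

lemma diagm_mult: "diagm n d * diagm n e = diagm n (\<lambda>i. d i * e i)"
  by (rule eq_matI) (auto simp: row_diagm_scalar_prod)

lemma mat_adjoint_diagm [simp]: "mat_adjoint (diagm n d) = diagm n d"
  by (rule eq_matI) auto

lemma diagm_cong: "(\<And>i. i < n \<Longrightarrow> d i = e i) \<Longrightarrow> diagm n d = diagm n e"
  by (rule eq_matI) auto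

lemma diagm_sqrt:
  assumes "\<And>i. i < n \<Longrightarrow> 0 \<le> d i"
  shows "diagm n (\<lambda>i. sqrt (d i)) * diagm n (\<lambda>i. sqrt (d i)) = diagm n d"
  unfolding diagm_mult using assms by (intro diagm_cong) simp

lemma hermitian_psd_diagm:
  assumes "\<And>i. i < n \<Longrightarrow> 0 \<le> d i"
  shows "hermitian_psd n (diagm n d)"
  using hermitian_psd_adjoint_mult[of "diagm n (\<lambda>i. sqrt (d i))" n n] diagm_sqrt[OF assms] by simp

lemma hermitian_psd_sqrt_exists:
  assumes "hermitian_psd n A"
  shows "\<exists>B. hermitian_psd n B \<and> B * B = A"
proof -
  obtain U d where U: "unitary_mat n U" and A: "A = U * diagm n d * mat_adjoint U" and d: "\<And>i. i < n \<Longrightarrow> 0 \<le> d i"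
    using hermitian_psd_spectral[OF assms(1)] by blast
  note [simp] = unitary_matD(1,4,5)[OF U]
  let ?D = "diagm n (\<lambda>i. sqrt (d i))"
  have DD: "?D * ?D = diagm n d" by (rule diagm_sqrt[OF d])
  have "hermitian_psd n (U * ?D * mat_adjoint U)"
    using hermitian_psd_congruence[OF hermitian_psd_diagm, of n "\<lambda>i. sqrt (d i)" "mat_adjoint U" n] d by simp
  moreover have "(U * ?D * mat_adjoint U) * (U * ?D * mat_adjoint U) = U * (?D * (mat_adjoint U * U) * ?D) * mat_adjoint U"
    by (simp add: assoc_mult_dim)
  then have "(U * ?D * mat_adjoint U) * (U * ?D * mat_adjoint U) = A"
    by (simp add: unitary_matD(2)[OF U] DD A)
  ultimately show ?thesis by blast
qed

text \<open>Makes the description in \<open>psd_sqrt\<close> definite. At a unit eigenvector v of B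
  - C with eigenvalue d, the vectors B v and C v have equal norms, which gives d (b + c) = 0 for the
  forms b and c of B and C at v. If d were nonzero, both nonnegative forms would vanish,
  contradicting b = c + d.\<close>

lemma hermitian_psd_sqrt_unique:
  assumes B: "hermitian_psd n B" and C: "hermitian_psd n C" and BC: "B * B = C * C"
  shows "B = C"
proof -
  note [simp] = hermitian_psd_carrier[OF B] hermitian_psd_carrier[OF C]
    carrier_matD[OF hermitian_psd_carrier[OF B]] carrier_matD[OF hermitian_psd_carrier[OF C]]
  define D where "D = B - C"
  have D [simp]: "D \<in> carrier_mat n n" "dim_row D = n" "dim_col D = n" by (auto simp: D_def)
  have B_eq: "B = C + D" unfolding D_def by (intro eq_matI) auto
  have aD: "mat_adjoint D = D"
  proof -
    have "mat_adjoint (C + D) = C + mat_adjoint D"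
      using hermitian_psd_adjoint[OF C] by (subst mat_adjoint_add[of _ n n]) auto
    then have "C + mat_adjoint D = C + D" using hermitian_psd_adjoint[OF B] B_eq by simp
    then show ?thesis by (metis D(1) mat_adjoint_carrier mat_add_diff_cancel hermitian_psd_carrier C)
  qed
  obtain U d where U: "unitary_mat n U" and DU: "D = U * diagm n d * mat_adjoint U"
    using hermitian_spectral[OF D(1) aD] by blast
  note [simp] = unitary_matD(1,4,5)[OF U]
  have "d i = 0" if i: "i < n" for i
  proof (rule ccontr)
    assume di: "d i \<noteq> 0"
    define v where "v = col U i"
    have v [simp]: "v \<in> carrier_vec n" unfolding v_def by (rule carrier_vecI) simp
    have Dv: "D *\<^sub>v v = complex_of_real (d i) \<cdot>\<^sub>v v" unfolding v_def by (rule unitary_diag_col[OF U DU i])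
    have car [simp]: "B *\<^sub>v v \<in> carrier_vec n" "C *\<^sub>v v \<in> carrier_vec n"
      by (rule mult_mat_vec_carrier[of _ n n]; simp)+
    have Bv: "B *\<^sub>v v = C *\<^sub>v v + complex_of_real (d i) \<cdot>\<^sub>v v"
      unfolding B_eq using Dv by (simp add: add_mult_distrib_mat_vec[of _ n n])
    have sym: "(E *\<^sub>v u) \<bullet>c v = u \<bullet>c (E *\<^sub>v v)" if "hermitian_psd n E" "u \<in> carrier_vec n" for E u
      using cscalar_prod_adjoint[OF hermitian_psd_carrier[OF that(1)] that(2) v] hermitian_psd_adjoint[OF that(1)] by simp
    have "(B *\<^sub>v v) \<bullet>c (B *\<^sub>v v) = ((B * B) *\<^sub>v v) \<bullet>c v"
      using sym[OF B car(1)] by (simp add: assoc_mult_mat_vec[of _ n n _ n])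
    also have "\<dots> = (C *\<^sub>v v) \<bullet>c (C *\<^sub>v v)"
      unfolding BC using sym[OF C car(2)] by (simp add: assoc_mult_mat_vec[of _ n n _ n])
    finally have eq: "(B *\<^sub>v v) \<bullet>c (B *\<^sub>v v) = (C *\<^sub>v v) \<bullet>c (C *\<^sub>v v)" .
    have 1: "(B *\<^sub>v v) \<bullet>c u = (C *\<^sub>v v) \<bullet>c u + complex_of_real (d i) * (v \<bullet>c u)" if "u \<in> carrier_vec n" for u
      unfolding Bv using that by (subst cscalar_prod_add[of _ n]) (auto simp: smult_scalar_prod_distrib[of _ n])
    have 2: "u \<bullet>c (B *\<^sub>v v) = u \<bullet>c (C *\<^sub>v v) + complex_of_real (d i) * (u \<bullet>c v)" if u: "u \<in> carrier_vec n" for u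
      using arg_cong[OF 1[OF u], of cnj] cscalar_prod_cnj[of _ u] carrier_vecD[OF u] carrier_vecD[OF v]
        carrier_vecD[OF car(1)] carrier_vecD[OF car(2)] by simp
    define b where "b = Re ((B *\<^sub>v v) \<bullet>c v)"
    define c where "c = Re ((C *\<^sub>v v) \<bullet>c v)"
    have pos: "0 \<le> b" "0 \<le> c"
      using hermitian_psd_form[OF B v] hermitian_psd_form[OF C v] by (auto simp: b_def c_def)
    have bc: "b = c + d i"
      using 1[OF v] unitary_cscalar_col[OF U i i] by (simp add: b_def c_def v_def)
    have "complex_of_real (d i) * ((B *\<^sub>v v) \<bullet>c v + (C *\<^sub>v v) \<bullet>c v) = 0"
      using eq 2[OF car(1)] 1[OF car(2)] sym[OF C v] by (simp add: algebra_simps)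
    then have "b + c = 0" using di by (simp add: b_def c_def complex_eq_iff)
    with pos bc di show False by simp
  qed
  then have "diagm n d = 0\<^sub>m n n" by (intro eq_matI) auto
  then have "D = 0\<^sub>m n n" unfolding DU by simp
  then show ?thesis using B_eq by simp
qed

lemma psd_sqrt:
  assumes "hermitian_psd n A"
  shows "hermitian_psd n (psd_sqrt A)" "psd_sqrt A * psd_sqrt A = A"
proof -
  have "\<exists>!B. hermitian_psd (dim_row A) B \<and> B * B = A"
    using hermitian_psd_sqrt_exists[OF assms] hermitian_psd_sqrt_unique
      carrier_matD[OF hermitian_psd_carrier[OF assms]] by metis
  from theI'[OF this] show "hermitian_psd n (psd_sqrt A)" "psd_sqrt A * psd_sqrt A = A"
    using carrier_matD[OF hermitian_psd_carrier[OF assms]] by (auto simp: psd_sqrt_def)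
qed

section \<open>Rank and nonzero eigenvalues\<close>

lemma unitary_cols_lin_indpt:
  assumes U: "unitary_mat n (U :: complex mat)"
  shows "distinct (cols U)" "\<not> module.lin_dep class_ring (module_vec TYPE(complex) n) (set (cols U))"
proof -
  interpret vec_space "TYPE(complex)" n .
  note [simp] = unitary_matD(1,4,5)[OF U]
  have inj: "i = j" if "i < n" "j < n" "col U i = col U j" for i j
    using that unitary_cscalar_col[OF U that(1,2)] unitary_cscalar_col[OF U that(1,1)] by (auto split: if_splits)
  show dist: "distinct (cols U)"
    using inj by (auto simp: distinct_conv_nth)
  show "\<not> lin_dep (set (cols U))"
  proof
    assume "lin_dep (set (cols U))"
    then obtain v where v: "v \<in> carrier_vec n" "v \<noteq> 0\<^sub>v n" "U *\<^sub>v v = 0\<^sub>v n"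
      using lin_depE[OF _ _ dist, of n] by auto
    have "v = mat_adjoint U * U *\<^sub>v v" using v(1) by (simp add: unitary_matD(2)[OF U])
    also have "\<dots> = mat_adjoint U *\<^sub>v 0\<^sub>v n"
      using v by (subst assoc_mult_mat_vec[of _ n n _ n]) simp_all
    also have "\<dots> = 0\<^sub>v n" by (rule eq_vecI) (simp_all add: scalar_prod_def)
    finally show False using v(2) by simp
  qed
qed

text \<open>A column of \<open>U\<close> with \<open>d i\<close> nonzero is \<open>A\<close> applied
  to its own multiple by \<open>1 / d i\<close>, hence lies in the column space; these columns are
  linearly independent.\<close>

lemma card_nonzero_eigenvalues_le_rank:
  assumes U: "unitary_mat n U" and A: "A = U * diagm n d * mat_adjoint U"
  shows "card {i. i < n \<and> d i \<noteq> 0} \<le> vec_space.rank n A"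
proof -
  interpret vec_space "TYPE(complex)" n .
  note [simp] = unitary_matD(1,4,5)[OF U]
  have Ac: "A \<in> carrier_mat n n" unfolding A by (intro mult_carrier_mat[of _ _ n]) simp_all
  have cA: "set (cols A) \<subseteq> carrier_vec n" using Ac cols_dim by blast
  define J where "J = {i. i < n \<and> d i \<noteq> 0}"
  define L where "L = col U ` J"
  have LU: "L \<subseteq> set (cols U)" by (auto simp: L_def J_def cols_def)
  have L_indpt: "lin_indpt L"
    using unitary_cols_lin_indpt(2)[OF U] LU supset_ld_is_ld by blast
  have inj: "inj_on (col U) J"
    using unitary_cols_lin_indpt(1)[OF U] by (auto simp: inj_on_def J_def distinct_conv_nth)
  have L_span: "L \<subseteq> span (set (cols A))"
  proof
    fix x assume "x \<in> L"
    then obtain i where i: "i < n" "d i \<noteq> 0" "x = col U i" by (auto simp: L_def J_def)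
    have c: "col U i \<in> carrier_vec n" by (rule carrier_vecI) simp
    have "A *\<^sub>v (complex_of_real (1 / d i) \<cdot>\<^sub>v col U i) = col U i"
      using mult_mat_vec[OF Ac c] unitary_diag_col[OF U A i(1)] i(2)
      by (simp add: smult_smult_assoc flip: of_real_mult)
    then have "col U i \<in> col_space A"
      using c carrier_matD[OF Ac] unfolding col_space_eq[OF Ac]
      by (auto intro!: bexI[of _ "complex_of_real (1 / d i) \<cdot>\<^sub>v col U i"])
    then show "x \<in> span (set (cols A))" by (simp add: i col_space_def)
  qed
  have vs: "vectorspace class_ring (span_vs (set (cols A)))"
    using subspace_is_vs[OF span_is_subspace] cA by simp
  have sub: "submodule class_ring (span (set (cols A))) V"
    using span_is_submodule cA by simp
  have indpt': "LinearCombinations.module.lin_indpt class_ring (span_vs (set (cols A))) L"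
    using span_li_not_depend(2)[OF L_span sub] L_indpt by simp
  have fd: "vectorspace.fin_dim class_ring (span_vs (set (cols A)))"
    using fin_dim_span[of "set (cols A)"] cA by simp
  have "card L \<le> rank A"
    unfolding rank_def using L_span by (intro vectorspace.li_le_dim(2)[OF vs fd _ indpt']) simp
  then show ?thesis by (simp add: L_def card_image[OF inj] flip: J_def)
qed

text \<open>The rank of \<open>RT\<close> enters the estimates only through this bound. I - (I +
  H)^-1 lies between 0 and I and vanishes on the kernel of R, so in an eigenbasis of R its diagonal
  entries are at most 1, and 0 where the eigenvalue is 0. \<open>R\<close> is kept apart from
  \<open>H\<close> because one fixed \<open>R\<close> has to serve for random
  \<open>H\<close>.\<close>

lemma trace_one_minus_minv_le_rank:
  assumes R: "hermitian_psd n R" and H: "hermitian_psd n H"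
    and ker: "\<And>v. v \<in> carrier_vec n \<Longrightarrow> R *\<^sub>v v = 0\<^sub>v n \<Longrightarrow> H *\<^sub>v v = 0\<^sub>v n"
  shows "Re (mat_trace (1\<^sub>m n - minv (1\<^sub>m n + H))) \<le> real (vec_space.rank n R)"
proof -
  obtain U d where U: "unitary_mat n U" and R_eq: "R = U * diagm n d * mat_adjoint U"
    using hermitian_psd_spectral[OF R] by blast
  note [simp] = unitary_matD(1,4,5)[OF U] hermitian_psd_carrier[OF H] carrier_matD[OF hermitian_psd_carrier[OF H]]
  define Q where "Q = minv (1\<^sub>m n + H)"
  note Q = minv_one_plus_psd[OF H, folded Q_def]
  note [simp] = Q(1) carrier_matD[OF Q(1)]
  define Z where "Z = mat_adjoint U * (1\<^sub>m n - Q) * U"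
  have Zc [simp]: "Z \<in> carrier_mat n n" "dim_row Z = n" "dim_col Z = n" unfolding Z_def by auto
  have "mat_trace Z = mat_trace (U * (mat_adjoint U * (1\<^sub>m n - Q)))"
    unfolding Z_def by (rule mat_trace_mult_comm[of _ n n]) (auto intro!: mult_carrier_mat[of _ _ n])
  also have "U * (mat_adjoint U * (1\<^sub>m n - Q)) = 1\<^sub>m n - Q"
    by (simp add: unitary_matD(3)[OF U] flip: assoc_mult_dim)
  finally have tr: "mat_trace Z = mat_trace (1\<^sub>m n - Q)" .
  have Z_psd: "hermitian_psd n Z"
    unfolding Z_def by (rule hermitian_psd_congruence[OF hermitian_psd_one_minus_minv[OF H, folded Q_def]]) simp
  have "Z = mat_adjoint U * U - mat_adjoint U * Q * U"
    unfolding Z_def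
    by (subst mult_minus_distrib_mat[of _ n n _ n], simp_all)
       (subst minus_mult_distrib_mat[of _ n n _ _ n], auto intro!: mult_carrier_mat[of _ _ n])
  then have ZQ: "Z $$ (i, i) = 1 - (mat_adjoint U * Q * U) $$ (i, i)" if "i < n" for i
    using that by (simp add: unitary_matD(2)[OF U])
  have le1: "Re (Z $$ (i, i)) \<le> 1" if "i < n" for i
    using hermitian_psd_diag(1)[OF hermitian_psd_congruence[OF hermitian_psd_minv[OF H, folded Q_def], of U n], of i]
      ZQ[OF that] that by simp
  have z0: "Re (Z $$ (i, i)) = 0" if i: "i < n" "d i = 0" for i
  proof -
    have c: "col U i \<in> carrier_vec n" by (rule carrier_vecI) simp
    have "R *\<^sub>v col U i = 0\<^sub>v n"
      unfolding unitary_diag_col[OF U R_eq i(1)] i(2) by (rule eq_vecI) simp_all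
    then have H0: "H *\<^sub>v col U i = 0\<^sub>v n" by (rule ker[OF c])
    have zero: "B *\<^sub>v 0\<^sub>v n = 0\<^sub>v n" if "B \<in> carrier_mat n n" for B :: "complex mat"
      using that by (intro eq_vecI) (simp_all add: scalar_prod_def)
    have "Z *\<^sub>v unit_vec n i = mat_adjoint U *\<^sub>v (Q *\<^sub>v (H *\<^sub>v (U *\<^sub>v unit_vec n i)))"
      unfolding Z_def Q_def one_minus_minv(2)[OF H] using Q(1)[unfolded Q_def]
      by (simp add: assoc_mult_vec_dim)
    also have "U *\<^sub>v unit_vec n i = col U i" using i by (intro eq_vecI) simp_all
    finally have "Z *\<^sub>v unit_vec n i = 0\<^sub>v n" using H0 zero by simp
    then show ?thesis using mat_unit_vec_cscalar[OF Zc(1) i(1) i(1)] by simp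
  qed
  have "Re (mat_trace Z) = (\<Sum>i<n. Re (Z $$ (i, i)))" by (simp add: mat_trace_eq[OF Zc(1)])
  also have "\<dots> \<le> (\<Sum>i<n. if d i \<noteq> 0 then 1 else 0)"
    using le1 z0 by (intro sum_mono) auto
  also have "\<dots> = real (card {i. i < n \<and> d i \<noteq> 0})"
    by (simp add: sum.If_cases) (intro arg_cong[where f = card], auto)
  also have "\<dots> \<le> real (vec_space.rank n R)"
    using card_nonzero_eigenvalues_le_rank[OF U R_eq] by simp
  finally show ?thesis by (simp add: tr Q_def)
qed

section \<open>Kronecker products and their determinants\<close>

lemma kronecker_dim [simp]:
  "dim_row (kronecker A B) = dim_row A * dim_row B" "dim_col (kronecker A B) = dim_col A * dim_col B"
  by (auto simp: kronecker_def)

lemma div_less_mult: "i < a * b \<Longrightarrow> i div b < (a :: nat)"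
  by (simp add: less_mult_imp_div_less)

lemma mod_less_mult: "i < a * b \<Longrightarrow> i mod b < (b :: nat)"
  by (cases "b = 0") auto

lemma kronecker_index:
  "i < dim_row A * dim_row B \<Longrightarrow> j < dim_col A * dim_col B \<Longrightarrow>
    kronecker A B $$ (i, j) = A $$ (i div dim_row B, j div dim_col B) * B $$ (i mod dim_row B, j mod dim_col B)"
  by (simp add: kronecker_def)

lemma mult_add_less_mult: "a < m \<Longrightarrow> b < p \<Longrightarrow> a * p + b < m * (p :: nat)"
proof -
  assume "a < m" "b < p"
  then have "a * p + b < Suc a * p" and "Suc a * p \<le> m * p" by (simp_all del: mult_Suc add: mult_le_mono1) simp
  then show ?thesis by (rule less_le_trans)
qed

text \<open>An index of a Kronecker product corresponds to a block number and a position in the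
  block; sums and products over it become double ones.\<close>

lemma bij_betw_div_mod: "bij_betw (\<lambda>k. (k div p, k mod p)) {..<m * p} ({..<m} \<times> {..<p :: nat})"
  by (rule bij_betw_byWitness[where f' = "\<lambda>(a, b). a * p + b"])
     (auto simp: div_less_mult mod_less_mult mult_add_less_mult)

lemma sum_div_mod:
  fixes f :: "nat \<Rightarrow> nat \<Rightarrow> 'a :: comm_monoid_add"
  shows "(\<Sum>k<m * p. f (k div p) (k mod p)) = (\<Sum>a<m. \<Sum>b<p. f a b)"
  using sum.reindex_bij_betw[OF bij_betw_div_mod, of "case_prod f" p m] by (simp add: sum.cartesian_product)

lemma prod_div_mod:
  fixes f :: "nat \<Rightarrow> nat \<Rightarrow> 'a :: comm_monoid_mult"
  shows "(\<Prod>k<m * p. f (k div p) (k mod p)) = (\<Prod>a<m. \<Prod>b<p. f a b)"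
  using prod.reindex_bij_betw[OF bij_betw_div_mod, of "case_prod f" p m] by (simp add: prod.cartesian_product)

lemma kronecker_mult:
  fixes A B C D :: "'a :: comm_semiring_0 mat"
  assumes "dim_col A = dim_row C" "dim_col B = dim_row D"
  shows "kronecker A B * kronecker C D = kronecker (A * C) (B * D)"
proof (rule eq_matI; simp)
  fix i j assume i: "i < dim_row A * dim_row B" and j: "j < dim_col C * dim_col D"
  let ?i1 = "i div dim_row B" and ?i2 = "i mod dim_row B" and ?j1 = "j div dim_col D" and ?j2 = "j mod dim_col D"
  have "row (kronecker A B) i \<bullet> col (kronecker C D) j
    = (\<Sum>k<dim_row C * dim_row D. (A $$ (?i1, k div dim_row D) * C $$ (k div dim_row D, ?j1)) *
        (B $$ (?i2, k mod dim_row D) * D $$ (k mod dim_row D, ?j2)))"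
    using i j assms by (auto simp: scalar_prod_def lessThan_atLeast0 kronecker_index ac_simps intro!: sum.cong)
  also have "\<dots> = (\<Sum>a<dim_row C. \<Sum>b<dim_row D. (A $$ (?i1, a) * C $$ (a, ?j1)) * (B $$ (?i2, b) * D $$ (b, ?j2)))"
    by (rule sum_div_mod)
  also have "\<dots> = (\<Sum>a<dim_row C. A $$ (?i1, a) * C $$ (a, ?j1)) * (\<Sum>b<dim_row D. B $$ (?i2, b) * D $$ (b, ?j2))"
    by (simp add: sum_product)
  also have "\<dots> = kronecker (A * C) (B * D) $$ (i, j)"
    using i j assms
    by (simp add: kronecker_index scalar_prod_def lessThan_atLeast0 div_less_mult mod_less_mult)
  finally show "row (kronecker A B) i \<bullet> col (kronecker C D) j = kronecker (A * C) (B * D) $$ (i, j)" .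
qed

lemma div_mod_eq_iff: "i div p = j div p \<and> i mod p = j mod p \<longleftrightarrow> i = (j :: nat)"
  by (metis div_mult_mod_eq)

lemma kronecker_diagm:
  "kronecker (diagm m d) (diagm n e) = diagm (m * n) (\<lambda>i. d (i div n) * e (i mod n))"
  by (rule eq_matI) (auto simp: kronecker_index div_less_mult mod_less_mult dest: div_mod_eq_iff[THEN iffD1, OF conjI])

lemma mat_adjoint_kronecker:
  fixes A B :: "complex mat"
  shows "mat_adjoint (kronecker A B) = kronecker (mat_adjoint A) (mat_adjoint B)"
  by (rule eq_matI) (auto simp: kronecker_index div_less_mult mod_less_mult)

lemma one_mat_diagm: "1\<^sub>m n = diagm n (\<lambda>_. 1)"
  by (rule eq_matI) auto

lemma unitary_kronecker:
  assumes "unitary_mat m U" "unitary_mat n V"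
  shows "unitary_mat (m * n) (kronecker U V)"
proof (rule unitary_matI)
  note [simp] = unitary_matD(1,4,5)[OF assms(1)] unitary_matD(1,4,5)[OF assms(2)]
  show "kronecker U V \<in> carrier_mat (m * n) (m * n)" by (rule carrier_matI) simp_all
  show "mat_adjoint (kronecker U V) * kronecker U V = 1\<^sub>m (m * n)"
    by (simp add: mat_adjoint_kronecker kronecker_mult unitary_matD(2)[OF assms(1)] unitary_matD(2)[OF assms(2)])
       (simp add: one_mat_diagm kronecker_diagm)
qed

lemma det_diagm: "Determinant.det (diagm n d) = complex_of_real (\<Prod>i<n. d i)"
proof -
  have "Determinant.det (diagm n d) = prod_list (diag_mat (diagm n d))"
    by (rule det_upper_triangular[of _ n]) auto
  also have "\<dots> = (\<Prod>i<n. complex_of_real (d i))"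
    by (simp add: prod_list_diag_prod lessThan_atLeast0)
  finally show ?thesis by simp
qed

lemma smult_unitary_diag:
  assumes U: "unitary_mat n U" and A: "A = U * diagm n d * mat_adjoint U"
  shows "complex_of_real c \<cdot>\<^sub>m A = U * diagm n (\<lambda>i. c * d i) * mat_adjoint U"
proof -
  note [simp] = unitary_matD(1,4,5)[OF U]
  have "diagm n (\<lambda>i. c * d i) = complex_of_real c \<cdot>\<^sub>m diagm n d" by (rule eq_matI) auto
  then have "U * diagm n (\<lambda>i. c * d i) = complex_of_real c \<cdot>\<^sub>m (U * diagm n d)"
    by (simp add: mult_smult_distrib[of _ n n _ n])
  then show ?thesis unfolding A
    by (simp add: mult_smult_assoc_mat[of _ n n _ n] mult_carrier_mat[of _ n n])
qed

lemma one_plus_unitary_diag: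
  assumes U: "unitary_mat n U" and A: "A = U * diagm n d * mat_adjoint U"
  shows "1\<^sub>m n + complex_of_real c \<cdot>\<^sub>m A = U * diagm n (\<lambda>i. 1 + c * d i) * mat_adjoint U"
proof -
  note [simp] = unitary_matD(1,4,5)[OF U]
  have "diagm n (\<lambda>i. 1 + c * d i) = 1\<^sub>m n + diagm n (\<lambda>i. c * d i)" by (rule eq_matI) auto
  then show ?thesis
    by (simp add: smult_unitary_diag[OF U A] mult_add_dim add_mult_dim unitary_matD(3)[OF U])
qed

lemma det_one_plus_unitary_diag:
  assumes U: "unitary_mat n U" and A: "A = U * diagm n d * mat_adjoint U"
  shows "Determinant.det (1\<^sub>m n + complex_of_real c \<cdot>\<^sub>m A) = complex_of_real (\<Prod>i<n. 1 + c * d i)"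
proof -
  note [simp] = unitary_matD(1,4,5)[OF U]
  have "Determinant.det (U * diagm n (\<lambda>i. 1 + c * d i) * mat_adjoint U)
     = Determinant.det U * Determinant.det (mat_adjoint U) * Determinant.det (diagm n (\<lambda>i. 1 + c * d i))"
    by (simp add: det_mult[of _ n] mult_carrier_mat[of _ n n])
  moreover have "Determinant.det U * Determinant.det (mat_adjoint U) = 1"
    using det_mult[of U n "mat_adjoint U"] unitary_matD(3)[OF U] by simp
  ultimately show ?thesis by (simp add: one_plus_unitary_diag[OF U A] det_diagm)
qed

text \<open>The Kronecker product of the two unitary matrices diagonalizes
  \<open>kronecker R G\<close>, with eigenvalues \<open>d a * g b\<close>. The factors with equal a
  form a determinant of the smaller size; all are positive, so the logarithm splits.\<close>

lemma ln_det_kronecker: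
  assumes U: "unitary_mat m U" and R: "R = U * diagm m d * mat_adjoint U" and d: "\<And>i. i < m \<Longrightarrow> 0 \<le> d i"
    and G: "hermitian_psd n G" and c: "0 \<le> c"
  shows "ln (Re (Determinant.det (1\<^sub>m (m * n) + complex_of_real c \<cdot>\<^sub>m kronecker R G)))
    = (\<Sum>i<m. ln (Re (Determinant.det (1\<^sub>m n + complex_of_real (c * d i) \<cdot>\<^sub>m G))))"
proof -
  obtain V g where V: "unitary_mat n V" and GV: "G = V * diagm n g * mat_adjoint V" and g: "\<And>i. i < n \<Longrightarrow> 0 \<le> g i"
    using hermitian_psd_spectral[OF G] by blast
  note [simp] = unitary_matD(1,4,5)[OF U] unitary_matD(1,4,5)[OF V]
  have "kronecker R G = kronecker U V * diagm (m * n) (\<lambda>i. d (i div n) * g (i mod n)) * mat_adjoint (kronecker U V)"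
    unfolding R GV by (simp add: mat_adjoint_kronecker kronecker_mult flip: kronecker_diagm)
  from det_one_plus_unitary_diag[OF unitary_kronecker[OF U V] this, of c]
  have "Re (Determinant.det (1\<^sub>m (m * n) + complex_of_real c \<cdot>\<^sub>m kronecker R G))
    = (\<Prod>i<m * n. 1 + c * (d (i div n) * g (i mod n)))" by (simp only: Re_complex_of_real)
  also have "\<dots> = (\<Prod>a<m. \<Prod>b<n. 1 + c * (d a * g b))" by (rule prod_div_mod)
  finally have "ln (Re (Determinant.det (1\<^sub>m (m * n) + complex_of_real c \<cdot>\<^sub>m kronecker R G)))
    = ln (\<Prod>a<m. \<Prod>b<n. 1 + c * (d a * g b))" by simp
  also have "\<dots> = (\<Sum>a<m. ln (\<Prod>b<n. 1 + c * (d a * g b)))"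
  proof -
    have "(\<Prod>b<n. 1 + c * (d a * g b)) > 0" if "a < m" for a
      using that d g c by (intro prod_pos) (auto intro!: add_pos_nonneg)
    then show "ln (\<Prod>a<m. \<Prod>b<n. 1 + c * (d a * g b)) = (\<Sum>a<m. ln (\<Prod>b<n. 1 + c * (d a * g b)))"
      by (intro ln_prod) (auto simp: less_imp_neq[symmetric])
  qed
  also have "\<dots> = (\<Sum>a<m. ln (Re (Determinant.det (1\<^sub>m n + complex_of_real (c * d a) \<cdot>\<^sub>m G))))"
    by (intro sum.cong refl, subst det_one_plus_unitary_diag[OF V GV]) (simp only: Re_complex_of_real mult.assoc)
  finally show ?thesis .
qed

section \<open>The list of largest eigenvalues\<close>

lemma sorted_desc_nonneg_split:
  assumes "sorted_wrt (\<ge>) xs" "\<And>x. x \<in> set xs \<Longrightarrow> (0 :: real) \<le> x"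
  shows "xs = filter (\<lambda>x. x \<noteq> 0) xs @ replicate (length (filter (\<lambda>x. x = 0) xs)) 0"
  using assms
proof (induction xs)
  case (Cons x xs)
  show ?case
  proof (cases "x = 0")
    case True
    then have "y = 0" if "y \<in> set xs" for y using Cons.prems that by force
    then have "filter (\<lambda>x. x \<noteq> 0) xs = []" "filter (\<lambda>x. x = 0) xs = xs" "xs = replicate (length xs) 0"
      by (auto simp: filter_empty_conv filter_id_conv intro!: replicate_eqI)
    then show ?thesis using True by simp
  qed (use Cons in auto)
qed simp

text \<open>At most \<open>K\<close> entries are nonzero and, being positive, they come first in the
  decreasing list. Padding and cutting at \<open>K\<close> therefore only add or remove zeros, which
  \<open>\<phi> 0 = 0\<close> makes invisible.\<close>

lemma sum_largest_entries:
  fixes \<phi> :: "real \<Rightarrow> real"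
  assumes nonneg: "\<And>x. x \<in># m \<Longrightarrow> 0 \<le> x" and K: "size (filter_mset (\<lambda>x. x \<noteq> 0) m) \<le> K" and "\<phi> 0 = 0"
  defines "l \<equiv> take K (rev (sorted_list_of_multiset m) @ replicate K 0)"
  shows "(\<Sum>j<K. \<phi> (l ! j)) = (\<Sum>x\<in>#m. \<phi> x)"
proof -
  define xs where "xs = rev (sorted_list_of_multiset m)"
  define ys where "ys = filter (\<lambda>x. x \<noteq> 0) xs"
  have mx: "mset xs = m" by (simp add: xs_def)
  have sx: "\<And>x. x \<in> set xs \<Longrightarrow> 0 \<le> x" using nonneg by (simp add: xs_def)
  have "sorted_wrt (\<ge>) xs" by (simp add: xs_def sorted_wrt_rev)
  from sorted_desc_nonneg_split[OF this sx] obtain z where z: "xs = ys @ replicate z 0"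
    unfolding ys_def by blast
  have "length ys = size (filter_mset (\<lambda>x. x \<noteq> 0) m)" unfolding ys_def mx[symmetric] by (metis mset_filter size_mset)
  then have ly: "length ys \<le> K" using K by simp
  have l: "l = ys @ replicate (K - length ys) 0"
    unfolding l_def xs_def[symmetric] z using ly
    by (auto simp: min_def simp flip: replicate_add)
  have len: "length l = K" using ly by (simp add: l)
  have "(\<Sum>j<K. \<phi> (l ! j)) = sum_list (map \<phi> l)"
    by (simp add: sum_list_sum_nth len lessThan_atLeast0)
  also have "\<dots> = sum_list (map \<phi> xs)" using \<open>\<phi> 0 = 0\<close> by (simp add: l z sum_list_replicate)
  also have "\<dots> = (\<Sum>x\<in>#mset xs. \<phi> x)" by (metis mset_map sum_mset_sum_list)
  finally show "(\<Sum>j<K. \<phi> (l ! j)) = (\<Sum>x\<in>#m. \<phi> x)" by (simp add: mx)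
qed

lemma proots_char_poly_unitary_diag:
  assumes U: "unitary_mat n U" and A: "A = U * diagm n d * mat_adjoint U"
  shows "proots (char_poly A) = image_mset (\<lambda>i. complex_of_real (d i)) (mset_set {..<n})"
proof -
  note [simp] = unitary_matD[OF U]
  have "similar_mat_wit A (diagm n d) U (mat_adjoint U)"
    by (rule similar_mat_witI[of _ _ n]) (auto simp: A intro!: mult_carrier_mat[of _ _ n])
  then have "char_poly A = char_poly (diagm n d)" by (intro char_poly_similar) (auto simp: similar_mat_def)
  also have "\<dots> = (\<Prod>a\<leftarrow>diag_mat (diagm n d). [:- a, 1:])"
    by (rule char_poly_upper_triangular[of _ n]) auto
  also have "diag_mat (diagm n d) = map (\<lambda>i. complex_of_real (d i)) [0..<n]" by (simp add: diag_mat_def)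
  finally have cp: "char_poly A = (\<Prod>i<n. [:- complex_of_real (d i), 1:])"
    using prod.distinct_set_conv_list[of "[0..<n]" "\<lambda>i. [:- complex_of_real (d i), 1:]"]
    by (simp add: o_def lessThan_atLeast0)
  have "proots (char_poly A) = (\<Sum>i<n. {#complex_of_real (d i)#})"
    unfolding cp by (subst proots_prod) auto
  also have "\<dots> = image_mset (\<lambda>i. complex_of_real (d i)) (mset_set {..<n})"
    by (induction n) (auto simp: lessThan_Suc)
  finally show ?thesis .
qed

text \<open>Replaces the sum over the list by a sum over an arbitrary spectral decomposition, so
  that it can be matched with the one that splits the log-determinant. It is applied to
  \<open>rho_bar\<close>, which vanishes at eigenvalue 0.\<close>

lemma sum_largest_eigenvalues:
  fixes \<phi> :: "real \<Rightarrow> real"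
  assumes U: "unitary_mat n U" and A: "A = U * diagm n d * mat_adjoint U"
    and d: "\<And>i. i < n \<Longrightarrow> 0 \<le> d i" and K: "vec_space.rank n A \<le> K" and c: "0 < c" and "\<phi> 0 = 0"
  shows "(\<Sum>j<K. \<phi> (largest_eigenvalues K (complex_of_real c \<cdot>\<^sub>m A) ! j)) = (\<Sum>i<n. \<phi> (c * d i))"
proof -
  note [simp] = unitary_matD(1,4,5)[OF U]
  note cA = smult_unitary_diag[OF U A]
  define m where "m = image_mset (\<lambda>i. c * d i) (mset_set {..<n})"
  have le: "largest_eigenvalues K (complex_of_real c \<cdot>\<^sub>m A) = take K (rev (sorted_list_of_multiset m) @ replicate K 0)"
    unfolding largest_eigenvalues_def proots_char_poly_unitary_diag[OF U cA] m_def
    by (simp add: image_mset.compositionality o_def)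
  have "size (filter_mset (\<lambda>x. x \<noteq> 0) m) = card {i. i < n \<and> d i \<noteq> 0}"
    using c by (simp add: m_def filter_mset_image_mset)
  with card_nonzero_eigenvalues_le_rank[OF U A] K have 1: "size (filter_mset (\<lambda>x. x \<noteq> 0) m) \<le> K" by simp
  have 2: "0 \<le> x" if "x \<in># m" for x using that c d by (auto simp: m_def)
  have 3: "(\<Sum>x\<in>#m. \<phi> x) = (\<Sum>i<n. \<phi> (c * d i))"
    by (simp add: m_def image_mset.compositionality o_def sum_unfold_sum_mset)
  show "(\<Sum>j<K. \<phi> (largest_eigenvalues K (complex_of_real c \<cdot>\<^sub>m A) ! j)) = (\<Sum>i<n. \<phi> (c * d i))"
    unfolding le 3[symmetric] by (rule sum_largest_entries[where \<phi> = \<phi>, OF 2 1 \<open>\<phi> 0 = 0\<close>])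
qed

section \<open>The deterministic equivalent\<close>

text \<open>\<open>T\<close> and its resolvent share an eigenbasis; this turns the matrix
  fixed-point equation into a scalar one.\<close>

lemma trace_resolvent:
  assumes U: "unitary_mat n U" and T: "T = U * diagm n t * mat_adjoint U"
    and t: "\<And>i. i < n \<Longrightarrow> 0 \<le> t i" and a: "0 \<le> a"
  shows "mat_trace (T * minv (1\<^sub>m n + complex_of_real a \<cdot>\<^sub>m T)) = complex_of_real (\<Sum>i<n. t i / (1 + a * t i))"
proof -
  note [simp] = unitary_matD(1,4,5)[OF U]
  have "hermitian_psd n T"
    using hermitian_psd_congruence[OF hermitian_psd_diagm[where d = t, OF t], where C = "mat_adjoint U" and m = n] by (simp add: T)
  then have H: "hermitian_psd n (complex_of_real a \<cdot>\<^sub>m T)" by (rule hermitian_psd_smult[OF _ a])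
  have Tc: "T \<in> carrier_mat n n" "dim_row T = n" "dim_col T = n" by (auto simp: T intro!: mult_carrier_mat[of _ _ n])
  note X = one_plus_unitary_diag[OF U T, of a]
  have pos: "1 + a * t i > 0" if "i < n" for i using t[OF that] a by (simp add: add_pos_nonneg)
  let ?Y = "U * diagm n (\<lambda>i. 1 / (1 + a * t i)) * mat_adjoint U"
  have "(U * diagm n (\<lambda>i. 1 + a * t i) * mat_adjoint U) * ?Y
     = U * (diagm n (\<lambda>i. 1 + a * t i) * (mat_adjoint U * U) * diagm n (\<lambda>i. 1 / (1 + a * t i))) * mat_adjoint U"
    by (simp add: assoc_mult_dim)
  also have "diagm n (\<lambda>i. 1 + a * t i) * (mat_adjoint U * U) * diagm n (\<lambda>i. 1 / (1 + a * t i)) = 1\<^sub>m n"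
    using pos unfolding one_mat_diagm[of n]
    by (simp add: unitary_matD(2)[OF U, unfolded one_mat_diagm] diagm_mult)
       (intro diagm_cong, force)
  finally have "(1\<^sub>m n + complex_of_real a \<cdot>\<^sub>m T) * ?Y = 1\<^sub>m n"
    by (simp add: X unitary_matD(3)[OF U])
  then have "minv (1\<^sub>m n + complex_of_real a \<cdot>\<^sub>m T) = ?Y"
    using Tc by (intro mat_inverse_unique[OF _ minv_one_plus_psd(1)[OF H] _ minv_one_plus_psd(2)[OF H]])
      (auto intro!: mult_carrier_mat[of _ _ n])
  then have "T * minv (1\<^sub>m n + complex_of_real a \<cdot>\<^sub>m T)
     = U * (diagm n t * (mat_adjoint U * U) * diagm n (\<lambda>i. 1 / (1 + a * t i))) * mat_adjoint U"
    by (simp add: T assoc_mult_dim)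
  also have "diagm n t * (mat_adjoint U * U) * diagm n (\<lambda>i. 1 / (1 + a * t i)) = diagm n (\<lambda>i. t i / (1 + a * t i))"
    by (simp add: unitary_matD(2)[OF U] diagm_mult)
  finally have "mat_trace (T * minv (1\<^sub>m n + complex_of_real a \<cdot>\<^sub>m T))
     = mat_trace (mat_adjoint U * (U * diagm n (\<lambda>i. t i / (1 + a * t i))))"
    using mat_trace_mult_comm[of "U * diagm n (\<lambda>i. t i / (1 + a * t i))" n n "mat_adjoint U"]
    by (simp add: mult_carrier_mat[of _ n n])
  also have "mat_adjoint U * (U * diagm n (\<lambda>i. t i / (1 + a * t i))) = diagm n (\<lambda>i. t i / (1 + a * t i))"
    by (simp add: unitary_matD(2)[OF U] flip: assoc_mult_dim)
  finally show ?thesis by (simp add: mat_trace_eq[of _ n n])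
qed

text \<open>After division by 1 + r d the left side is strictly increasing and the right side
  nonincreasing in d, so there is at most one solution. For existence, the difference of the two
  sides changes sign between 0 and \<open>u\<close>, the value that the right side would have for r
  = 0.\<close>

lemma fixed_point_unique:
  fixes t :: "nat \<Rightarrow> real" and N :: real
  assumes t: "\<And>i. i < n \<Longrightarrow> 0 \<le> t i" and r: "0 \<le> r" and N: "0 < N"
  shows "\<exists>!d. 0 \<le> d \<and> d = (1 / N) * (\<Sum>i<n. t i / (1 + r / (1 + r * d) * t i))"
proof -
  define g where "g d = (1 / N) * (\<Sum>i<n. t i / (1 + r / (1 + r * d) * t i))" for d
  have den: "0 < 1 + r * d + r * t i" "0 < 1 + r * d" "0 < 1 + r / (1 + r * d) * t i" if "0 \<le> d" "i < n" for d i
    using t[OF that(2)] r that by (auto intro!: add_pos_nonneg)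
  have trm: "t i / (1 + r / (1 + r * d) * t i) = (1 + r * d) * (t i / (1 + r * d + r * t i))" if "0 \<le> d" "i < n" for d i
  proof -
    have "1 + r / (1 + r * d) * t i = (1 + r * d + r * t i) / (1 + r * d)"
      using den(2)[OF that] by (simp add: divide_simps)
    then show ?thesis using den(2)[OF that] by simp
  qed
  have g: "g d = (1 + r * d) * ((1 / N) * (\<Sum>i<n. t i / (1 + r * d + r * t i)))" if "0 \<le> d" for d
    unfolding g_def using trm[OF that] by (simp add: sum_distrib_left)
  have uniq: "\<not> d1 < d2" if "0 \<le> d1" "d1 = g d1" "d2 = g d2" for d1 d2
  proof
    assume less: "d1 < d2"
    have pos: "0 < 1 + r * d1" "0 < 1 + r * d2" using r that less by (auto intro!: add_pos_nonneg)
    have "d1 / (1 + r * d1) < d2 / (1 + r * d2)"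
      using pos less by (simp add: divide_simps algebra_simps)
    also have "d2 / (1 + r * d2) = (1 / N) * (\<Sum>i<n. t i / (1 + r * d2 + r * t i))"
    proof -
      have "d2 / (1 + r * d2) = g d2 / (1 + r * d2)" by (rule arg_cong[OF that(3)])
      also have "\<dots> = (1 / N) * (\<Sum>i<n. t i / (1 + r * d2 + r * t i))"
        using g[of d2] pos(2) less that(1) by simp
      finally show ?thesis .
    qed
    also have "\<dots> \<le> (1 / N) * (\<Sum>i<n. t i / (1 + r * d1 + r * t i))"
      using less r that(1) N t den(1)
      by (intro mult_left_mono sum_mono divide_left_mono) (auto intro!: mult_left_mono mult_pos_pos)
    also have "\<dots> = g d1 / (1 + r * d1)"
      unfolding g[OF that(1)] using pos(1) by simp
    also have "g d1 / (1 + r * d1) = d1 / (1 + r * d1)" using that(2) by (rule arg_cong[OF sym])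
    finally show False by simp
  qed
  define u where "u = (\<Sum>i<n. t i) / N"
  have u: "0 \<le> u" using t N by (auto simp: u_def intro!: divide_nonneg_pos sum_nonneg)
  have g0: "0 \<le> g 0"
    unfolding g_def using t N den(3)[of 0] by (auto intro!: mult_nonneg_nonneg sum_nonneg divide_nonneg_nonneg add_nonneg_nonneg r)
  have gu: "g u \<le> u"
  proof -
    have "t i / (1 + r / (1 + r * u) * t i) \<le> t i / 1" if "i < n" for i
      using t[OF that] r u by (intro divide_left_mono) (auto intro!: mult_nonneg_nonneg divide_nonneg_nonneg add_nonneg_nonneg mult_pos_pos add_pos_nonneg)
    then have "(\<Sum>i<n. t i / (1 + r / (1 + r * u) * t i)) \<le> (\<Sum>i<n. t i)" by (intro sum_mono) auto
    then show ?thesis unfolding g_def u_def using N by (simp add: divide_right_mono)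
  qed
  have cont: "continuous_on {0..u} (\<lambda>d. d - g d)"
  proof -
    have "1 + r * d \<noteq> 0" "1 + r / (1 + r * d) * t i \<noteq> 0" if "0 \<le> d" "i < n" for d i
      using den(2,3)[OF that] by (simp_all add: less_imp_neq[symmetric])
    then show ?thesis unfolding g_def by (intro continuous_intros ballI) auto
  qed
  obtain d where "0 \<le> d" "d \<le> u" "d - g d = 0"
    using IVT'[of "\<lambda>d. d - g d" 0 0 u] g0 gu u cont by auto
  then have "0 \<le> d \<and> d = g d" by linarith
  moreover have "d' = d" if "0 \<le> d' \<and> d' = g d'" for d'
    using uniq[of d d'] uniq[of d' d] that \<open>0 \<le> d \<and> d = g d\<close> by linarith
  ultimately show ?thesis unfolding g_def[symmetric] by blast
qed

lemma rho_bar_approx: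
  assumes T: "hermitian_psd n T" and l: "0 \<le> l" and NK: "K < N"
    and tr: "\<And>a. 0 \<le> a \<Longrightarrow> Re (mat_trace (1\<^sub>m n - minv (1\<^sub>m n + complex_of_real a \<cdot>\<^sub>m T))) \<le> real K"
  shows "\<bar>rho_bar N T l - ln (Re (Determinant.det (1\<^sub>m n + complex_of_real l \<cdot>\<^sub>m T)))\<bar> \<le> (real K)\<^sup>2 / (real N - real K)"
proof -
  obtain U t where U: "unitary_mat n U" and TU: "T = U * diagm n t * mat_adjoint U" and t: "\<And>i. i < n \<Longrightarrow> 0 \<le> t i"
    using hermitian_psd_spectral[OF T] by blast
  note [simp] = hermitian_psd_carrier[OF T] carrier_matD[OF hermitian_psd_carrier[OF T]]
  have N: "0 < real N" using NK by simp
  have psd: "hermitian_psd n (complex_of_real a \<cdot>\<^sub>m T)" if "0 \<le> a" for a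
    by (rule hermitian_psd_smult[OF T that])
  define P where "P d \<longleftrightarrow> 0 \<le> d \<and> d = (1 / real N) * (\<Sum>i<n. t i / (1 + l / (1 + l * d) * t i))" for d
  have ex1: "\<exists>!d. P d" unfolding P_def by (rule fixed_point_unique[OF t l N])
  define d where "d = delta N T l"
  have eq: "(complex_of_real d = 1 / of_nat N * mat_trace (T * the (mat_inverse
         (1\<^sub>m (dim_row T) + complex_of_real (l / (1 + l * d)) \<cdot>\<^sub>m T))))
      \<longleftrightarrow> d = (1 / real N) * (\<Sum>i<n. t i / (1 + l / (1 + l * d) * t i))" if "0 \<le> d" for d
  proof -
    have a: "0 \<le> l / (1 + l * d)" using l that by (auto intro!: divide_nonneg_nonneg add_nonneg_nonneg)
    have "the (mat_inverse (1\<^sub>m n + complex_of_real (l / (1 + l * d)) \<cdot>\<^sub>m T))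
        = minv (1\<^sub>m n + complex_of_real (l / (1 + l * d)) \<cdot>\<^sub>m T)"
      by (rule mat_inverse_eq_minv[of _ n, OF _ one_plus_psd_det[OF psd[OF a]]]) simp
    then have *: "1 / of_nat N * mat_trace (T * the (mat_inverse
         (1\<^sub>m (dim_row T) + complex_of_real (l / (1 + l * d)) \<cdot>\<^sub>m T)))
      = complex_of_real ((1 / real N) * (\<Sum>i<n. t i / (1 + l / (1 + l * d) * t i)))"
      using trace_resolvent[OF U TU t a] by simp
    show ?thesis unfolding * by (rule of_real_eq_iff)
  qed
  have "d = (THE d. P d)"
    unfolding d_def delta_def P_def using eq by (intro arg_cong[where f = The] ext) blast
  then have "P d" using theI'[OF ex1] by simp
  then have d0: "0 \<le> d" and "d = (1 / real N) * (\<Sum>i<n. t i / (1 + l / (1 + l * d) * t i))"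
    unfolding P_def by blast+
  from arg_cong[OF this(2), of "\<lambda>x. real N * x"]
  have fix_eq: "real N * d = (\<Sum>i<n. t i / (1 + l / (1 + l * d) * t i))"
    using N by simp
  \<comment> \<open>The three abbreviations are tied by y = x / (1 + x) and a = l (1 - y), so a
    bound on y controls everything.\<close>
  define x where "x = l * d"
  define a where "a = l / (1 + x)"
  define y where "y = x / (1 + x)"
  have x0: "0 \<le> x" using l d0 by (simp add: x_def)
  have a0: "0 \<le> a" using l x0 by (simp add: a_def)
  have sumt: "(\<Sum>i<n. t i / (1 + a * t i)) = real N * d" using fix_eq by (simp add: a_def x_def)
  have "1\<^sub>m n - minv (1\<^sub>m n + complex_of_real a \<cdot>\<^sub>m T) = complex_of_real a \<cdot>\<^sub>m (T * minv (1\<^sub>m n + complex_of_real a \<cdot>\<^sub>m T))"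
    using one_minus_minv(1)[OF psd[OF a0]] minv_one_plus_psd(1)[OF psd[OF a0]]
    by (simp add: mult_smult_assoc_mat[of _ n n _ n])
  then have "mat_trace (1\<^sub>m n - minv (1\<^sub>m n + complex_of_real a \<cdot>\<^sub>m T)) = complex_of_real (a * (real N * d))"
    using trace_resolvent[OF U TU t a0] minv_one_plus_psd(1)[OF psd[OF a0]] sumt
    by (simp add: mat_trace_smult[of _ n] mult_carrier_mat[of _ n n])
  with tr[OF a0] have "a * (real N * d) \<le> real K" by simp
  then have Ny: "real N * y \<le> real K" by (simp add: y_def a_def x_def mult_ac)
  have y0: "0 \<le> y" using x0 by (simp add: y_def)
  have y_less: "y < 1" using x0 by (simp add: y_def)
  have xy: "x - y = x * y" using x0 by (simp add: y_def field_simps)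
  \<comment> \<open>The relation x (1 - y) = y turns y \<le> K / N into x \<le> K / (N - K).\<close>
  have xK: "x * (real N - real K) \<le> real K"
  proof -
    have "x = (1 + x) * y" using x0 by (simp add: y_def)
    then have "real N * x = (1 + x) * (real N * y)" by (metis mult.left_commute)
    also have "\<dots> \<le> (1 + x) * real K" using Ny x0 by (intro mult_left_mono) auto
    finally show ?thesis by (simp add: algebra_simps)
  qed
  have bound: "real N * (x * y) \<le> (real K)\<^sup>2 / (real N - real K)"
  proof -
    have "(real N * (x * y)) * (real N - real K) = (real N * y) * (x * (real N - real K))" by (simp add: algebra_simps)
    also have "\<dots> \<le> real K * real K" using Ny xK x0 y0 NK by (intro mult_mono) auto
    finally show ?thesis using NK by (simp add: pos_le_divide_eq power2_eq_square)
  qed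
  have det: "ln (Re (Determinant.det (1\<^sub>m n + complex_of_real c \<cdot>\<^sub>m T))) = (\<Sum>i<n. ln (1 + c * t i))" if "0 \<le> c" for c
  proof -
    have "1 + c * t i \<noteq> 0" if "i < n" for i using t[OF that] \<open>0 \<le> c\<close> by (simp add: add_nonneg_eq_0_iff)
    then have "ln (\<Prod>i<n. 1 + c * t i) = (\<Sum>i<n. ln (1 + c * t i))" by (intro ln_prod) auto
    then show ?thesis unfolding det_one_plus_unitary_diag[OF U TU] by (simp only: Re_complex_of_real)
  qed
  have al: "a \<le> l" using l x0 by (simp add: a_def field_simps)
  have la: "l - a = l * y" using x0 by (simp add: a_def y_def field_simps)
  \<comment> \<open>Tangent inequality for the logarithm at 1 + a t. The sum that appears is N
    \<delta> by the fixed-point equation, so the total is (l - a) N \<delta> = N x y.\<close>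
  have upper: "(\<Sum>i<n. ln (1 + l * t i)) - (\<Sum>i<n. ln (1 + a * t i)) \<le> real N * (x * y)"
  proof -
    have "ln (1 + l * t i) - ln (1 + a * t i) \<le> (l - a) * (t i / (1 + a * t i))" if "i < n" for i
    proof -
      have p: "0 < 1 + a * t i" "0 < 1 + l * t i" using t[OF that] a0 l by (auto intro!: add_pos_nonneg)
      have "ln (1 + l * t i) - ln (1 + a * t i) = ln ((1 + l * t i) / (1 + a * t i))" using p by (simp add: ln_div)
      also have "\<dots> \<le> (1 + l * t i) / (1 + a * t i) - 1" using p by (intro ln_le_minus_one) simp
      also have "\<dots> = (l - a) * (t i / (1 + a * t i))" using p by (simp add: field_simps)
      finally show ?thesis .
    qed
    then have "(\<Sum>i<n. ln (1 + l * t i) - ln (1 + a * t i)) \<le> (l - a) * (\<Sum>i<n. t i / (1 + a * t i))"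
      unfolding sum_distrib_left by (intro sum_mono) auto
    then show ?thesis by (simp add: sumt sum_subtractf la x_def mult_ac)
  qed
  have lower: "(\<Sum>i<n. ln (1 + a * t i)) \<le> (\<Sum>i<n. ln (1 + l * t i))"
  proof (intro sum_mono)
    fix i assume "i \<in> {..<n}"
    then have "0 \<le> t i" using t by simp
    then show "ln (1 + a * t i) \<le> ln (1 + l * t i)"
      using al a0 l by (subst ln_le_cancel_iff) (auto intro!: add_pos_nonneg mult_right_mono)
  qed
  have ln_x: "y \<le> ln (1 + x)" "ln (1 + x) \<le> x"
  proof -
    have "ln (1 / (1 + x)) \<le> 1 / (1 + x) - 1" using x0 by (intro ln_le_minus_one) simp
    then show "y \<le> ln (1 + x)" using x0 by (simp add: ln_div y_def field_simps)
    show "ln (1 + x) \<le> x" using x0 by (rule ln_add_one_self_le_self)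
  qed
  \<comment> \<open>The two corrections have opposite signs and are at most N x y each in size, so
    the bound is not doubled.\<close>
  have "rho_bar N T l = (\<Sum>i<n. ln (1 + a * t i)) + real N * ln (1 + x) - real N * y"
    unfolding rho_bar_def d_def[symmetric] using det[OF a0] by (simp add: x_def a_def y_def)
  then have "rho_bar N T l - ln (Re (Determinant.det (1\<^sub>m n + complex_of_real l \<cdot>\<^sub>m T)))
      = ((\<Sum>i<n. ln (1 + a * t i)) - (\<Sum>i<n. ln (1 + l * t i))) + real N * (ln (1 + x) - y)"
    by (simp add: det[OF l] algebra_simps)
  moreover have "0 \<le> real N * (ln (1 + x) - y)" using ln_x by simp
  moreover have "real N * (ln (1 + x) - y) \<le> real N * (x * y)" using ln_x xy by (intro mult_left_mono) auto
  ultimately show ?thesis using upper lower bound by linarith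
qed

section \<open>Stein's identity for Gaussian variables\<close>

lemma normal_density_DERIV:
  assumes "0 < \<sigma>"
  shows "(normal_density 0 \<sigma> has_real_derivative - (x / \<sigma>\<^sup>2) * normal_density 0 \<sigma> x) (at x)"
proof -
  have *: "normal_density 0 \<sigma> = (\<lambda>x. 1 / sqrt (2 * pi * \<sigma>\<^sup>2) * exp (- x\<^sup>2 / (2 * \<sigma>\<^sup>2)))"
    by (simp add: fun_eq_iff normal_density_def)
  show ?thesis unfolding *
    using assms by (auto intro!: derivative_eq_intros simp: field_simps power2_eq_square)
qed

lemma normal_density_tendsto_0:
  assumes "0 < \<sigma>"
  shows "(normal_density 0 \<sigma> \<longlongrightarrow> 0) at_top" "(normal_density 0 \<sigma> \<longlongrightarrow> 0) at_bot"
proof -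
  have ev: "normal_density 0 \<sigma> (- x) = normal_density 0 \<sigma> x" for x
    by (simp add: normal_density_def)
  have "filterlim (\<lambda>x::real. x\<^sup>2) at_top at_top"
    by (rule filterlim_pow_at_top) (auto intro: filterlim_ident)
  then have "filterlim (\<lambda>x::real. x\<^sup>2 / (2 * \<sigma>\<^sup>2)) at_top at_top"
    using filterlim_tendsto_pos_mult_at_top[OF tendsto_const, of "1 / (2 * \<sigma>\<^sup>2)" "\<lambda>x::real. x\<^sup>2" at_top] assms by simp
  then have "((\<lambda>x::real. exp (- (x\<^sup>2 / (2 * \<sigma>\<^sup>2)))) \<longlongrightarrow> 0) at_top"
    by (intro filterlim_compose[OF exp_at_bot]) (simp add: filterlim_uminus_at_bot_at_top filterlim_uminus_at_top)
  then have "((\<lambda>x::real. 1 / sqrt (2 * pi * \<sigma>\<^sup>2) * exp (- (x\<^sup>2 / (2 * \<sigma>\<^sup>2)))) \<longlongrightarrow> 0) at_top"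
    by (rule tendsto_mult_right_zero)
  then show top: "(normal_density 0 \<sigma> \<longlongrightarrow> 0) at_top"
    by (simp add: normal_density_def[abs_def])
  show "(normal_density 0 \<sigma> \<longlongrightarrow> 0) at_bot"
    using top by (simp add: filterlim_at_bot_mirror ev)
qed

text \<open>The derivative of the density times \<open>f\<close> is integrated over the line. As
  \<open>f\<close> is bounded, the boundary terms vanish with the density; the factor
  \<open>\<sigma>\<^sup>2\<close> comes from the logarithmic derivative of the density.\<close>

lemma stein_normal_lborel:
  fixes f f' :: "real \<Rightarrow> real"
  assumes s: "0 < \<sigma>" and f: "\<And>x. (f has_real_derivative f' x) (at x)" and f': "continuous_on UNIV f'"
    and bf: "\<And>x. \<bar>f x\<bar> \<le> C" and bf': "\<And>x. \<bar>f' x\<bar> \<le> D"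
  shows "integrable lborel (\<lambda>x. normal_density 0 \<sigma> x * (x * f x))"
    "integrable lborel (\<lambda>x. normal_density 0 \<sigma> x * f' x)"
    "(LINT x|lborel. normal_density 0 \<sigma> x * (x * f x)) = \<sigma>\<^sup>2 * (LINT x|lborel. normal_density 0 \<sigma> x * f' x)"
proof -
  let ?n = "normal_density 0 \<sigma>"
  have cf: "continuous_on UNIV f" using f by (intro continuous_at_imp_continuous_on ballI DERIV_isCont) blast
  have [measurable]: "f \<in> borel_measurable borel" "f' \<in> borel_measurable borel"
    using cf f' by (auto intro: borel_measurable_continuous_onI)
  have n0: "0 \<le> ?n x" for x by simp
  show I1: "integrable lborel (\<lambda>x. ?n x * (x * f x))"
  proof (rule Bochner_Integration.integrable_bound)
    show "integrable lborel (\<lambda>x. C * (?n x * \<bar>x - 0\<bar> ^ 1))"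
      by (intro integrable_mult_right integrable_normal_moment_abs s)
    have "\<bar>?n x * (x * f x)\<bar> \<le> \<bar>C * (?n x * \<bar>x\<bar>)\<bar>" for x
    proof -
      have "\<bar>?n x * (x * f x)\<bar> = \<bar>f x\<bar> * (?n x * \<bar>x\<bar>)" by (simp add: abs_mult)
      also have "\<dots> \<le> C * (?n x * \<bar>x\<bar>)" by (intro mult_right_mono bf) simp
      finally show ?thesis by linarith
    qed
    then show "AE x in lborel. norm (?n x * (x * f x)) \<le> norm (C * (?n x * \<bar>x - 0\<bar> ^ 1))" by simp
  qed simp
  show I2: "integrable lborel (\<lambda>x. ?n x * f' x)"
  proof (rule Bochner_Integration.integrable_bound)
    show "integrable lborel (\<lambda>x. D * ?n x)" using s by simp
    have "\<bar>?n x * f' x\<bar> \<le> \<bar>D * ?n x\<bar>" for x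
    proof -
      have "\<bar>?n x * f' x\<bar> = \<bar>f' x\<bar> * ?n x" by (simp add: abs_mult)
      also have "\<dots> \<le> D * ?n x" by (intro mult_right_mono bf') simp
      finally show ?thesis by linarith
    qed
    then show "AE x in lborel. norm (?n x * f' x) \<le> norm (D * ?n x)" by simp
  qed simp
  let ?F' = "\<lambda>x. ?n x * f' x - (1 / \<sigma>\<^sup>2) * (?n x * (x * f x))"
  have IF: "integrable lborel ?F'" using I1 I2 by simp
  have dF: "((\<lambda>x. ?n x * f x) has_vector_derivative ?F' x) (at x)" for x
    unfolding has_real_derivative_iff_has_vector_derivative[symmetric]
    by (rule derivative_eq_intros normal_density_DERIV[OF s] f refl)+ (simp add: field_simps)
  have cn: "continuous_on UNIV ?n"
    using normal_density_DERIV[OF s] by (intro continuous_at_imp_continuous_on ballI DERIV_isCont) blast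
  have cF: "continuous_on UNIV ?F'" by (intro continuous_intros cn cf f')
  have lim: "((\<lambda>x. ?n x * f x) \<longlongrightarrow> 0) F" if "(?n \<longlongrightarrow> 0) F" for F
  proof (rule Lim_null_comparison)
    have "\<bar>?n x * f x\<bar> \<le> C * ?n x" for x
      using mult_right_mono[OF bf[of x] n0[of x]] by (simp add: abs_mult mult.commute)
    then show "\<forall>\<^sub>F x in F. norm (?n x * f x) \<le> C * ?n x" by simp
    show "((\<lambda>x. C * ?n x) \<longlongrightarrow> 0) F" by (rule tendsto_mult_right_zero[OF that])
  qed
  have "(LBINT x=-\<infinity>..\<infinity>. ?F' x) = 0 - 0"
  proof (rule interval_integral_FTC_integrable)
    show "set_integrable lborel (einterval (- \<infinity>) \<infinity>) ?F'" using IF by (simp add: set_integrable_def)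
    show "isCont ?F' x" for x using cF by (simp add: continuous_on_eq_continuous_at)
    show "(((\<lambda>x. ?n x * f x) \<circ> real_of_ereal) \<longlongrightarrow> 0) (at_right (- \<infinity>))"
      using lim[OF normal_density_tendsto_0(2)[OF s]] by (simp add: ereal_tendsto_simps)
    show "(((\<lambda>x. ?n x * f x) \<circ> real_of_ereal) \<longlongrightarrow> 0) (at_left \<infinity>)"
      using lim[OF normal_density_tendsto_0(1)[OF s]] by (simp add: ereal_tendsto_simps)
  qed (use dF in auto)
  then have "(LINT x|lborel. ?F' x) = 0"
    by (simp add: interval_lebesgue_integral_def set_lebesgue_integral_def)
  then have "(LINT x|lborel. ?n x * f' x) - (1 / \<sigma>\<^sup>2) * (LINT x|lborel. ?n x * (x * f x)) = 0"
    using I1 I2 by simp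
  then show "(LINT x|lborel. ?n x * (x * f x)) = \<sigma>\<^sup>2 * (LINT x|lborel. ?n x * f' x)"
    using s by (simp add: field_simps)
qed

lemma (in prob_space) stein_normal:
  fixes f f' :: "real \<Rightarrow> real"
  assumes s: "0 < \<sigma>" and X: "distributed M lborel X (normal_density 0 \<sigma>)"
    and f: "\<And>x. (f has_real_derivative f' x) (at x)" and f': "continuous_on UNIV f'"
    and bf: "\<And>x. \<bar>f x\<bar> \<le> C" and bf': "\<And>x. \<bar>f' x\<bar> \<le> D"
  shows "expectation (\<lambda>w. X w * f (X w)) = \<sigma>\<^sup>2 * expectation (\<lambda>w. f' (X w))"
proof -
  have cf: "continuous_on UNIV f" using f by (intro continuous_at_imp_continuous_on ballI DERIV_isCont) blast
  have [measurable]: "f \<in> borel_measurable borel" "f' \<in> borel_measurable borel"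
    using cf f' by (auto intro: borel_measurable_continuous_onI)
  note st = stein_normal_lborel[OF s f f' bf bf']
  have "expectation (\<lambda>w. X w * f (X w)) = (LINT x|lborel. normal_density 0 \<sigma> x * (x * f x))"
    by (subst distributed_integral[OF X, symmetric]) simp_all
  also have "\<dots> = \<sigma>\<^sup>2 * (LINT x|lborel. normal_density 0 \<sigma> x * f' x)" by (rule st(3))
  also have "(LINT x|lborel. normal_density 0 \<sigma> x * f' x) = expectation (\<lambda>w. f' (X w))"
    by (subst distributed_integral[OF X, symmetric]) simp_all
  finally show ?thesis .
qed

section \<open>Nonnegative quadratics in the denominator\<close>

lemma nonneg_quadratic_discriminant:
  fixes a b c :: real
  assumes "\<And>x. 0 \<le> a * x\<^sup>2 + 2 * b * x + c"
  shows "0 \<le> a" "b\<^sup>2 \<le> a * c"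
proof -
  show a: "0 \<le> a"
  proof (rule ccontr)
    assume "\<not> 0 \<le> a"
    \<comment> \<open>Chosen with x \<ge> 1 and a x = a - 2 |b| - |c|, so that a x^2 outweighs the
      other two terms.\<close>
    define x where "x = 1 + (2 * \<bar>b\<bar> + \<bar>c\<bar>) / (- a)"
    have x: "1 \<le> x" using \<open>\<not> 0 \<le> a\<close> by (simp add: x_def divide_nonneg_neg)
    have "a * x = a - (2 * \<bar>b\<bar> + \<bar>c\<bar>)" using \<open>\<not> 0 \<le> a\<close> by (simp add: x_def field_simps)
    then have "a * x\<^sup>2 + 2 * b * x + c = (a - 2 * \<bar>b\<bar> - \<bar>c\<bar>) * x + 2 * b * x + c"
      by (simp add: power2_eq_square flip: mult.assoc)
    also have "\<dots> = a * x + 2 * (b - \<bar>b\<bar>) * x + (c - \<bar>c\<bar> * x)" by (simp add: algebra_simps)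
    also have "\<dots> < 0"
    proof -
      have "a * x < 0" using x \<open>\<not> 0 \<le> a\<close> by (simp add: mult_neg_pos)
      moreover have "2 * (b - \<bar>b\<bar>) * x \<le> 0" using x by (simp add: mult_nonpos_nonneg)
      moreover have "c \<le> \<bar>c\<bar> * x" using x mult_left_mono[of 1 x "\<bar>c\<bar>"] by linarith
      ultimately show ?thesis by linarith
    qed
    finally show False using assms[of x] by simp
  qed
  show "b\<^sup>2 \<le> a * c"
  proof (cases "a = 0")
    case True
    have "b = 0"
    proof (rule ccontr)
      assume "b \<noteq> 0"
      then have "2 * b * (- (\<bar>c\<bar> + 1) / (2 * b)) + c < 0"
        by simp
      with assms[of "- (\<bar>c\<bar> + 1) / (2 * b)"] True show False by simp
    qed
    then show ?thesis using True by simp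
  next
    case False
    then have "0 < a" using a by simp
    have "a * (- b / a)\<^sup>2 + 2 * b * (- b / a) + c = c - b\<^sup>2 / a"
      using \<open>0 < a\<close> by (simp add: field_simps power2_eq_square)
    with assms[of "- b / a"] have "b\<^sup>2 / a \<le> c" by simp
    then show ?thesis using \<open>0 < a\<close> by (simp add: field_simps)
  qed
qed

text \<open>The numerator is half the derivative of the denominator. The bound (a x + b)^2 \<le> a
  D, a form of the discriminant inequality, keeps the quotient and its derivative bounded, as
  Stein's identity requires.\<close>

lemma (in prob_space) stein_rational:
  fixes a b c :: real
  assumes s: "0 < \<sigma>" and X: "distributed M lborel X (normal_density 0 \<sigma>)"
    and q: "\<And>x. 0 \<le> a * x\<^sup>2 + 2 * b * x + c"
  defines "D \<equiv> \<lambda>x. 1 + (a * x\<^sup>2 + 2 * b * x + c)"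
  shows "expectation (\<lambda>w. X w * ((a * X w + b) / D (X w)))
    = \<sigma>\<^sup>2 * expectation (\<lambda>w. a / D (X w) - 2 * (a * X w + b)\<^sup>2 / (D (X w))\<^sup>2)"
proof -
  note d = nonneg_quadratic_discriminant[OF q]
  have D1: "1 \<le> D x" for x using q[of x] by (simp add: D_def)
  have D0: "D x \<noteq> 0" "0 < D x" for x using D1[of x] by auto
  have key: "(a * x + b)\<^sup>2 \<le> a * D x" for x
  proof -
    have "(a * x + b)\<^sup>2 = a * (a * x\<^sup>2 + 2 * b * x + c) + (b\<^sup>2 - a * c)"
      by (simp add: power2_eq_square algebra_simps)
    then show ?thesis using d by (simp add: D_def algebra_simps)
  qed
  show ?thesis
  proof (rule stein_normal[OF s X])
    show "((\<lambda>x. (a * x + b) / D x) has_real_derivative a / D x - 2 * (a * x + b)\<^sup>2 / (D x)\<^sup>2) (at x)" for x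
    proof -
      have "((\<lambda>x. (a * x + b) / D x) has_real_derivative
          (a * D x - (a * x + b) * (2 * a * x + 2 * b)) / (D x * D x)) (at x)"
      proof (rule DERIV_divide)
        show "((\<lambda>x. a * x + b) has_real_derivative a) (at x)" by (auto intro!: derivative_eq_intros)
        show "(D has_real_derivative 2 * a * x + 2 * b) (at x)"
          unfolding D_def by (auto intro!: derivative_eq_intros)
      qed (rule D0)
      moreover have "(a * D x - (a * x + b) * (2 * a * x + 2 * b)) / (D x * D x)
          = a / D x - 2 * (a * x + b)\<^sup>2 / (D x)\<^sup>2"
        using D0(1)[of x] by (simp add: field_simps power2_eq_square)
      ultimately show ?thesis by simp
    qed
    show "continuous_on UNIV (\<lambda>x. a / D x - 2 * (a * x + b)\<^sup>2 / (D x)\<^sup>2)"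
      using D0(1) unfolding D_def by (intro continuous_intros) auto
    \<comment> \<open>The natural bound is the root of a; 1 + a dominates it and avoids the root, as
      a \<le> (1 + a)^2.\<close>
    show "\<bar>(a * x + b) / D x\<bar> \<le> 1 + a" for x
    proof (rule abs_le_square_iff[THEN iffD2, THEN order.trans])
      show "((a * x + b) / D x)\<^sup>2 \<le> (1 + a)\<^sup>2"
      proof -
        have "((a * x + b) / D x)\<^sup>2 \<le> a * D x / (D x)\<^sup>2"
          unfolding power_divide using key[of x] by (intro divide_right_mono) auto
        also have "\<dots> = a / D x" using D0[of x] by (simp add: power2_eq_square)
        also have "\<dots> \<le> a / 1" using d(1) D1[of x] by (intro divide_left_mono) auto
        also have "\<dots> \<le> (1 + a)\<^sup>2" using d(1) by (simp add: power2_eq_square algebra_simps)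
        finally show ?thesis .
      qed
      show "\<bar>1 + a\<bar> \<le> 1 + a" using d(1) by simp
    qed
    \<comment> \<open>Both a / D and the squared quotient lie between 0 and a, and the latter enters
      twice.\<close>
    show "\<bar>a / D x - 2 * (a * x + b)\<^sup>2 / (D x)\<^sup>2\<bar> \<le> 3 * a" for x
    proof -
      have 1: "0 \<le> a / D x" "a / D x \<le> a / 1"
        using d(1) D1[of x] D0[of x] by (simp, intro divide_left_mono) auto
      have "(a * x + b)\<^sup>2 / (D x)\<^sup>2 \<le> a * D x / (D x)\<^sup>2"
        using key[of x] by (intro divide_right_mono) auto
      also have "\<dots> = a / D x" using D0[of x] by (simp add: power2_eq_square)
      finally have "(a * x + b)\<^sup>2 / (D x)\<^sup>2 \<le> a" using 1 by simp
      moreover have "0 \<le> (a * x + b)\<^sup>2 / (D x)\<^sup>2" by simp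
      moreover have "2 * (a * x + b)\<^sup>2 / (D x)\<^sup>2 = 2 * ((a * x + b)\<^sup>2 / (D x)\<^sup>2)" by simp
      ultimately show ?thesis using 1 unfolding abs_le_iff by linarith
    qed
  qed
qed

text \<open>Independence gives a product law, and by Fubini's theorem X can be integrated first; an
  identity valid for each frozen value of Y thus passes to the joint expectation. It is used to
  isolate one real component of a complex variable, and later one entry of the matrix.\<close>

lemma (in prob_space) indep_var_expectation_cong:
  fixes F G :: "'b \<times> 'b \<Rightarrow> real"
  assumes ind: "indep_var A X B Y"
    and [measurable]: "F \<in> borel_measurable (A \<Otimes>\<^sub>M B)" "G \<in> borel_measurable (A \<Otimes>\<^sub>M B)"
    and IF: "integrable M (\<lambda>w. F (X w, Y w))" and IG: "integrable M (\<lambda>w. G (X w, Y w))"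
    and eq: "\<And>y. y \<in> space B \<Longrightarrow> expectation (\<lambda>w. F (X w, y)) = expectation (\<lambda>w. G (X w, y))"
  shows "expectation (\<lambda>w. F (X w, Y w)) = expectation (\<lambda>w. G (X w, Y w))"
proof -
  have [measurable]: "random_variable A X" "random_variable B Y"
    using ind by (auto dest: indep_var_rv1 indep_var_rv2)
  let ?PX = "distr M A X" and ?PY = "distr M B Y"
  interpret PX: prob_space ?PX by (rule prob_space_distr) simp
  interpret PY: prob_space ?PY by (rule prob_space_distr) simp
  interpret P: pair_sigma_finite ?PX ?PY ..
  have joint: "distr M (A \<Otimes>\<^sub>M B) (\<lambda>w. (X w, Y w)) = ?PX \<Otimes>\<^sub>M ?PY"
    using ind by (simp add: indep_var_distribution_eq)
  have *: "expectation (\<lambda>w. H (X w, Y w)) = (LINT y|?PY. expectation (\<lambda>w. H (X w, y)))"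
    if [measurable]: "H \<in> borel_measurable (A \<Otimes>\<^sub>M B)" and I: "integrable M (\<lambda>w. H (X w, Y w))" for H :: "'b \<times> 'b \<Rightarrow> real"
  proof -
    have "integrable (distr M (A \<Otimes>\<^sub>M B) (\<lambda>w. (X w, Y w))) H"
      using I by (subst integrable_distr_eq) auto
    then have int: "integrable (?PX \<Otimes>\<^sub>M ?PY) (case_prod (\<lambda>x y. H (x, y)))" by (simp add: joint)
    have "expectation (\<lambda>w. H (X w, Y w)) = (LINT p|distr M (A \<Otimes>\<^sub>M B) (\<lambda>w. (X w, Y w)). H p)"
      by (subst integral_distr) auto
    also have "\<dots> = (LINT p|(?PX \<Otimes>\<^sub>M ?PY). (case_prod (\<lambda>x y. H (x, y))) p)" by (simp add: joint)
    also have "\<dots> = (LINT y|?PY. LINT x|?PX. H (x, y))" by (rule P.integral_snd[OF int, symmetric])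
    also have "\<dots> = (LINT y|?PY. expectation (\<lambda>w. H (X w, y)))"
      by (intro Bochner_Integration.integral_cong refl) (subst integral_distr, auto)
    finally show ?thesis .
  qed
  show ?thesis
    unfolding *[OF assms(2) IF] *[OF assms(3) IG]
    by (intro Bochner_Integration.integral_cong refl eq) simp
qed

text \<open>The Hermitian form of a semidefinite matrix B at a vector u, as a function of a single
  entry z of u: \<open>a\<close> is the diagonal entry of B, \<open>\<beta>\<close> the part of B u
  at that position due to the other entries, \<open>c\<close> the form at u with z cleared.\<close>

abbreviation qform :: "real \<Rightarrow> complex \<Rightarrow> real \<Rightarrow> complex \<Rightarrow> real" where
  "qform a \<beta> c z \<equiv> a * (cmod z)\<^sup>2 + 2 * Re (cnj z * \<beta>) + c"

text \<open>The real part of cnj z times f(z) for f(z) = (a z + \<beta>) / (1 + q(z)), where q is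
  \<open>qform\<close>; \<open>stein_g\<close> is the Wirtinger derivative of f in z. Complex
  integration by parts relates the two, with the variance as factor.\<close>

abbreviation stein_f :: "real \<Rightarrow> complex \<Rightarrow> real \<Rightarrow> complex \<Rightarrow> real" where
  "stein_f a \<beta> c z \<equiv> Re (cnj z * (a * z + \<beta>)) / (1 + qform a \<beta> c z)"

abbreviation stein_g :: "real \<Rightarrow> complex \<Rightarrow> real \<Rightarrow> complex \<Rightarrow> real" where
  "stein_g a \<beta> c z \<equiv> a / (1 + qform a \<beta> c z) - (cmod (a * z + \<beta>))\<^sup>2 / (1 + qform a \<beta> c z)\<^sup>2"

text \<open>The discriminant inequality for a complex variable. Moving z along the direction of
  \<open>\<beta>\<close> makes the cross term real and of full size |\<beta>|, which leaves a
  quadratic in one real variable.\<close>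

lemma quadratic_form_bound:
  fixes a c :: real and \<beta> z :: complex
  assumes q: "\<And>z :: complex. 0 \<le> qform a \<beta> c z"
  shows "0 \<le> a" "(cmod (a * z + \<beta>))\<^sup>2 \<le> a * qform a \<beta> c z"
proof -
  have "0 \<le> a * x\<^sup>2 + 2 * 0 * x + (c + 2 * 0)" if "\<beta> = 0" for x :: real
    using q[of "complex_of_real x"] that by simp
  \<comment> \<open>For \<open>\<beta> = 0\<close> the value of \<open>sgn\<close> would be 0, which
    is no direction; any unit number serves.\<close>
  define s where "s = (if \<beta> = 0 then 1 else sgn \<beta>)"
  have s: "cmod s = 1" "cnj s * \<beta> = cmod \<beta>"
  proof -
    show "cmod s = 1" by (simp add: s_def norm_sgn)
    show "cnj s * \<beta> = cmod \<beta>"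
    proof (cases "\<beta> = 0")
      case False
      have "cnj \<beta> * \<beta> = complex_of_real ((cmod \<beta>)\<^sup>2)" by (metis complex_norm_square mult.commute)
      then show ?thesis using False
        by (simp add: s_def sgn_div_norm scaleR_conv_of_real power2_eq_square field_simps)
    qed simp
  qed
  have "0 \<le> a * x\<^sup>2 + 2 * cmod \<beta> * x + c" for x :: real
  proof -
    have "cnj (complex_of_real x * s) * \<beta> = complex_of_real x * (cnj s * \<beta>)" by simp
    also have "\<dots> = complex_of_real (x * cmod \<beta>)" unfolding s(2) by simp
    finally have "Re (cnj (complex_of_real x * s) * \<beta>) = x * cmod \<beta>" by (simp only: Re_complex_of_real)
    moreover have "(cmod (complex_of_real x * s))\<^sup>2 = x\<^sup>2" by (simp add: norm_mult s(1))
    ultimately show ?thesis using q[of "complex_of_real x * s"] by (simp only: mult_ac)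
  qed
  from nonneg_quadratic_discriminant[OF this]
  have a: "0 \<le> a" and disc: "(cmod \<beta>)\<^sup>2 \<le> a * c" by auto
  show "0 \<le> a" by (rule a)
  have "(cmod (a * z + \<beta>))\<^sup>2 = a * (a * (cmod z)\<^sup>2 + 2 * Re (cnj z * \<beta>)) + (cmod \<beta>)\<^sup>2"
    by (simp add: cmod_power2) (simp add: power2_eq_square algebra_simps)
  then show "(cmod (a * z + \<beta>))\<^sup>2 \<le> a * qform a \<beta> c z"
    using disc by (simp add: algebra_simps)
qed

section \<open>Complex Gaussian variables\<close>

lemma (in prob_space) indep_var_sym: "indep_var A X B Y \<Longrightarrow> indep_var B Y A X"
  unfolding indep_var_eq indep_sets2_eq by (metis (no_types, lifting) Int_commute mult.commute)

lemma (in prob_space) complex_gaussian_measurable: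
  assumes "complex_gaussian M v Z"
  shows "(\<lambda>w. Re (Z w)) \<in> borel_measurable M" "(\<lambda>w. Im (Z w)) \<in> borel_measurable M" "Z \<in> borel_measurable M"
proof -
  show 1: "(\<lambda>w. Re (Z w)) \<in> borel_measurable M" "(\<lambda>w. Im (Z w)) \<in> borel_measurable M"
    using assms unfolding complex_gaussian_def by (auto dest: indep_var_rv1 indep_var_rv2)
  then show "Z \<in> borel_measurable M" by (simp add: borel_measurable_complex_iff)
qed

lemma (in prob_space) complex_gaussian_integrable:
  assumes "complex_gaussian M v Z" "0 < v"
  shows "integrable M (\<lambda>w. cmod (Z w))" "integrable M (\<lambda>w. (cmod (Z w))\<^sup>2)"
    "expectation (\<lambda>w. (cmod (Z w))\<^sup>2) = v" "integrable M Z" "expectation Z = 0"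
proof -
  note [measurable] = complex_gaussian_measurable[OF assms(1)]
  have s: "0 < sqrt (v / 2)" using assms(2) by simp
  have *: "integrable M (\<lambda>w. X w)" "integrable M (\<lambda>w. (X w)\<^sup>2)" "expectation (\<lambda>w. (X w)\<^sup>2) = v / 2" "expectation X = 0"
    if "distributed M lborel X (normal_density 0 (sqrt (v / 2)))" for X
  proof -
    show "integrable M (\<lambda>w. X w)"
      using integrable_normal_moment[OF s, of 0 1] distributed_integrable[OF that, of "\<lambda>x. x"] by simp
    show "integrable M (\<lambda>w. (X w)\<^sup>2)"
      using integrable_normal_moment[OF s, of 0 2] distributed_integrable[OF that, of "\<lambda>x. x\<^sup>2"] by simp
    show e: "expectation X = 0" using normal_distributed_expectation[OF s that] .
    show "expectation (\<lambda>w. (X w)\<^sup>2) = v / 2"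
      using normal_distributed_variance[OF s that] assms(2) by (simp add: e)
  qed
  have dR: "distributed M lborel (\<lambda>w. Re (Z w)) (normal_density 0 (sqrt (v / 2)))"
    and dI: "distributed M lborel (\<lambda>w. Im (Z w)) (normal_density 0 (sqrt (v / 2)))"
    using assms by (auto simp: complex_gaussian_def)
  show "integrable M (\<lambda>w. (cmod (Z w))\<^sup>2)" "expectation (\<lambda>w. (cmod (Z w))\<^sup>2) = v"
    using *[OF dR] *[OF dI] by (simp_all add: cmod_power2)
  show "integrable M (\<lambda>w. cmod (Z w))"
  proof (rule Bochner_Integration.integrable_bound)
    show "integrable M (\<lambda>w. \<bar>Re (Z w)\<bar> + \<bar>Im (Z w)\<bar>)" using *(1)[OF dR] *(1)[OF dI] by simp
    show "AE x in M. norm (cmod (Z x)) \<le> norm (\<bar>Re (Z x)\<bar> + \<bar>Im (Z x)\<bar>)"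
      by (simp add: cmod_le)
  qed simp
  then show iZ: "integrable M Z" by (simp add: integrable_norm_iff)
  show "expectation Z = 0"
    using integral_Re[OF iZ] integral_Im[OF iZ] *(4)[OF dR] *(4)[OF dI] by (simp add: complex_eq_iff)
qed

text \<open>All follow from D \<ge> 1 and |a z + \<beta>|^2 \<le> a D. Except for D itself, the
  bounds are uniform in z and provide integrability.\<close>

lemma stein_scalar_bounds:
  fixes a c :: real and \<beta> z :: complex
  assumes q: "\<And>z :: complex. 0 \<le> qform a \<beta> c z"
  defines "D \<equiv> 1 + qform a \<beta> c z"
  shows "0 \<le> a" "0 < D" "cmod (a * z + \<beta>) / D \<le> 1 + a" "a / D \<le> a"
    "0 \<le> (cmod (a * z + \<beta>))\<^sup>2 / D\<^sup>2" "(cmod (a * z + \<beta>))\<^sup>2 / D\<^sup>2 \<le> a / D"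
proof -
  show a: "0 \<le> a" by (rule quadratic_form_bound(1)[OF q])
  have D1: "1 \<le> D" using q[of z] by (simp add: D_def)
  then show D0: "0 < D" by simp
  have "(cmod (a * z + \<beta>))\<^sup>2 / D\<^sup>2 \<le> a * D / D\<^sup>2"
    using quadratic_form_bound(2)[OF q, of z] a by (intro divide_right_mono) (auto simp: D_def algebra_simps)
  also have "\<dots> = a / D" using D0 by (simp add: power2_eq_square)
  finally show le: "(cmod (a * z + \<beta>))\<^sup>2 / D\<^sup>2 \<le> a / D" .
  show aD: "a / D \<le> a" using a D1 divide_left_mono[of 1 D a] by simp
  show "cmod (a * z + \<beta>) / D \<le> 1 + a"
  proof (rule power2_le_imp_le)
    have "a \<le> (1 + a)\<^sup>2" using a by (simp add: power2_eq_square algebra_simps)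
    with le aD show "(cmod (a * z + \<beta>) / D)\<^sup>2 \<le> (1 + a)\<^sup>2" unfolding power_divide by linarith
  qed (use a in simp)
qed simp

text \<open>\<open>p\<close> stands for \<open>Re\<close> and \<open>Im\<close> at once. The product
  side is dominated by a multiple of |Z|, and the derivative side is bounded.\<close>

lemma (in prob_space) stein_complex_integrable:
  fixes a c :: real and \<beta> :: complex and Z :: "'a \<Rightarrow> complex"
  assumes Z: "complex_gaussian M v Z" and v: "0 < v" and q: "\<And>z :: complex. 0 \<le> qform a \<beta> c z"
    and p [measurable]: "p \<in> borel_measurable borel" and le: "\<And>z. \<bar>p z\<bar> \<le> cmod z"
  defines "D \<equiv> \<lambda>z :: complex. 1 + qform a \<beta> c z"
  shows "integrable M (\<lambda>w. p (Z w) * (p (a * Z w + \<beta>) / D (Z w)))"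
    "integrable M (\<lambda>w. v / 2 * (a / D (Z w) - 2 * (p (a * Z w + \<beta>))\<^sup>2 / (D (Z w))\<^sup>2))"
proof -
  note [measurable] = complex_gaussian_measurable[OF Z]
  have D: "1 + qform a \<beta> c z = D z" for z by (simp add: D_def)
  note b = stein_scalar_bounds[OF q, unfolded D]
  have [measurable]: "D \<in> borel_measurable borel"
    unfolding D_def by (intro borel_measurable_continuous_onI continuous_intros)
  show "integrable M (\<lambda>w. p (Z w) * (p (a * Z w + \<beta>) / D (Z w)))"
  proof (rule Bochner_Integration.integrable_bound)
    show "integrable M (\<lambda>w. (1 + a) * cmod (Z w))" using complex_gaussian_integrable(1)[OF Z v] by simp
    have "\<bar>p z * (p (a * z + \<beta>) / D z)\<bar> \<le> \<bar>(1 + a) * cmod z\<bar>" for z :: complex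
    proof -
      have "\<bar>p (a * z + \<beta>) / D z\<bar> \<le> cmod (a * z + \<beta>) / D z"
        using le[of "a * z + \<beta>"] b(2)[of z] by (simp add: abs_divide divide_right_mono)
      then have "\<bar>p z\<bar> * \<bar>p (a * z + \<beta>) / D z\<bar> \<le> cmod z * (1 + a)"
        using le[of z] b(3)[of z] by (intro mult_mono) auto
      then show ?thesis using b(1) by (simp add: abs_mult mult.commute)
    qed
    then show "AE w in M. norm (p (Z w) * (p (a * Z w + \<beta>) / D (Z w))) \<le> norm ((1 + a) * cmod (Z w))" by simp
  qed simp
  show "integrable M (\<lambda>w. v / 2 * (a / D (Z w) - 2 * (p (a * Z w + \<beta>))\<^sup>2 / (D (Z w))\<^sup>2))"
  proof (intro integrable_mult_right integrable_const_bound[where B = "3 * a"])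
    have "\<bar>a / D z - 2 * (p (a * z + \<beta>))\<^sup>2 / (D z)\<^sup>2\<bar> \<le> 3 * a" for z :: complex
    proof -
      have "(p (a * z + \<beta>))\<^sup>2 \<le> (cmod (a * z + \<beta>))\<^sup>2"
        using le[of "a * z + \<beta>"] power_mono[of "\<bar>p (a * z + \<beta>)\<bar>" "cmod (a * z + \<beta>)" 2] by simp
      then have "(p (a * z + \<beta>))\<^sup>2 / (D z)\<^sup>2 \<le> (cmod (a * z + \<beta>))\<^sup>2 / (D z)\<^sup>2"
        by (intro divide_right_mono) auto
      moreover have "0 \<le> (p (a * z + \<beta>))\<^sup>2 / (D z)\<^sup>2" by simp
      moreover have "2 * (p (a * z + \<beta>))\<^sup>2 / (D z)\<^sup>2 = 2 * ((p (a * z + \<beta>))\<^sup>2 / (D z)\<^sup>2)" by simp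
      ultimately show ?thesis using b(1) b(4,5,6)[of z] unfolding abs_le_iff by linarith
    qed
    then show "AE w in M. norm (a / D (Z w) - 2 * (p (a * Z w + \<beta>))\<^sup>2 / (D (Z w))\<^sup>2) \<le> 3 * a" by simp
  qed simp
qed

text \<open>With the imaginary part frozen, the form is a real quadratic in x = Re z, and Re (a z +
  \<beta>) = a x + Re \<beta> is half its derivative; the real part has variance v / 2.\<close>

lemma (in prob_space) stein_complex_Re:
  fixes a c :: real and \<beta> :: complex and Z :: "'a \<Rightarrow> complex"
  assumes Z: "complex_gaussian M v Z" and v: "0 < v" and q: "\<And>z :: complex. 0 \<le> qform a \<beta> c z"
  defines "D \<equiv> \<lambda>z :: complex. 1 + qform a \<beta> c z"
  shows "expectation (\<lambda>w. Re (Z w) * (Re (a * Z w + \<beta>) / D (Z w)))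
      = expectation (\<lambda>w. v / 2 * (a / D (Z w) - 2 * (Re (a * Z w + \<beta>))\<^sup>2 / (D (Z w))\<^sup>2))"
proof -
  have s: "0 < sqrt (v / 2)" using v by simp
  have dR: "distributed M lborel (\<lambda>w. Re (Z w)) (normal_density 0 (sqrt (v / 2)))"
    and ind: "indep_var borel (\<lambda>w. Re (Z w)) borel (\<lambda>w. Im (Z w))"
    using Z by (auto simp: complex_gaussian_def)
  have D: "1 + qform a \<beta> c z = D z" for z by (simp add: D_def)
  note int = stein_complex_integrable(1,2)[OF Z v q, of Re, unfolded D]
  have [measurable]: "D \<in> borel_measurable borel"
    unfolding D_def by (intro borel_measurable_continuous_onI continuous_intros)
  have [measurable]: "(\<lambda>p. Complex (f p) (g p)) \<in> borel_measurable N"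
    if "f \<in> borel_measurable N" "g \<in> borel_measurable N" for f g and N :: "(real \<times> real) measure"
    using that by (simp add: borel_measurable_complex_iff)
  let ?F = "\<lambda>(x, y). Re (Complex x y) * (Re (a * Complex x y + \<beta>) / D (Complex x y))"
  let ?G = "\<lambda>(x, y). v / 2 * (a / D (Complex x y) - 2 * (Re (a * Complex x y + \<beta>))\<^sup>2 / (D (Complex x y))\<^sup>2)"
  have "expectation (\<lambda>w. ?F (Re (Z w), Im (Z w))) = expectation (\<lambda>w. ?G (Re (Z w), Im (Z w)))"
  proof (rule indep_var_expectation_cong[OF ind])
    show "integrable M (\<lambda>w. ?F (Re (Z w), Im (Z w)))" using int(1) abs_Re_le_cmod by simp
    show "integrable M (\<lambda>w. ?G (Re (Z w), Im (Z w)))" using int(2) abs_Re_le_cmod by simp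
    fix y
    have qx: "qform a \<beta> c (Complex x y) = a * x\<^sup>2 + 2 * Re \<beta> * x + (a * y\<^sup>2 + 2 * y * Im \<beta> + c)" for x
      by (simp add: cmod_power2 algebra_simps)
    have "0 \<le> a * x\<^sup>2 + 2 * Re \<beta> * x + (a * y\<^sup>2 + 2 * y * Im \<beta> + c)" for x
      using q[of "Complex x y"] unfolding qx .
    note st = stein_rational[OF s dR this]
    have Dx: "D (Complex x y) = 1 + (a * x\<^sup>2 + 2 * Re \<beta> * x + (a * y\<^sup>2 + 2 * y * Im \<beta> + c))" for x
      unfolding D_def qx ..
    show "expectation (\<lambda>w. ?F (Re (Z w), y)) = expectation (\<lambda>w. ?G (Re (Z w), y))"
      using v st by (simp add: Dx)
  qed (unfold split_beta', measurable)
  then show ?thesis by simp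
qed

lemma (in prob_space) stein_complex:
  fixes a c :: real and \<beta> :: complex and Z :: "'a \<Rightarrow> complex"
  assumes Z: "complex_gaussian M v Z" and v: "0 < v" and q: "\<And>z :: complex. 0 \<le> qform a \<beta> c z"
  shows "expectation (\<lambda>w. stein_f a \<beta> c (Z w)) = v * expectation (\<lambda>w. stein_g a \<beta> c (Z w))"
proof -
  define D where "D z = 1 + qform a \<beta> c z" for z
  \<comment> \<open>The imaginary part reduces to the real part by exchanging the two components.\<close>
  define sw where "sw z = Complex (Im z) (Re z)" for z
  have Z': "complex_gaussian M v (\<lambda>w. sw (Z w))"
    using Z by (auto simp: complex_gaussian_def sw_def intro: indep_var_sym)
  have qsw: "qform a (sw \<beta>) c (sw z) = qform a \<beta> c z" for z
    by (simp add: sw_def cmod_power2 algebra_simps)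
  have q': "0 \<le> qform a (sw \<beta>) c z" for z
    using q[of "sw z"] unfolding qsw[symmetric] by (simp add: sw_def)
  have sw: "Re (sw z) = Im z" "Re (a * sw z + sw \<beta>) = Im (a * z + \<beta>)" for z :: complex by (simp_all add: sw_def)
  note int = stein_complex_integrable[OF Z v q, folded D_def]
  have ReIm: "\<bar>Re z\<bar> \<le> cmod z" "\<bar>Im z\<bar> \<le> cmod z" for z by (auto intro: abs_Re_le_cmod abs_Im_le_cmod)
  have partRe: "expectation (\<lambda>w. Re (Z w) * (Re (a * Z w + \<beta>) / D (Z w)))
      = expectation (\<lambda>w. v / 2 * (a / D (Z w) - 2 * (Re (a * Z w + \<beta>))\<^sup>2 / (D (Z w))\<^sup>2))"
    unfolding D_def by (rule stein_complex_Re[OF Z v q])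
  have partIm: "expectation (\<lambda>w. Im (Z w) * (Im (a * Z w + \<beta>) / D (Z w)))
      = expectation (\<lambda>w. v / 2 * (a / D (Z w) - 2 * (Im (a * Z w + \<beta>))\<^sup>2 / (D (Z w))\<^sup>2))"
    unfolding D_def using stein_complex_Re[OF Z' v q'] unfolding qsw sw .
  have "expectation (\<lambda>w. stein_f a \<beta> c (Z w))
    = expectation (\<lambda>w. Re (Z w) * (Re (a * Z w + \<beta>) / D (Z w)) + Im (Z w) * (Im (a * Z w + \<beta>) / D (Z w)))"
    unfolding D_def[symmetric]
    by (intro Bochner_Integration.integral_cong refl) (simp flip: add_divide_distrib)
  also have "\<dots> = expectation (\<lambda>w. v / 2 * (a / D (Z w) - 2 * (Re (a * Z w + \<beta>))\<^sup>2 / (D (Z w))\<^sup>2)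
      + v / 2 * (a / D (Z w) - 2 * (Im (a * Z w + \<beta>))\<^sup>2 / (D (Z w))\<^sup>2))"
    using int(1,2)[of Re] int(1,2)[of Im] ReIm partRe partIm
    by (subst (1 2) Bochner_Integration.integral_add) auto
  \<comment> \<open>The halves of the variance add up in the term with a, while the two squares
    complete |a z + \<beta>|^2; this is how the factor 2 disappears.\<close>
  also have "\<dots> = expectation (\<lambda>w. v * (a / D (Z w) - (cmod (a * Z w + \<beta>))\<^sup>2 / (D (Z w))\<^sup>2))"
  proof (intro Bochner_Integration.integral_cong refl)
    fix w
    have "v / 2 * (A - 2 * X / E) + v / 2 * (A - 2 * Y / E) = v * (A - (X + Y) / E)" for A X Y E :: real
      by (simp add: add_divide_distrib algebra_simps)
    then show "v / 2 * (a / D (Z w) - 2 * (Re (a * Z w + \<beta>))\<^sup>2 / (D (Z w))\<^sup>2)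
      + v / 2 * (a / D (Z w) - 2 * (Im (a * Z w + \<beta>))\<^sup>2 / (D (Z w))\<^sup>2)
      = v * (a / D (Z w) - (cmod (a * Z w + \<beta>))\<^sup>2 / (D (Z w))\<^sup>2)"
      unfolding cmod_power2[of "a * Z w + \<beta>"] .
  qed
  finally show ?thesis by (simp add: D_def)
qed

section \<open>Removing one column of the random matrix\<close>

definition gram_mat :: "complex mat \<Rightarrow> complex mat \<Rightarrow> complex mat" where
  "gram_mat A S = A * S * mat_adjoint S * mat_adjoint A"

definition res_mat :: "complex mat \<Rightarrow> complex mat \<Rightarrow> complex mat" where
  "res_mat A S = minv (1\<^sub>m (dim_row A) + gram_mat A S)"

text \<open>The resolvent carried over to the side of \<open>S\<close>, so that columns of
  \<open>S\<close> act on it directly. For this matrix M, the trace of M is m and the trace of S^H M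
  S is t.\<close>

definition cores_mat :: "complex mat \<Rightarrow> complex mat \<Rightarrow> complex mat" where
  "cores_mat A S = mat_adjoint A * res_mat A S * A"

text \<open>Clearing a column changes the Gram matrix as deleting it would, but keeps the
  dimensions.\<close>

definition zero_col :: "nat \<Rightarrow> complex mat \<Rightarrow> complex mat" where
  "zero_col k S = Matrix.mat (dim_row S) (dim_col S) (\<lambda>(i, j). if j = k then 0 else S $$ (i, j))"

lemma zero_col_carrier [simp]: "S \<in> carrier_mat n N \<Longrightarrow> zero_col k S \<in> carrier_mat n N"
  by (auto simp: zero_col_def)

lemma gram_mat_eq:
  assumes "A \<in> carrier_mat n n" "S \<in> carrier_mat n N"
  shows "gram_mat A S = (A * S) * mat_adjoint (A * S)"
  using carrier_matD[OF assms(1)] carrier_matD[OF assms(2)]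
  by (simp add: gram_mat_def mat_adjoint_mult_dim assoc_mult_dim)

lemma gram_mat_psd:
  assumes "A \<in> carrier_mat n n" "S \<in> carrier_mat n N"
  shows "hermitian_psd n (gram_mat A S)"
  unfolding gram_mat_eq[OF assms] by (rule hermitian_psd_mult_adjoint[OF mult_carrier_mat[OF assms]])

lemma res_mat:
  assumes "A \<in> carrier_mat n n" "S \<in> carrier_mat n N"
  shows "res_mat A S \<in> carrier_mat n n" "(1\<^sub>m n + gram_mat A S) * res_mat A S = 1\<^sub>m n"
    "res_mat A S * (1\<^sub>m n + gram_mat A S) = 1\<^sub>m n"
    "hermitian_psd n (res_mat A S)" "hermitian_psd n (1\<^sub>m n - res_mat A S)"
    "1\<^sub>m n - res_mat A S = res_mat A S * gram_mat A S"
  using minv_one_plus_psd[OF gram_mat_psd[OF assms]] hermitian_psd_minv[OF gram_mat_psd[OF assms]]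
    hermitian_psd_one_minus_minv[OF gram_mat_psd[OF assms]] one_minus_minv[OF gram_mat_psd[OF assms]]
    assms by (simp_all add: res_mat_def)

lemma cores_mat_psd:
  assumes "A \<in> carrier_mat n n" "S \<in> carrier_mat n N"
  shows "hermitian_psd n (cores_mat A S)" "cores_mat A S \<in> carrier_mat n n"
  using hermitian_psd_congruence[OF res_mat(4)[OF assms] assms(1)]
  by (auto simp: cores_mat_def hermitian_psd_carrier)

text \<open>The resolvent is at most I. The bound does not involve \<open>S\<close> and so supplies
  dominating constants for integrability.\<close>

lemma cores_mat_diag_le:
  assumes A: "A \<in> carrier_mat n n" and S: "S \<in> carrier_mat n N" and i: "i < n"
  shows "Re (cores_mat A S $$ (i, i)) \<le> Re ((mat_adjoint A * A) $$ (i, i))"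
proof -
  note [simp] = A res_mat(1)[OF A S] carrier_matD[OF A] carrier_matD[OF res_mat(1)[OF A S]]
  have "mat_adjoint A * (1\<^sub>m n - res_mat A S) * A = mat_adjoint A * A - cores_mat A S"
    unfolding cores_mat_def
    by (subst mult_minus_distrib_mat[of _ n n _ n], simp_all)
       (subst minus_mult_distrib_mat[of _ n n _ _ n], auto intro!: mult_carrier_mat[of _ _ n])
  with hermitian_psd_diag(1)[OF hermitian_psd_congruence[OF res_mat(5)[OF A S] A] i] show ?thesis
    using i by (simp add: cores_mat_def)
qed

text \<open>Column k contributes the rank-one matrix w w^H, stated by its action on vectors as the
  Sherman--Morrison formula uses it.\<close>

lemma gram_mat_mult_vec:
  assumes A: "A \<in> carrier_mat n n" and S: "S \<in> carrier_mat n N" and k: "k < N" and v: "v \<in> carrier_vec n"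
  defines "w \<equiv> A *\<^sub>v col S k"
  shows "gram_mat A S *\<^sub>v v = gram_mat A (zero_col k S) *\<^sub>v v + (v \<bullet>c w) \<cdot>\<^sub>v w"
proof -
  have key: "(gram_mat A R *\<^sub>v v) $ i = (\<Sum>l<N. (A * R) $$ (i, l) * (v \<bullet>c col (A * R) l))"
    if R: "R \<in> carrier_mat n N" and i: "i < n" for R i
  proof -
    have C: "A * R \<in> carrier_mat n N" by (rule mult_carrier_mat[OF A R])
    have "gram_mat A R *\<^sub>v v = (A * R) *\<^sub>v (mat_adjoint (A * R) *\<^sub>v v)"
      unfolding gram_mat_eq[OF A R] using C v by (intro assoc_mult_mat_vec[of _ n N _ n]) simp_all
    moreover have "(mat_adjoint (A * R) *\<^sub>v v) $ l = v \<bullet>c col (A * R) l" if "l < N" for l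
      using that carrier_matD[OF C] carrier_vecD[OF v] carrier_matD[OF A] carrier_matD[OF R]
      by (auto simp: scalar_prod_def mult.commute intro!: sum.cong)
    ultimately show ?thesis
      using i carrier_matD[OF C] carrier_matD[OF A] carrier_matD[OF R]
      by (simp add: scalar_prod_def[of "row _ _"] lessThan_atLeast0)
  qed
  have S0: "zero_col k S \<in> carrier_mat n N" using S by simp
  have c0: "col (A * zero_col k S) l = (if l = k then 0\<^sub>v n else col (A * S) l)" if "l < N" for l
    using that A S k by (intro eq_vecI) (auto simp: scalar_prod_def zero_col_def intro!: sum.cong sum.neutral)
  have ck: "col (A * S) k = w" using A S k by (intro eq_vecI) (auto simp: w_def)
  show ?thesis
  proof (rule eq_vecI)
    fix i assume "i < dim_vec (gram_mat A (zero_col k S) *\<^sub>v v + (v \<bullet>c w) \<cdot>\<^sub>v w)"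
    then have i: "i < n" using A by (simp add: w_def)
    have Ci: "(A * R) $$ (i, l) = col (A * R) l $ i" if "l < N" "R \<in> carrier_mat n N" for R l
      using that i A by (auto simp: carrier_matD)
    have "(gram_mat A S *\<^sub>v v) $ i = (\<Sum>l\<in>{..<N} - {k}. col (A * S) l $ i * (v \<bullet>c col (A * S) l)) + w $ i * (v \<bullet>c w)"
      unfolding key[OF S i] using k Ci[OF _ S] by (simp add: sum.remove[of _ k] ck add.commute)
    also have "(\<Sum>l\<in>{..<N} - {k}. col (A * S) l $ i * (v \<bullet>c col (A * S) l)) = (gram_mat A (zero_col k S) *\<^sub>v v) $ i"
      unfolding key[OF S0 i] using k Ci[OF _ S0] i by (simp add: sum.remove[of _ k] c0)
    finally show "(gram_mat A S *\<^sub>v v) $ i = (gram_mat A (zero_col k S) *\<^sub>v v + (v \<bullet>c w) \<cdot>\<^sub>v w) $ i"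
      using i A by (simp add: w_def gram_mat_def mult.commute)
  qed (use A in \<open>simp add: w_def gram_mat_def\<close>)
qed

text \<open>\<open>B\<close> does not involve column k, so \<open>M\<close> becomes an explicit
  function of that column. The rank-one formula between A^H and A reads B v = M v + <B v, s> M s;
  taking v = s gives B s = (1 + q) M s, and a unit vector v gives the diagonal entry.\<close>

lemma cores_mat_leave_one_out:
  assumes A: "A \<in> carrier_mat n n" and S: "S \<in> carrier_mat n N" and k: "k < N"
  defines "s \<equiv> col S k" and "M \<equiv> cores_mat A S" and "B \<equiv> cores_mat A (zero_col k S)"
  defines "q \<equiv> Re ((B *\<^sub>v s) \<bullet>c s)"
  shows "0 \<le> q" "M *\<^sub>v s = complex_of_real (1 / (1 + q)) \<cdot>\<^sub>v (B *\<^sub>v s)"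
    "Re ((M *\<^sub>v s) \<bullet>c s) = q / (1 + q)"
    "i < n \<Longrightarrow> Re (M $$ (i, i)) = Re (B $$ (i, i)) - (cmod ((B *\<^sub>v s) $ i))\<^sup>2 / (1 + q)"
proof -
  have S0: "zero_col k S \<in> carrier_mat n N" using S by simp
  define Q where "Q = res_mat A S"
  define Q0 where "Q0 = res_mat A (zero_col k S)"
  have Q [simp]: "Q \<in> carrier_mat n n" "dim_row Q = n" "dim_col Q = n"
    and Q0 [simp]: "Q0 \<in> carrier_mat n n" "dim_row Q0 = n" "dim_col Q0 = n"
    using res_mat(1)[OF A S] res_mat(1)[OF A S0] by (auto simp: Q_def Q0_def)
  note [simp] = A carrier_matD[OF A]
  have Mc [simp]: "M \<in> carrier_mat n n" and Bc [simp]: "B \<in> carrier_mat n n" and Bp: "hermitian_psd n B"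
    using cores_mat_psd[OF A S] cores_mat_psd[OF A S0] by (auto simp: M_def B_def)
  have s [simp]: "s \<in> carrier_vec n" using S by (auto simp: s_def intro!: carrier_vecI)
  define w where "w = A *\<^sub>v s"
  have mv [simp]: "P *\<^sub>v v \<in> carrier_vec n" if "P \<in> carrier_mat n n" "v \<in> carrier_vec n" for P :: "complex mat" and v
    using that by (rule mult_mat_vec_carrier)
  have w [simp]: "w \<in> carrier_vec n" by (simp add: w_def)
  let ?X = "1\<^sub>m n + gram_mat A S" and ?Y = "1\<^sub>m n + gram_mat A (zero_col k S)"
  note gc = hermitian_psd_carrier[OF gram_mat_psd[OF A S]] hermitian_psd_carrier[OF gram_mat_psd[OF A S0]]
  have Xv: "?X *\<^sub>v v = ?Y *\<^sub>v v + (v \<bullet>c w) \<cdot>\<^sub>v w" if v: "v \<in> carrier_vec n" for v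
  proof -
    have "?X *\<^sub>v v = v + gram_mat A S *\<^sub>v v"
      using v gc by (simp add: add_mult_distrib_mat_vec[of _ n n])
    also have "gram_mat A S *\<^sub>v v = gram_mat A (zero_col k S) *\<^sub>v v + (v \<bullet>c w) \<cdot>\<^sub>v w"
      unfolding w_def s_def by (rule gram_mat_mult_vec[OF A S k v])
    also have "v + (gram_mat A (zero_col k S) *\<^sub>v v + (v \<bullet>c w) \<cdot>\<^sub>v w) = ?Y *\<^sub>v v + (v \<bullet>c w) \<cdot>\<^sub>v w"
      using v gc mv[OF gc(2) v] by (simp add: add_mult_distrib_mat_vec[of _ n n] assoc_add_vec[of _ n])
    finally show ?thesis .
  qed
  have X0Q0: "?Y *\<^sub>v (Q0 *\<^sub>v v) = v" if "v \<in> carrier_vec n" for v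
    using res_mat(2)[OF A S0, folded Q0_def] that gc by (simp flip: assoc_mult_mat_vec[of _ n n _ n])
  have QX: "Q *\<^sub>v (?X *\<^sub>v v) = v" if "v \<in> carrier_vec n" for v
    using res_mat(3)[OF A S, folded Q_def] that gc by (simp flip: assoc_mult_mat_vec[of _ n n _ n])
  \<comment> \<open>Sherman--Morrison: the inverse after a rank-one update by \<open>w\<close>.\<close>
  have SM: "Q0 *\<^sub>v v = Q *\<^sub>v v + ((Q0 *\<^sub>v v) \<bullet>c w) \<cdot>\<^sub>v (Q *\<^sub>v w)" if v: "v \<in> carrier_vec n" for v
  proof -
    have "Q0 *\<^sub>v v = Q *\<^sub>v (?X *\<^sub>v (Q0 *\<^sub>v v))" using v by (simp add: QX)
    also have "?X *\<^sub>v (Q0 *\<^sub>v v) = v + ((Q0 *\<^sub>v v) \<bullet>c w) \<cdot>\<^sub>v w" using v by (simp add: Xv X0Q0)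
    finally show ?thesis using v by (simp add: mult_add_distrib_mat_vec[of _ n n] mult_mat_vec[of _ n n])
  qed
  have Mv: "M *\<^sub>v v = mat_adjoint A *\<^sub>v (Q *\<^sub>v (A *\<^sub>v v))" if "v \<in> carrier_vec n" for v
    using that carrier_vecD[OF that] by (simp add: M_def cores_mat_def Q_def[symmetric] assoc_mult_vec_dim)
  have Bv: "B *\<^sub>v v = mat_adjoint A *\<^sub>v (Q0 *\<^sub>v (A *\<^sub>v v))" if "v \<in> carrier_vec n" for v
    using that carrier_vecD[OF that] by (simp add: B_def cores_mat_def Q0_def[symmetric] assoc_mult_vec_dim)
  have form: "(B *\<^sub>v v) \<bullet>c s = (Q0 *\<^sub>v (A *\<^sub>v v)) \<bullet>c w" if "v \<in> carrier_vec n" for v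
    using cscalar_prod_adjoint[of "mat_adjoint A" n n "Q0 *\<^sub>v (A *\<^sub>v v)" s] that by (simp add: Bv w_def)
  show q0: "0 \<le> q" unfolding q_def by (rule hermitian_psd_form[OF Bp s])
  have q: "(B *\<^sub>v s) \<bullet>c s = complex_of_real q"
    using hermitian_form_Im[OF Bc hermitian_psd_adjoint[OF Bp] s] by (simp add: q_def complex_eq_iff)
  have main: "B *\<^sub>v v = M *\<^sub>v v + ((B *\<^sub>v v) \<bullet>c s) \<cdot>\<^sub>v (M *\<^sub>v s)" if v: "v \<in> carrier_vec n" for v
  proof -
    have "B *\<^sub>v v = mat_adjoint A *\<^sub>v (Q *\<^sub>v (A *\<^sub>v v) + ((Q0 *\<^sub>v (A *\<^sub>v v)) \<bullet>c w) \<cdot>\<^sub>v (Q *\<^sub>v w))"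
      unfolding Bv[OF v] using v by (subst SM) simp_all
    also have "\<dots> = M *\<^sub>v v + ((Q0 *\<^sub>v (A *\<^sub>v v)) \<bullet>c w) \<cdot>\<^sub>v (M *\<^sub>v s)"
      using v by (simp add: mult_add_distrib_mat_vec[of _ n n] mult_mat_vec[of _ n n] Mv w_def)
    finally show ?thesis unfolding form[OF v] .
  qed
  have Ms: "(M *\<^sub>v s) $ j = (B *\<^sub>v s) $ j / (1 + complex_of_real q)" if "j < n" for j
  proof -
    have "(B *\<^sub>v s) $ j = (M *\<^sub>v s) $ j + complex_of_real q * (M *\<^sub>v s) $ j"
      using arg_cong[OF main[OF s], of "\<lambda>v. v $ j"] that carrier_matD[OF Mc] by (simp add: q)
    moreover have "1 + complex_of_real q \<noteq> 0" using q0 by (auto simp: complex_eq_iff)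
    ultimately show ?thesis by (simp add: field_simps)
  qed
  show M_s: "M *\<^sub>v s = complex_of_real (1 / (1 + q)) \<cdot>\<^sub>v (B *\<^sub>v s)"
    using Ms carrier_matD[OF Mc] carrier_matD[OF Bc] by (intro eq_vecI) auto
  show "Re ((M *\<^sub>v s) \<bullet>c s) = q / (1 + q)"
    unfolding M_s by (simp add: smult_scalar_prod_distrib[of _ n] q)
  assume i: "i < n"
  let ?e = "unit_vec n i :: complex vec"
  have Be: "(B *\<^sub>v ?e) \<bullet>c s = cnj ((B *\<^sub>v s) $ i)"
  proof -
    have "(B *\<^sub>v ?e) \<bullet>c s = cnj ((B *\<^sub>v s) \<bullet>c ?e)"
      using hermitian_form_cnj[OF Bc hermitian_psd_adjoint[OF Bp] s, of ?e] by simp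
    moreover have "conjugate ?e = ?e" by (rule eq_vecI) (auto simp: unit_vec_def)
    ultimately show ?thesis using i carrier_matD[OF Bc] by simp
  qed
  have "B $$ (i, i) = M $$ (i, i) + cnj ((B *\<^sub>v s) $ i) * ((B *\<^sub>v s) $ i / (1 + complex_of_real q))"
    using arg_cong[OF main[of ?e], of "\<lambda>v. v $ i"] i carrier_matD[OF Mc] carrier_matD[OF Bc] Be Ms[OF i] by simp
  also have "cnj ((B *\<^sub>v s) $ i) * ((B *\<^sub>v s) $ i / (1 + complex_of_real q))
      = complex_of_real ((cmod ((B *\<^sub>v s) $ i))\<^sup>2 / (1 + q))"
    unfolding of_real_divide complex_norm_square by (simp add: mult.commute)
  finally show "Re (M $$ (i, i)) = Re (B $$ (i, i)) - (cmod ((B *\<^sub>v s) $ i))\<^sup>2 / (1 + q)" by simp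
qed

section \<open>Dependence on a single entry\<close>

definition stein_lhs :: "complex mat \<Rightarrow> nat \<Rightarrow> nat \<Rightarrow> complex mat \<Rightarrow> real" where
  "stein_lhs A i k S = Re (cnj (S $$ (i, k)) * (cores_mat A S * S) $$ (i, k))"

text \<open>M_ii (1 - (S^H M S)_kk) is the Wirtinger derivative of (M S)_ik with respect to S_ik, in
  a form where i and k separate.\<close>

definition stein_rhs :: "complex mat \<Rightarrow> nat \<Rightarrow> nat \<Rightarrow> complex mat \<Rightarrow> real" where
  "stein_rhs A i k S = Re (cores_mat A S $$ (i, i)) * (1 - Re ((mat_adjoint S * cores_mat A S * S) $$ (k, k)))"

lemma cores_mat_entries:
  assumes A: "A \<in> carrier_mat n n" and S: "S \<in> carrier_mat n N" and k: "k < N"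
  shows "i < n \<Longrightarrow> (cores_mat A S * S) $$ (i, k) = (cores_mat A S *\<^sub>v col S k) $ i"
    "(mat_adjoint S * cores_mat A S * S) $$ (k, k) = (cores_mat A S *\<^sub>v col S k) \<bullet>c col S k"
proof -
  note M = cores_mat_psd(2)[OF A S]
  note [simp] = carrier_matD[OF M] carrier_matD[OF S]
  show "i < n \<Longrightarrow> (cores_mat A S * S) $$ (i, k) = (cores_mat A S *\<^sub>v col S k) $ i"
    using k by simp
  have "col (cores_mat A S * S) k = cores_mat A S *\<^sub>v col S k"
    using k by (intro eq_vecI) simp_all
  moreover have "row (mat_adjoint S) k \<bullet> u = u \<bullet>c col S k" if "dim_vec u = n" for u
    using that k by (auto simp: scalar_prod_def mult.commute intro!: sum.cong)
  ultimately show "(mat_adjoint S * cores_mat A S * S) $$ (k, k) = (cores_mat A S *\<^sub>v col S k) \<bullet>c col S k"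
    using k by (simp add: assoc_mult_dim)
qed

text \<open>Isolates the i-th coordinate of \<open>u\<close> and thereby delivers the coefficients
  of \<open>qform\<close>.\<close>

lemma hermitian_form_entry:
  assumes B: "hermitian_psd n B" and u: "u \<in> carrier_vec n" and i: "i < n"
  defines "u0 \<equiv> Matrix.vec n (\<lambda>j. if j = i then 0 else u $ j)"
  shows "(B *\<^sub>v u) $ i = Re (B $$ (i, i)) * u $ i + (B *\<^sub>v u0) $ i"
    "Re ((B *\<^sub>v u) \<bullet>c u) = Re (B $$ (i, i)) * (cmod (u $ i))\<^sup>2 + 2 * Re (cnj (u $ i) * (B *\<^sub>v u0) $ i) + Re ((B *\<^sub>v u0) \<bullet>c u0)"
proof -
  note Bc = hermitian_psd_carrier[OF B]
  note [simp] = Bc carrier_matD[OF Bc]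
  let ?e = "unit_vec n i :: complex vec"
  have mv [simp]: "B *\<^sub>v v \<in> carrier_vec n" if "v \<in> carrier_vec n" for v
    using Bc that by (rule mult_mat_vec_carrier)
  have u0 [simp]: "u0 \<in> carrier_vec n" by (simp add: u0_def)
  have u_eq: "u = u0 + u $ i \<cdot>\<^sub>v ?e"
    using u i by (intro eq_vecI) (auto simp: u0_def)
  have Bu: "B *\<^sub>v u = B *\<^sub>v u0 + u $ i \<cdot>\<^sub>v (B *\<^sub>v ?e)"
    by (subst u_eq) (simp add: mult_add_distrib_mat_vec[of _ n n] mult_mat_vec[of _ n n])
  have Bii: "complex_of_real (Re (B $$ (i, i))) = B $$ (i, i)"
    using hermitian_psd_diag(2)[OF B i] by (simp add: complex_eq_iff)
  have Bei: "(B *\<^sub>v ?e) $ i = B $$ (i, i)" using i by simp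
  show 1: "(B *\<^sub>v u) $ i = Re (B $$ (i, i)) * u $ i + (B *\<^sub>v u0) $ i"
    using arg_cong[OF Bu, of "\<lambda>v. v $ i"] i unfolding Bii by (simp add: Bei del: mult_mat_vec)
  have ce: "v \<bullet>c ?e = v $ i" if "v \<in> carrier_vec n" for v
  proof -
    have "conjugate ?e = ?e" by (rule eq_vecI) (auto simp: unit_vec_def)
    then show ?thesis using i that by simp
  qed
  have cu: "v \<bullet>c u = v \<bullet>c u0 + cnj (u $ i) * v $ i" if v: "v \<in> carrier_vec n" for v
  proof -
    have "v \<bullet>c u = cnj (u \<bullet>c v)" using v u by (subst cscalar_prod_cnj) (auto simp: carrier_vecD)
    also have "u \<bullet>c v = u0 \<bullet>c v + u $ i * (?e \<bullet>c v)"
      by (subst u_eq, subst cscalar_prod_add[of _ n]) (use v in \<open>auto simp: smult_scalar_prod_distrib[of _ n]\<close>)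
    also have "cnj \<dots> = cnj (u0 \<bullet>c v) + cnj (u $ i) * cnj (?e \<bullet>c v)" by simp
    also have "cnj (u0 \<bullet>c v) = v \<bullet>c u0" using v by (subst cscalar_prod_cnj) (auto simp: carrier_vecD)
    also have "cnj (?e \<bullet>c v) = v $ i" using ce[OF v] v by (subst cscalar_prod_cnj) (auto simp: carrier_vecD)
    finally show ?thesis .
  qed
  have Bu0: "(B *\<^sub>v ?e) \<bullet>c u0 = cnj ((B *\<^sub>v u0) $ i)"
    using hermitian_form_cnj[OF Bc hermitian_psd_adjoint[OF B] u0, of ?e] ce[of "B *\<^sub>v u0"] by simp
  have "(B *\<^sub>v u) \<bullet>c u = (B *\<^sub>v u0) \<bullet>c u0 + u $ i * cnj ((B *\<^sub>v u0) $ i)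
      + cnj (u $ i) * (Re (B $$ (i, i)) * u $ i + (B *\<^sub>v u0) $ i)"
  proof -
    have "(B *\<^sub>v u) \<bullet>c u0 = (B *\<^sub>v u0) \<bullet>c u0 + u $ i * ((B *\<^sub>v ?e) \<bullet>c u0)"
      unfolding Bu by (subst cscalar_prod_add[of _ n]) (auto simp: smult_scalar_prod_distrib[of _ n])
    then show ?thesis using cu[of "B *\<^sub>v u"] u 1 Bu0 by simp
  qed
  then show "Re ((B *\<^sub>v u) \<bullet>c u) = Re (B $$ (i, i)) * (cmod (u $ i))\<^sup>2 + 2 * Re (cnj (u $ i) * (B *\<^sub>v u0) $ i) + Re ((B *\<^sub>v u0) \<bullet>c u0)"
    by (simp add: cmod_power2) (simp add: power2_eq_square algebra_simps)
qed

lemma stein_entry: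
  assumes A: "A \<in> carrier_mat n n" and i: "i < n" and k: "k < N"
  obtains a c :: real and \<beta> :: complex where
    "\<And>z :: complex. 0 \<le> qform a \<beta> c z" "a \<le> Re ((mat_adjoint A * A) $$ (i, i))"
    "\<And>S. S \<in> carrier_mat n N \<Longrightarrow> (\<And>i' k'. i' < n \<Longrightarrow> k' < N \<Longrightarrow> (i', k') \<noteq> (i, k) \<Longrightarrow> S $$ (i', k') = R (i', k')) \<Longrightarrow>
      stein_lhs A i k S = stein_f a \<beta> c (S $$ (i, k)) \<and>
      stein_rhs A i k S = stein_g a \<beta> c (S $$ (i, k))"
proof -
  define S0 where "S0 = Matrix.mat n N (\<lambda>(i', k'). if k' = k then 0 else R (i', k'))"
  have S0: "S0 \<in> carrier_mat n N" by (simp add: S0_def)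
  define B where "B = cores_mat A S0"
  have B: "hermitian_psd n B" using cores_mat_psd[OF A S0] by (simp add: B_def)
  define u0 where "u0 = Matrix.vec n (\<lambda>j. if j = i then 0 else R (j, k))"
  define a where "a = Re (B $$ (i, i))"
  define \<beta> where "\<beta> = (B *\<^sub>v u0) $ i"
  define c where "c = Re ((B *\<^sub>v u0) \<bullet>c u0)"
  have form: "(B *\<^sub>v u) $ i = a * u $ i + \<beta>"
    "Re ((B *\<^sub>v u) \<bullet>c u) = qform a \<beta> c (u $ i)"
    if u: "u \<in> carrier_vec n" and "\<And>j. j < n \<Longrightarrow> j \<noteq> i \<Longrightarrow> u $ j = R (j, k)" for u
  proof -
    have "Matrix.vec n (\<lambda>j. if j = i then 0 else u $ j) = u0"
      using that(2) by (intro eq_vecI) (auto simp: u0_def)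
    then show "(B *\<^sub>v u) $ i = a * u $ i + \<beta>"
      "Re ((B *\<^sub>v u) \<bullet>c u) = qform a \<beta> c (u $ i)"
      using hermitian_form_entry[OF B u i] by (simp_all add: a_def \<beta>_def c_def)
  qed
  show ?thesis
  proof (rule that)
    show "a \<le> Re ((mat_adjoint A * A) $$ (i, i))"
      unfolding a_def B_def by (rule cores_mat_diag_le[OF A S0 i])
    show "0 \<le> qform a \<beta> c z" for z :: complex
    proof -
      let ?u = "Matrix.vec n (\<lambda>j. if j = i then z else R (j, k))"
      have "Re ((B *\<^sub>v ?u) \<bullet>c ?u) = qform a \<beta> c z"
        using form(2)[of ?u] i by simp
      with hermitian_psd_form[OF B, of ?u] show ?thesis by simp
    qed
    fix S assume S: "S \<in> carrier_mat n N"
      and eq: "\<And>i' k'. i' < n \<Longrightarrow> k' < N \<Longrightarrow> (i', k') \<noteq> (i, k) \<Longrightarrow> S $$ (i', k') = R (i', k')"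
    have z: "zero_col k S = S0"
      using S eq by (intro eq_matI) (auto simp: zero_col_def S0_def)
    let ?s = "col S k" and ?z = "S $$ (i, k)"
    let ?q = "qform a \<beta> c ?z"
    have sc: "?s \<in> carrier_vec n" using S by (auto intro!: carrier_vecI)
    have si: "?s $ i = ?z" using S i k by simp
    have sj: "?s $ j = R (j, k)" if "j < n" "j \<noteq> i" for j using S k that eq by simp
    note f = form[OF sc sj, unfolded si]
    note loo = cores_mat_leave_one_out[OF A S k, unfolded z B_def[symmetric]]
    have q: "0 \<le> ?q" using loo(1) f(2) by simp
    have lhs: "(cores_mat A S * S) $$ (i, k) = (a * ?z + \<beta>) / (1 + ?q)"
      using cores_mat_entries(1)[OF A S k i] loo(2) f i carrier_matD[OF hermitian_psd_carrier[OF B]]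
      by simp
    have "stein_lhs A i k S = Re (cnj ?z * (a * ?z + \<beta>)) / (1 + ?q)"
      unfolding stein_lhs_def lhs times_divide_eq_right by (metis Re_divide_of_real of_real_1 of_real_add)
    moreover have "stein_rhs A i k S = (a - (cmod (a * ?z + \<beta>))\<^sup>2 / (1 + ?q)) * (1 - ?q / (1 + ?q))"
      unfolding stein_rhs_def cores_mat_entries(2)[OF A S k] using loo(3) loo(4)[OF i] f by (simp add: a_def)
    \<comment> \<open>The factor 1 - q / (1 + q) = 1 / (1 + q) supplies the second power of the
      denominator.\<close>
    moreover have "\<dots> = a / (1 + ?q) - (cmod (a * ?z + \<beta>))\<^sup>2 / (1 + ?q)\<^sup>2"
    proof -
      have *: "(a - x / (1 + r)) * (1 - r / (1 + r)) = a / (1 + r) - x / (1 + r)\<^sup>2" if "0 \<le> r" for x r :: real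
      proof -
        have "1 - r / (1 + r) = 1 / (1 + r)" using that by (simp add: field_simps)
        then show ?thesis by (simp add: diff_divide_distrib power2_eq_square)
      qed
      show ?thesis by (rule *[OF q])
    qed
    ultimately show "stein_lhs A i k S = Re (cnj ?z * (a * ?z + \<beta>)) / (1 + ?q) \<and>
      stein_rhs A i k S = a / (1 + ?q) - (cmod (a * ?z + \<beta>))\<^sup>2 / (1 + ?q)\<^sup>2" by simp
  qed
qed

section \<open>Stein's identity for the random matrix\<close>

text \<open>Entrywise measurability takes the place of a sigma-algebra on matrices; the dimensions
  belong to the values and are fixed along with it.\<close>

definition mat_measurable :: "'a measure \<Rightarrow> nat \<Rightarrow> nat \<Rightarrow> ('a \<Rightarrow> complex mat) \<Rightarrow> bool" where
  "mat_measurable L n m f \<longleftrightarrow> (\<forall>w\<in>space L. f w \<in> carrier_mat n m) \<and>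
     (\<forall>i<n. \<forall>j<m. (\<lambda>w. f w $$ (i, j)) \<in> borel_measurable L)"

lemma mat_measurableD:
  assumes "mat_measurable L n m f"
  shows "w \<in> space L \<Longrightarrow> f w \<in> carrier_mat n m"
    "i < n \<Longrightarrow> j < m \<Longrightarrow> (\<lambda>w. f w $$ (i, j)) \<in> borel_measurable L"
  using assms by (auto simp: mat_measurable_def)

lemma mat_measurable_eqI:
  assumes "\<And>w. w \<in> space L \<Longrightarrow> f w \<in> carrier_mat n m"
    and "\<And>i j w. i < n \<Longrightarrow> j < m \<Longrightarrow> w \<in> space L \<Longrightarrow> f w $$ (i, j) = g i j w"
    and "\<And>i j. i < n \<Longrightarrow> j < m \<Longrightarrow> g i j \<in> borel_measurable L"
  shows "mat_measurable L n m f"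
  unfolding mat_measurable_def
proof (intro conjI ballI allI impI)
  fix i j assume "i < n" "j < m"
  then show "(\<lambda>w. f w $$ (i, j)) \<in> borel_measurable L"
    using assms(2,3) by (subst measurable_cong[where g = "g i j"]) auto
qed (rule assms(1))

lemma mat_measurable_const: "A \<in> carrier_mat n m \<Longrightarrow> mat_measurable L n m (\<lambda>_. A)"
  by (simp add: mat_measurable_def)

lemma mat_measurable_mult:
  assumes f: "mat_measurable L n m f" and g: "mat_measurable L m p g"
  shows "mat_measurable L n p (\<lambda>w. f w * g w)"
proof (rule mat_measurable_eqI)
  show "f w * g w \<in> carrier_mat n p" if "w \<in> space L" for w
    using mat_measurableD(1)[OF f that] mat_measurableD(1)[OF g that] by (rule mult_carrier_mat)
  show "(f w * g w) $$ (i, j) = (\<Sum>k<m. f w $$ (i, k) * g w $$ (k, j))"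
    if "i < n" "j < p" "w \<in> space L" for i j w
    using mat_measurableD(1)[OF f that(3)] mat_measurableD(1)[OF g that(3)] that
    by (auto simp: scalar_prod_def lessThan_atLeast0 intro!: sum.cong)
qed (auto intro!: borel_measurable_sum borel_measurable_times mat_measurableD(2)[OF f] mat_measurableD(2)[OF g])

lemma mat_measurable_add:
  assumes f: "mat_measurable L n m f" and g: "mat_measurable L n m g"
  shows "mat_measurable L n m (\<lambda>w. f w + g w)"
proof (rule mat_measurable_eqI)
  show "f w + g w \<in> carrier_mat n m" if "w \<in> space L" for w
    using mat_measurableD(1)[OF f that] mat_measurableD(1)[OF g that] by (intro add_carrier_mat)
  show "(f w + g w) $$ (i, j) = f w $$ (i, j) + g w $$ (i, j)"
    if "i < n" "j < m" "w \<in> space L" for i j w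
    using mat_measurableD(1)[OF f that(3)] mat_measurableD(1)[OF g that(3)] that by auto
qed (auto intro!: borel_measurable_add mat_measurableD(2)[OF f] mat_measurableD(2)[OF g])

lemma mat_measurable_adjoint:
  assumes f: "mat_measurable L n m f"
  shows "mat_measurable L m n (\<lambda>w. mat_adjoint (f w))"
proof (rule mat_measurable_eqI)
  show "mat_adjoint (f w) \<in> carrier_mat m n" if "w \<in> space L" for w
    using mat_measurableD(1)[OF f that] by simp
  show "mat_adjoint (f w) $$ (i, j) = cnj (f w $$ (j, i))"
    if "i < m" "j < n" "w \<in> space L" for i j w
    using mat_measurableD(1)[OF f that(3)] that by auto
  show "(\<lambda>w. cnj (f w $$ (j, i))) \<in> borel_measurable L" if "i < m" "j < n" for i j
    using mat_measurableD(2)[OF f that(2,1)]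
    by (rule borel_measurable_continuous_on[OF continuous_on_cnj[OF continuous_on_id]])
qed

text \<open>By the Leibniz formula the determinant is a polynomial in the entries.\<close>

lemma det_measurable:
  assumes f: "mat_measurable L n n f"
  shows "(\<lambda>w. Determinant.det (f w)) \<in> borel_measurable L"
proof -
  have "(\<lambda>w. \<Sum>p\<in>{p. p permutes {0..<n}}. signof p * (\<Prod>i = 0..<n. f w $$ (i, p i))) \<in> borel_measurable L"
  proof (intro borel_measurable_sum borel_measurable_times borel_measurable_const borel_measurable_prod)
    fix p i assume "p \<in> {p. p permutes {0..<n}}" "i \<in> {0..<n}"
    then have "i < n" "p i < n" using permutes_in_image[of p "{0..<n}" i] by auto
    then show "(\<lambda>w. f w $$ (i, p i)) \<in> borel_measurable L" by (rule mat_measurableD(2)[OF f])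
  qed
  then show ?thesis
    using mat_measurableD(1)[OF f] by (subst measurable_cong[OF det_def']) auto
qed

lemma mat_measurable_delete:
  assumes f: "mat_measurable L n n f" and "i < n" "j < n"
  shows "mat_measurable L (n - 1) (n - 1) (\<lambda>w. mat_delete (f w) i j)"
proof (rule mat_measurable_eqI)
  show "mat_delete (f w) i j \<in> carrier_mat (n - 1) (n - 1)" if "w \<in> space L" for w
    using mat_measurableD(1)[OF f that] by (simp add: mat_delete_def)
  show "mat_delete (f w) i j $$ (i', j') = f w $$ (if i' < i then i' else Suc i', if j' < j then j' else Suc j')"
    if "i' < n - 1" "j' < n - 1" "w \<in> space L" for i' j' w
    using mat_measurableD(1)[OF f that(3)] that by (simp add: mat_delete_def)
qed (use assms in \<open>auto intro!: mat_measurableD(2)[OF f]\<close>)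

lemma mat_measurable_minv:
  assumes f: "mat_measurable L n n f"
  shows "mat_measurable L n n (\<lambda>w. minv (f w))"
proof (rule mat_measurable_eqI)
  show "minv (f w) \<in> carrier_mat n n" if "w \<in> space L" for w
    using adj_mat(1)[OF mat_measurableD(1)[OF f that]] by (simp add: minv_def)
  show "minv (f w) $$ (i, j) = inverse (Determinant.det (f w)) * ((- 1) ^ (j + i) * Determinant.det (mat_delete (f w) j i))"
    if "i < n" "j < n" "w \<in> space L" for i j w
    using mat_measurableD(1)[OF f that(3)] that by (auto simp: minv_def adj_mat_def cofactor_def)
  show "(\<lambda>w. inverse (Determinant.det (f w)) * ((- 1) ^ (j + i) * Determinant.det (mat_delete (f w) j i))) \<in> borel_measurable L"
    if "i < n" "j < n" for i j
    using det_measurable[OF f] det_measurable[OF mat_measurable_delete[OF f that(2,1)]]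
    by (intro borel_measurable_times borel_measurable_inverse borel_measurable_const)
qed

lemma
  assumes A: "A \<in> carrier_mat n n" and f: "mat_measurable L n N f"
  shows mat_measurable_gram: "mat_measurable L n n (\<lambda>w. gram_mat A (f w))"
    and mat_measurable_cores: "mat_measurable L n n (\<lambda>w. cores_mat A (f w))"
proof -
  note intros = mat_measurable_mult mat_measurable_add mat_measurable_adjoint mat_measurable_const f A
    one_carrier_mat mat_adjoint_carrier
  show gram: "mat_measurable L n n (\<lambda>w. gram_mat A (f w))"
    unfolding gram_mat_def by (rule intros)+
  have res: "mat_measurable L n n (\<lambda>w. res_mat A (f w))"
    unfolding res_mat_def carrier_matD(1)[OF A]
    by (rule mat_measurable_minv mat_measurable_add mat_measurable_const one_carrier_mat gram)+
  show "mat_measurable L n n (\<lambda>w. cores_mat A (f w))"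
    unfolding cores_mat_def by (rule res intros)+
qed

lemma
  assumes A: "A \<in> carrier_mat n n" and f: "mat_measurable L n N f" and i: "i < n" and k: "k < N"
  shows stein_lhs_measurable: "(\<lambda>w. stein_lhs A i k (f w)) \<in> borel_measurable L"
    and stein_rhs_measurable: "(\<lambda>w. stein_rhs A i k (f w)) \<in> borel_measurable L"
proof -
  note M = mat_measurable_cores[OF A f]
  have cnj: "(\<lambda>w. cnj (g w)) \<in> borel_measurable L" if "g \<in> borel_measurable L" for g :: "_ \<Rightarrow> complex"
    using that by (rule borel_measurable_continuous_on[OF continuous_on_cnj[OF continuous_on_id]])
  show "(\<lambda>w. stein_lhs A i k (f w)) \<in> borel_measurable L"
    unfolding stein_lhs_def
    by (intro borel_measurable_Re[THEN measurable_compose_rev] borel_measurable_times cnj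
          mat_measurableD(2)[OF f i k] mat_measurableD(2)[OF mat_measurable_mult[OF M f] i k])
  show "(\<lambda>w. stein_rhs A i k (f w)) \<in> borel_measurable L"
    unfolding stein_rhs_def
    by (intro borel_measurable_Re[THEN measurable_compose_rev] borel_measurable_times borel_measurable_diff
        borel_measurable_const mat_measurableD(2)[OF M i i]
        mat_measurableD(2)[OF mat_measurable_mult[OF mat_measurable_mult[OF mat_measurable_adjoint[OF f] M] f] k k])
qed

lemma stein_bounds:
  assumes A: "A \<in> carrier_mat n n" and S: "S \<in> carrier_mat n N" and i: "i < n" and k: "k < N"
  defines "g \<equiv> Re ((mat_adjoint A * A) $$ (i, i))"
  shows "0 \<le> g" "\<bar>stein_lhs A i k S\<bar> \<le> (1 + g) * cmod (S $$ (i, k))" "\<bar>stein_rhs A i k S\<bar> \<le> g"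
proof -
  obtain a c :: real and \<beta> :: complex where
    q: "\<And>z :: complex. 0 \<le> qform a \<beta> c z" and ag: "a \<le> g" and
    f: "\<And>S'. S' \<in> carrier_mat n N \<Longrightarrow> (\<And>i' k'. i' < n \<Longrightarrow> k' < N \<Longrightarrow> (i', k') \<noteq> (i, k) \<Longrightarrow> S' $$ (i', k') = S $$ (i', k')) \<Longrightarrow>
      stein_lhs A i k S' = stein_f a \<beta> c (S' $$ (i, k)) \<and>
      stein_rhs A i k S' = stein_g a \<beta> c (S' $$ (i, k))"
    using stein_entry[OF A i k, of "\<lambda>p. S $$ p"] unfolding g_def by metis
  define z where "z = S $$ (i, k)"
  define D where "D = 1 + qform a \<beta> c z"
  note b = stein_scalar_bounds(2-6)[OF q, of z, folded D_def]
  show g: "0 \<le> g" using stein_scalar_bounds(1)[OF q] ag by simp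
  have lhs: "stein_lhs A i k S = Re (cnj z * (a * z + \<beta>)) / D"
    and rhs: "stein_rhs A i k S = a / D - (cmod (a * z + \<beta>))\<^sup>2 / D\<^sup>2"
    using f[OF S refl] by (simp_all only: z_def D_def)
  have "\<bar>stein_lhs A i k S\<bar> \<le> cmod (cnj z * (a * z + \<beta>)) / D"
    unfolding lhs abs_divide using b(1) by (intro frac_le abs_Re_le_cmod) auto
  also have "\<dots> = cmod z * (cmod (a * z + \<beta>) / D)" by (simp add: norm_mult)
  also have "\<dots> \<le> cmod z * (1 + g)" using b(2) ag by (intro mult_left_mono) auto
  finally show "\<bar>stein_lhs A i k S\<bar> \<le> (1 + g) * cmod (S $$ (i, k))" by (simp add: z_def mult.commute)
  show "\<bar>stein_rhs A i k S\<bar> \<le> g" unfolding rhs using b(3-5) ag by linarith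
qed

section \<open>Gaussian matrices\<close>

lemma (in prob_space) iid_gaussian_matD:
  assumes "iid_gaussian_mat M v n N S"
  shows "mat_measurable M n N S" "i < n \<Longrightarrow> k < N \<Longrightarrow> complex_gaussian M v (\<lambda>w. S w $$ (i, k))"
    "indep_vars (\<lambda>_. borel) (\<lambda>ij w. S w $$ ij) ({..<n} \<times> {..<N})"
  using assms by (auto simp: iid_gaussian_mat_def mat_measurable_def intro: complex_gaussian_measurable(3))

text \<open>The entries are split into the one at (i, k) and all others, which are independent of
  it. For frozen others, \<open>stein_entry\<close> reduces both sides to functions of one complex
  Gaussian variable, and \<open>stein_complex\<close> applies.\<close>

lemma (in prob_space) stein_matrix:
  assumes S: "iid_gaussian_mat M v n N S" and v: "0 < v"
    and A: "A \<in> carrier_mat n n" and i: "i < n" and k: "k < N"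
  shows "integrable M (\<lambda>w. stein_lhs A i k (S w))" "integrable M (\<lambda>w. stein_rhs A i k (S w))"
    "expectation (\<lambda>w. stein_lhs A i k (S w)) = v * expectation (\<lambda>w. stein_rhs A i k (S w))"
proof -
  note Sm = iid_gaussian_matD(1)[OF S]
  note Sc = mat_measurableD(1)[OF Sm]
  note G = iid_gaussian_matD(2)[OF S i k]
  define g where "g = Re ((mat_adjoint A * A) $$ (i, i))"
  note bounds = stein_bounds[OF A _ i k, folded g_def]
  show I1: "integrable M (\<lambda>w. stein_lhs A i k (S w))"
  proof (rule Bochner_Integration.integrable_bound)
    show "integrable M (\<lambda>w. (1 + g) * cmod (S w $$ (i, k)))"
      using complex_gaussian_integrable(1)[OF G v] by simp
    show "AE w in M. norm (stein_lhs A i k (S w)) \<le> norm ((1 + g) * cmod (S w $$ (i, k)))"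
    proof (rule AE_I2)
      fix w assume "w \<in> space M"
      from bounds(2)[OF Sc[OF this]] show "norm (stein_lhs A i k (S w)) \<le> norm ((1 + g) * cmod (S w $$ (i, k)))"
        by simp
    qed
  qed (rule stein_lhs_measurable[OF A Sm i k])
  show I2: "integrable M (\<lambda>w. stein_rhs A i k (S w))"
    using bounds(3)[OF Sc]
    by (intro integrable_const_bound[where B = g] stein_rhs_measurable[OF A Sm i k]) auto
  let ?I = "{(i, k)}" and ?J = "{..<n} \<times> {..<N} - {(i, k)}"
  let ?b = "\<lambda>_ :: nat \<times> nat. borel :: complex measure"
  let ?X = "\<lambda>w. restrict (\<lambda>ij. S w $$ ij) ?I" and ?Y = "\<lambda>w. restrict (\<lambda>ij. S w $$ ij) ?J"
  have ind: "indep_var (PiM ?I ?b) ?X (PiM ?J ?b) ?Y"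
    using i k by (intro indep_var_restrict[OF iid_gaussian_matD(3)[OF S]]) auto
  \<comment> \<open>Reassembles the matrix from the two groups of entries, so that both sides become
    functions on a product space.\<close>
  define R where "R p = Matrix.mat n N (\<lambda>ij. if ij = (i, k) then fst p ij else snd p ij)"
    for p :: "(nat \<times> nat \<Rightarrow> complex) \<times> (nat \<times> nat \<Rightarrow> complex)"
  have Rc: "R p \<in> carrier_mat n N" for p by (simp add: R_def)
  have Rm: "mat_measurable (PiM ?I ?b \<Otimes>\<^sub>M PiM ?J ?b) n N R"
  proof (rule mat_measurable_eqI[OF Rc])
    show "R p $$ (i', k') = (if (i', k') = (i, k) then fst p (i', k') else snd p (i', k'))"
      if "i' < n" "k' < N" for i' k' p using that by (simp add: R_def)
    show "(\<lambda>p. if (i', k') = (i, k) then fst p (i', k') else snd p (i', k')) \<in> borel_measurable (PiM ?I ?b \<Otimes>\<^sub>M PiM ?J ?b)"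
      if "i' < n" "k' < N" for i' k'
    proof (cases "(i', k') = (i, k)")
      case True
      have "(\<lambda>x. x (i, k)) \<in> borel_measurable (PiM ?I ?b)" by (rule measurable_component_singleton) simp
      show ?thesis unfolding if_P[OF True] using True measurable_compose[OF measurable_fst \<open>(\<lambda>x. x (i, k)) \<in> _\<close>] by simp
    next
      case False
      then have "(\<lambda>y. y (i', k')) \<in> borel_measurable (PiM ?J ?b)"
        using that by (intro measurable_component_singleton) auto
      then show ?thesis unfolding if_not_P[OF False] by (rule measurable_compose[OF measurable_snd])
    qed
  qed
  have RS: "R (?X w, ?Y w) = S w" if "w \<in> space M" for w
    using Sc[OF that] by (intro eq_matI) (auto simp: R_def)
  have "expectation (\<lambda>w. stein_lhs A i k (R (?X w, ?Y w))) = expectation (\<lambda>w. v * stein_rhs A i k (R (?X w, ?Y w)))"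
  proof (rule indep_var_expectation_cong[OF ind])
    show "(\<lambda>p. stein_lhs A i k (R p)) \<in> borel_measurable (PiM ?I ?b \<Otimes>\<^sub>M PiM ?J ?b)"
      by (rule stein_lhs_measurable[OF A Rm i k])
    show "(\<lambda>p. v * stein_rhs A i k (R p)) \<in> borel_measurable (PiM ?I ?b \<Otimes>\<^sub>M PiM ?J ?b)"
      by (intro borel_measurable_times borel_measurable_const stein_rhs_measurable[OF A Rm i k])
    show "integrable M (\<lambda>w. stein_lhs A i k (R (?X w, ?Y w)))"
      using I1 by (rule Bochner_Integration.integrable_cong[OF refl, THEN iffD1, rotated]) (simp add: RS)
    show "integrable M (\<lambda>w. v * stein_rhs A i k (R (?X w, ?Y w)))"
      using integrable_mult_right[OF I2, of v] by (rule Bochner_Integration.integrable_cong[OF refl, THEN iffD1, rotated]) (simp add: RS)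
    fix y :: "nat \<times> nat \<Rightarrow> complex"
    obtain a c :: real and \<beta> :: complex where
      q: "\<And>z :: complex. 0 \<le> qform a \<beta> c z" and
      f: "\<And>S'. S' \<in> carrier_mat n N \<Longrightarrow> (\<And>i' k'. i' < n \<Longrightarrow> k' < N \<Longrightarrow> (i', k') \<noteq> (i, k) \<Longrightarrow> S' $$ (i', k') = y (i', k')) \<Longrightarrow>
        stein_lhs A i k S' = stein_f a \<beta> c (S' $$ (i, k)) \<and>
        stein_rhs A i k S' = stein_g a \<beta> c (S' $$ (i, k))"
      using stein_entry[OF A i k, of y] by metis
    have Rik: "R (?X w, y) $$ (i, k) = S w $$ (i, k)" for w using i k by (simp add: R_def)
    have f': "stein_lhs A i k (R (?X w, y)) = stein_f a \<beta> c (S w $$ (i, k))"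
      "stein_rhs A i k (R (?X w, y)) = stein_g a \<beta> c (S w $$ (i, k))" for w
    proof -
      have "R (?X w, y) $$ (i', k') = y (i', k')" if "i' < n" "k' < N" "(i', k') \<noteq> (i, k)" for i' k'
        using that(3) unfolding R_def index_mat(1)[OF that(1,2)] by (auto split: if_splits)
      from f[OF Rc this, unfolded Rik]
      show "stein_lhs A i k (R (?X w, y)) = stein_f a \<beta> c (S w $$ (i, k))"
        "stein_rhs A i k (R (?X w, y)) = stein_g a \<beta> c (S w $$ (i, k))" by blast+
    qed
    have "expectation (\<lambda>w. stein_lhs A i k (R (?X w, y))) = v * expectation (\<lambda>w. stein_rhs A i k (R (?X w, y)))"
      unfolding f' by (rule stein_complex[OF G v q])
    then show "expectation (\<lambda>w. stein_lhs A i k (R (?X w, y))) = expectation (\<lambda>w. v * stein_rhs A i k (R (?X w, y)))"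
      by simp
  qed
  moreover have "expectation (\<lambda>w. stein_lhs A i k (R (?X w, ?Y w))) = expectation (\<lambda>w. stein_lhs A i k (S w))"
    "expectation (\<lambda>w. v * stein_rhs A i k (R (?X w, ?Y w))) = expectation (\<lambda>w. v * stein_rhs A i k (S w))"
    by (intro Bochner_Integration.integral_cong refl; simp add: RS)+
  ultimately show "expectation (\<lambda>w. stein_lhs A i k (S w)) = v * expectation (\<lambda>w. stein_rhs A i k (S w))" by simp
qed

section \<open>The mutual information\<close>

lemma integral_double_sum:
  fixes f :: "nat \<Rightarrow> nat \<Rightarrow> 'a \<Rightarrow> real"
  assumes "\<And>i k. i < n \<Longrightarrow> k < N \<Longrightarrow> integrable M (f i k)"
  shows "(LINT w|M. (\<Sum>i<n. \<Sum>k<N. f i k w)) = (\<Sum>i<n. \<Sum>k<N. LINT w|M. f i k w)"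
proof -
  have "(LINT w|M. (\<Sum>i<n. \<Sum>k<N. f i k w)) = (\<Sum>i<n. LINT w|M. (\<Sum>k<N. f i k w))"
    using assms by (intro Bochner_Integration.integral_sum Bochner_Integration.integrable_sum) auto
  also have "\<dots> = (\<Sum>i<n. \<Sum>k<N. LINT w|M. f i k w)"
    using assms by (intro sum.cong refl Bochner_Integration.integral_sum) auto
  finally show ?thesis .
qed

lemma mat_trace_triple:
  fixes C S :: "complex mat"
  assumes "C \<in> carrier_mat n n" "S \<in> carrier_mat n N"
  shows "mat_trace (mat_adjoint S * C * S) = (\<Sum>i<n. \<Sum>k<N. cnj (S $$ (i, k)) * (C * S) $$ (i, k))"
    "mat_trace (mat_adjoint S * C * S) = mat_trace (C * (S * mat_adjoint S))"
proof -
  note [simp] = carrier_matD[OF assms(1)] carrier_matD[OF assms(2)]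
  have "mat_trace (mat_adjoint S * C * S) = (\<Sum>k<N. \<Sum>i<n. cnj (S $$ (i, k)) * (C * S) $$ (i, k))"
    by (auto simp: mat_trace_def assoc_mult_dim scalar_prod_def[of "row (mat_adjoint S) _"] lessThan_atLeast0 intro!: sum.cong)
  then show "mat_trace (mat_adjoint S * C * S) = (\<Sum>i<n. \<Sum>k<N. cnj (S $$ (i, k)) * (C * S) $$ (i, k))"
    by (subst sum.swap)
  have "mat_trace (mat_adjoint S * (C * S)) = mat_trace ((C * S) * mat_adjoint S)"
    by (rule mat_trace_mult_comm[of _ N n]) (auto intro!: mult_carrier_mat[OF assms] simp: assms)
  then show "mat_trace (mat_adjoint S * C * S) = mat_trace (C * (S * mat_adjoint S))"
    by (simp add: assoc_mult_dim)
qed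

text \<open>This is t, and \<open>cores_trace\<close> is m; both are traces of semidefinite
  matrices, hence nonnegative.\<close>

definition res_defect :: "complex mat \<Rightarrow> complex mat \<Rightarrow> real" where
  "res_defect A S = Re (mat_trace (1\<^sub>m (dim_row A) - res_mat A S))"

definition cores_trace :: "complex mat \<Rightarrow> complex mat \<Rightarrow> real" where
  "cores_trace A S = Re (mat_trace (cores_mat A S))"

text \<open>Cyclicity of the trace. \<open>Q\<close> is arbitrary since both the random resolvent
  and the inverse of I + A A^H are inserted.\<close>

lemma cores_trace_gram:
  assumes A: "A \<in> carrier_mat n n" and S: "S \<in> carrier_mat n N" and Q: "Q \<in> carrier_mat n n"
  shows "mat_trace (Q * gram_mat A S) = mat_trace (mat_adjoint S * (mat_adjoint A * Q * A) * S)"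
    "mat_trace (Q * (A * mat_adjoint A)) = mat_trace (mat_adjoint A * Q * A)"
proof -
  note [simp] = carrier_matD[OF A] carrier_matD[OF S] carrier_matD[OF Q] A S Q
  have C: "mat_adjoint A * Q * A \<in> carrier_mat n n" by (auto intro!: mult_carrier_mat[of _ _ n])
  have 1: "Q * (A * (S * mat_adjoint S)) \<in> carrier_mat n n" by (rule carrier_matI) simp_all
  have "mat_trace (Q * gram_mat A S) = mat_trace ((Q * (A * (S * mat_adjoint S))) * mat_adjoint A)"
    by (simp add: gram_mat_def assoc_mult_dim)
  also have "\<dots> = mat_trace (mat_adjoint A * (Q * (A * (S * mat_adjoint S))))"
    by (rule mat_trace_mult_comm[OF 1]) simp
  finally show "mat_trace (Q * gram_mat A S) = mat_trace (mat_adjoint S * (mat_adjoint A * Q * A) * S)"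
    unfolding mat_trace_triple(2)[OF C S] by (simp add: assoc_mult_dim)
  have 2: "Q * A \<in> carrier_mat n n" by (rule carrier_matI) simp_all
  have "mat_trace ((Q * A) * mat_adjoint A) = mat_trace (mat_adjoint A * (Q * A))"
    by (rule mat_trace_mult_comm[OF 2]) simp
  then show "mat_trace (Q * (A * mat_adjoint A)) = mat_trace (mat_adjoint A * Q * A)"
    by (simp add: assoc_mult_dim)
qed

lemma res_defect_eq:
  assumes A: "A \<in> carrier_mat n n" and S: "S \<in> carrier_mat n N"
  shows "res_defect A S = Re (mat_trace (mat_adjoint S * cores_mat A S * S))"
  unfolding res_defect_def carrier_matD(1)[OF A] res_mat(6)[OF A S]
    cores_trace_gram(1)[OF A S res_mat(1)[OF A S]] cores_mat_def ..

lemma sum_stein_lhs: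
  assumes A: "A \<in> carrier_mat n n" and S: "S \<in> carrier_mat n N"
  shows "(\<Sum>i<n. \<Sum>k<N. stein_lhs A i k S) = res_defect A S"
  unfolding res_defect_eq[OF A S] mat_trace_triple(1)[OF cores_mat_psd(2)[OF A S] S] stein_lhs_def by simp

text \<open>Each summand is a factor in i times a factor in k, so the double sum is a product; the
  first factor sums to m and the second to N - t.\<close>

lemma sum_stein_rhs:
  assumes A: "A \<in> carrier_mat n n" and S: "S \<in> carrier_mat n N"
  shows "(\<Sum>i<n. \<Sum>k<N. stein_rhs A i k S) = cores_trace A S * (real N - res_defect A S)"
proof -
  note M = cores_mat_psd(2)[OF A S]
  have "(\<Sum>i<n. \<Sum>k<N. stein_rhs A i k S)
     = (\<Sum>i<n. Re (cores_mat A S $$ (i, i))) * (\<Sum>k<N. 1 - Re ((mat_adjoint S * cores_mat A S * S) $$ (k, k)))"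
    by (simp add: stein_rhs_def sum_product)
  also have "(\<Sum>i<n. Re (cores_mat A S $$ (i, i))) = cores_trace A S"
    by (simp add: cores_trace_def mat_trace_eq[OF M])
  also have "(\<Sum>k<N. 1 - Re ((mat_adjoint S * cores_mat A S * S) $$ (k, k))) = real N - res_defect A S"
    using S by (simp add: sum_subtractf res_defect_eq[OF A S] mat_trace_def)
  finally show ?thesis .
qed

lemma cores_trace_bounds:
  assumes A: "A \<in> carrier_mat n n" and S: "S \<in> carrier_mat n N"
  shows "0 \<le> cores_trace A S" "cores_trace A S \<le> Re (mat_trace (mat_adjoint A * A))" "0 \<le> res_defect A S"
proof -
  note M = cores_mat_psd[OF A S]
  show "0 \<le> cores_trace A S" unfolding cores_trace_def by (rule hermitian_psd_trace(1)[OF M(1)])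
  have "mat_adjoint A * A \<in> carrier_mat n n" using A by (auto intro!: mult_carrier_mat[of _ _ n])
  then show "cores_trace A S \<le> Re (mat_trace (mat_adjoint A * A))"
    unfolding cores_trace_def mat_trace_eq[OF M(2)] using cores_mat_diag_le[OF A S]
    by (simp add: mat_trace_eq[of _ n n]) (intro sum_mono, auto)
  show "0 \<le> res_defect A S"
    unfolding res_defect_def carrier_matD(1)[OF A] by (rule hermitian_psd_trace(1)[OF res_mat(5)[OF A S]])
qed

section \<open>Bounds for the expected log-determinant\<close>

abbreviation ln_det_one_plus :: "nat \<Rightarrow> complex mat \<Rightarrow> real" where
  "ln_det_one_plus n H \<equiv> ln (Re (Determinant.det (1\<^sub>m n + H)))"

text \<open>The trace inequality in both directions. In the first the weight is the random
  resolvent, which leaves m - t; in the second the weight is deterministic, so the correction is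
  linear in S S^H and has expectation zero.\<close>

lemma ln_det_gram_bounds:
  assumes A: "A \<in> carrier_mat n n" and S: "S \<in> carrier_mat n N"
  defines "C \<equiv> mat_adjoint A * minv (1\<^sub>m n + A * mat_adjoint A) * A"
  shows "ln_det_one_plus n (A * mat_adjoint A) + (res_defect A S - cores_trace A S) \<le> ln_det_one_plus n (gram_mat A S)"
    "ln_det_one_plus n (gram_mat A S) \<le> ln_det_one_plus n (A * mat_adjoint A)
       + (Re (mat_trace (mat_adjoint S * C * S)) - Re (mat_trace C))"
proof -
  note gp = gram_mat_psd[OF A S] and Tp = hermitian_psd_mult_adjoint[OF A]
  note [simp] = hermitian_psd_carrier[OF gp] hermitian_psd_carrier[OF Tp] A
    carrier_matD[OF hermitian_psd_carrier[OF gp]] carrier_matD[OF A]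
  have expand: "Re (mat_trace (P * (1\<^sub>m n + H))) = Re (mat_trace P) + Re (mat_trace (P * H))"
    if "P \<in> carrier_mat n n" "H \<in> carrier_mat n n" for P H :: "complex mat"
    using that mat_trace_add[OF that(1) mult_carrier_mat[OF that]]
    by (simp add: mult_add_distrib_mat[of _ n n _ n] carrier_matD[OF that(1)])
  note Q = res_mat(1)[OF A S]
  have "ln_det_one_plus n (A * mat_adjoint A) - ln_det_one_plus n (gram_mat A S)
     \<le> Re (mat_trace (res_mat A S * (1\<^sub>m n + A * mat_adjoint A))) - real n"
    using ln_det_le_trace[OF Tp gp] by (simp add: res_mat_def)
  also have "\<dots> = cores_trace A S - res_defect A S"
    unfolding expand[OF Q hermitian_psd_carrier[OF Tp]] cores_trace_gram(2)[OF A S Q]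
    by (simp add: cores_trace_def cores_mat_def res_defect_def mat_trace_diff[of _ n] Q)
  finally show "ln_det_one_plus n (A * mat_adjoint A) + (res_defect A S - cores_trace A S) \<le> ln_det_one_plus n (gram_mat A S)"
    by simp
  define P where "P = minv (1\<^sub>m n + A * mat_adjoint A)"
  note P = minv_one_plus_psd[OF Tp, folded P_def]
  have "ln_det_one_plus n (gram_mat A S) - ln_det_one_plus n (A * mat_adjoint A)
     \<le> Re (mat_trace (P * (1\<^sub>m n + gram_mat A S))) - real n"
    using ln_det_le_trace[OF gp Tp] by (simp add: P_def)
  \<comment> \<open>n is written with the same weight \<open>P\<close>, so that the traces of
    \<open>P\<close> cancel.\<close>
  also have "real n = Re (mat_trace (P * (1\<^sub>m n + A * mat_adjoint A)))" by (simp add: P(3))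
  also have "Re (mat_trace (P * (1\<^sub>m n + gram_mat A S))) - Re (mat_trace (P * (1\<^sub>m n + A * mat_adjoint A)))
      = Re (mat_trace (mat_adjoint S * C * S)) - Re (mat_trace C)"
    unfolding expand[OF P(1) hermitian_psd_carrier[OF gp]] expand[OF P(1) hermitian_psd_carrier[OF Tp]]
      cores_trace_gram[OF A S P(1)] by (simp add: C_def P_def)
  finally show "ln_det_one_plus n (gram_mat A S) \<le> ln_det_one_plus n (A * mat_adjoint A)
       + (Re (mat_trace (mat_adjoint S * C * S)) - Re (mat_trace C))"
    by simp
qed

text \<open>E S S^H = I, entry by entry: each of the N columns contributes 1 / N on the diagonal,
  and independence with mean zero gives 0 off it.\<close>

lemma (in prob_space) expectation_quadratic_form:
  assumes S: "iid_gaussian_mat M (1 / real N) n N S" and N: "0 < N" and C: "C \<in> carrier_mat n n"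
  shows "integrable M (\<lambda>w. Re (mat_trace (mat_adjoint (S w) * C * S w)))"
    "expectation (\<lambda>w. Re (mat_trace (mat_adjoint (S w) * C * S w))) = Re (mat_trace C)"
proof -
  note Sc = mat_measurableD(1)[OF iid_gaussian_matD(1)[OF S]]
  have v: "0 < 1 / real N" using N by simp
  note G = iid_gaussian_matD(2)[OF S]
  have E: "integrable M (\<lambda>w. cnj (S w $$ (i, k)) * S w $$ (j, k)) \<and>
     expectation (\<lambda>w. cnj (S w $$ (i, k)) * S w $$ (j, k)) = (if i = j then 1 / of_nat N else 0)"
    if "i < n" "j < n" "k < N" for i j k
  proof (cases "i = j")
    case True
    have *: "cnj (S w $$ (i, k)) * S w $$ (i, k) = complex_of_real ((cmod (S w $$ (i, k)))\<^sup>2)" for w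
      unfolding complex_norm_square by (rule mult.commute)
    note Z = complex_gaussian_integrable(2,3)[OF G[OF that(1,3)] v]
    have I: "integrable M (\<lambda>w. complex_of_real ((cmod (S w $$ (i, k)))\<^sup>2))"
      by (rule integrable_of_real[OF Z(1)])
    show ?thesis
      unfolding True[symmetric] * integral_complex_of_real Z(2)
      using I by simp
  next
    case False
    \<comment> \<open>The conjugation is applied to one of the two variables by a map chosen through
      the index, so that independence is inherited.\<close>
    have ind: "indep_vars (\<lambda>_. borel) (\<lambda>ij w. (if ij = (i, k) then cnj else id) (S w $$ ij)) {(i, k), (j, k)}"
    proof (rule indep_vars_compose2[where M' = "\<lambda>_. borel" and N = "\<lambda>_. borel"
          and X = "\<lambda>ij w. S w $$ ij" and Y = "\<lambda>ij. if ij = (i, k) then cnj else id"])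
      show "indep_vars (\<lambda>_. borel) (\<lambda>ij w. S w $$ ij) {(i, k), (j, k)}"
        using that by (intro indep_vars_subset[OF iid_gaussian_matD(3)[OF S]]) auto
      show "(if ij = (i, k) then cnj else id) \<in> borel \<rightarrow>\<^sub>M (borel :: complex measure)" for ij
        by (auto intro!: borel_measurable_continuous_onI continuous_intros)
    qed
    have int: "integrable M ((\<lambda>ij w. (if ij = (i, k) then cnj else id) (S w $$ ij)) ij)" if "ij \<in> {(i, k), (j, k)}" for ij
      using complex_gaussian_integrable(4)[OF G v] that \<open>i < n\<close> \<open>j < n\<close> \<open>k < N\<close> by (auto simp: integrable_cnj)
    have "expectation (\<lambda>w. S w $$ (j, k)) = 0" using complex_gaussian_integrable(5)[OF G v] that by simp
    then show ?thesis
      using indep_vars_lebesgue_integral[OF _ ind int] indep_vars_integrable[OF _ ind int] False by simp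
  qed
  define f where "f i k j w = Re (C $$ (i, j) * (cnj (S w $$ (i, k)) * S w $$ (j, k)))" for i k j w
  have eq: "Re (mat_trace (mat_adjoint (S w) * C * S w))
      = (\<Sum>i<n. \<Sum>k<N. \<Sum>j<n. f i k j w)" if "w \<in> space M" for w
  proof -
    have "(C * S w) $$ (i, k) = (\<Sum>j<n. C $$ (i, j) * S w $$ (j, k))" if "i < n" "k < N" for i k
      using that C Sc[OF \<open>w \<in> space M\<close>] by (auto simp: scalar_prod_def lessThan_atLeast0 intro!: sum.cong)
    then show ?thesis
      unfolding mat_trace_triple(1)[OF C Sc[OF that]] f_def Re_sum[symmetric]
      by (intro arg_cong[where f = Re] sum.cong refl) (simp add: sum_distrib_left ac_simps)
  qed
  have int: "integrable M (\<lambda>w. f i k j w)"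
    if "i < n" "k < N" "j < n" for i j k
    unfolding f_def using E[OF that(1,3,2)] by (intro integrable_Re integrable_mult_right) simp
  have ex: "expectation (\<lambda>w. f i k j w)
      = (if i = j then Re (C $$ (i, i)) / real N else 0)" if "i < n" "k < N" "j < n" for i j k
  proof -
    have "expectation (\<lambda>w. f i k j w)
       = Re (expectation (\<lambda>w. C $$ (i, j) * (cnj (S w $$ (i, k)) * S w $$ (j, k))))"
      unfolding f_def using E[OF that(1,3,2)] by (intro integral_Re integrable_mult_right) simp
    also have "\<dots> = Re (C $$ (i, j) * (if i = j then 1 / of_nat N else 0))" using E[OF that(1,3,2)] by simp
    also have "\<dots> = (if i = j then Re (C $$ (i, i)) / real N else 0)"
      by simp
    finally show ?thesis .
  qed
  show "integrable M (\<lambda>w. Re (mat_trace (mat_adjoint (S w) * C * S w)))"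
  proof (subst Bochner_Integration.integrable_cong[OF refl eq])
    show "integrable M (\<lambda>w. \<Sum>i<n. \<Sum>k<N. \<Sum>j<n. f i k j w)"
      by (intro Bochner_Integration.integrable_sum int) simp_all
  qed
  have "expectation (\<lambda>w. Re (mat_trace (mat_adjoint (S w) * C * S w)))
     = expectation (\<lambda>w. \<Sum>i<n. \<Sum>k<N. \<Sum>j<n. f i k j w)"
    by (intro Bochner_Integration.integral_cong refl eq)
  also have "\<dots> = (\<Sum>i<n. \<Sum>k<N. \<Sum>j<n. if i = j then Re (C $$ (i, i)) / real N else 0)"
  proof (subst integral_double_sum)
    show "integrable M (\<lambda>w. \<Sum>j<n. f i k j w)" if "i < n" "k < N" for i k
      using that by (intro Bochner_Integration.integrable_sum int) simp_all
    show "(\<Sum>i<n. \<Sum>k<N. expectation (\<lambda>w. \<Sum>j<n. f i k j w))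
       = (\<Sum>i<n. \<Sum>k<N. \<Sum>j<n. if i = j then Re (C $$ (i, i)) / real N else 0)"
    proof (intro sum.cong refl)
      fix i k assume "i \<in> {..<n}" "k \<in> {..<N}"
      then have ik: "i < n" "k < N" by auto
      have "expectation (\<lambda>w. \<Sum>j<n. f i k j w)
          = (\<Sum>j<n. expectation (\<lambda>w. f i k j w))"
        by (rule Bochner_Integration.integral_sum) (use ik in \<open>intro int, simp_all\<close>)
      also have "\<dots> = (\<Sum>j<n. if i = j then Re (C $$ (i, i)) / real N else 0)"
        using ik by (intro sum.cong refl ex) simp_all
      finally show "expectation (\<lambda>w. \<Sum>j<n. f i k j w)
          = (\<Sum>j<n. if i = j then Re (C $$ (i, i)) / real N else 0)" .
    qed
  qed
  also have "\<dots> = Re (mat_trace C)" using N by (simp add: mat_trace_eq[OF C])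
  finally show "expectation (\<lambda>w. Re (mat_trace (mat_adjoint (S w) * C * S w))) = Re (mat_trace C)" .
qed

lemma (in prob_space) expected_ln_det_gram:
  assumes S: "iid_gaussian_mat M (1 / real N) n N S" and KN: "K < N" and A: "A \<in> carrier_mat n n"
    and defect: "\<And>S. S \<in> carrier_mat n N \<Longrightarrow> res_defect A S \<le> real K"
  shows "integrable M (\<lambda>w. ln_det_one_plus n (gram_mat A (S w)))"
    "\<bar>expectation (\<lambda>w. ln_det_one_plus n (gram_mat A (S w))) - ln_det_one_plus n (A * mat_adjoint A)\<bar>
       \<le> (real K)\<^sup>2 / (real N - real K)"
proof -
  note Sm = iid_gaussian_matD(1)[OF S]
  note Sc = mat_measurableD(1)[OF Sm]
  have N: "0 < N" using KN by simp
  have v: "0 < 1 / real N" using N by simp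
  let ?t = "\<lambda>w. res_defect A (S w)" and ?m = "\<lambda>w. cores_trace A (S w)" and ?L = "\<lambda>w. ln_det_one_plus n (gram_mat A (S w))"
  let ?l = "ln_det_one_plus n (A * mat_adjoint A)"
  define C where "C = mat_adjoint A * minv (1\<^sub>m n + A * mat_adjoint A) * A"
  have Cc: "C \<in> carrier_mat n n"
    using A minv_one_plus_psd(1)[OF hermitian_psd_mult_adjoint[OF A]]
    unfolding C_def by (auto intro!: mult_carrier_mat[of _ _ n])
  define W where "W w = Re (mat_trace (mat_adjoint (S w) * C * S w))" for w
  have IW: "integrable M W" and EW: "expectation W = Re (mat_trace C)"
    using expectation_quadratic_form[OF S N Cc] by (auto simp: W_def[abs_def])
  note st = stein_matrix[OF S v A]
  have It: "integrable M ?t"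
  proof (subst Bochner_Integration.integrable_cong[OF refl])
    show "?t w = (\<Sum>i<n. \<Sum>k<N. stein_lhs A i k (S w))" if "w \<in> space M" for w
      using sum_stein_lhs[OF A Sc[OF that]] by simp
  qed (auto intro!: Bochner_Integration.integrable_sum st(1))
  have Imt: "integrable M (\<lambda>w. ?m w * (real N - ?t w))"
  proof (subst Bochner_Integration.integrable_cong[OF refl])
    show "?m w * (real N - ?t w) = (\<Sum>i<n. \<Sum>k<N. stein_rhs A i k (S w))" if "w \<in> space M" for w
      using sum_stein_rhs[OF A Sc[OF that]] by simp
  qed (auto intro!: Bochner_Integration.integrable_sum st(2))
  have Im: "integrable M ?m"
  proof (rule integrable_const_bound)
    show "?m \<in> borel_measurable M"
    proof (subst measurable_cong)
      show "?m w = (\<Sum>i<n. Re (cores_mat A (S w) $$ (i, i)))" if "w \<in> space M" for w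
        using cores_mat_psd(2)[OF A Sc[OF that]] by (simp add: cores_trace_def mat_trace_eq[of _ n n])
    qed (auto intro!: borel_measurable_sum borel_measurable_Re[THEN measurable_compose_rev]
        mat_measurableD(2)[OF mat_measurable_cores[OF A Sm]])
    show "AE w in M. norm (?m w) \<le> Re (mat_trace (mat_adjoint A * A))"
      using cores_trace_bounds[OF A Sc] by (intro AE_I2) auto
  qed
  \<comment> \<open>Summing Stein's identity over all entries of \<open>S\<close>.\<close>
  have stein: "expectation ?t = 1 / real N * expectation (\<lambda>w. ?m w * (real N - ?t w))"
  proof -
    have "expectation ?t = expectation (\<lambda>w. \<Sum>i<n. \<Sum>k<N. stein_lhs A i k (S w))"
      using sum_stein_lhs[OF A Sc] by (intro Bochner_Integration.integral_cong) auto
    also have "\<dots> = (\<Sum>i<n. \<Sum>k<N. expectation (\<lambda>w. stein_lhs A i k (S w)))"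
      by (rule integral_double_sum[OF st(1)])
    also have "\<dots> = (\<Sum>i<n. \<Sum>k<N. 1 / real N * expectation (\<lambda>w. stein_rhs A i k (S w)))"
      by (intro sum.cong refl st(3)) auto
    also have "\<dots> = 1 / real N * expectation (\<lambda>w. \<Sum>i<n. \<Sum>k<N. stein_rhs A i k (S w))"
      by (simp only: integral_double_sum[of n N M "\<lambda>i k w. stein_rhs A i k (S w)", OF st(2)] sum_distrib_left)
    also have "expectation (\<lambda>w. \<Sum>i<n. \<Sum>k<N. stein_rhs A i k (S w)) = expectation (\<lambda>w. ?m w * (real N - ?t w))"
      using sum_stein_rhs[OF A Sc] by (intro Bochner_Integration.integral_cong) auto
    finally show ?thesis .
  qed
  have b: "0 \<le> ?m w" "?m w \<le> Re (mat_trace (mat_adjoint A * A))" "0 \<le> ?t w" "?t w \<le> real K" if "w \<in> space M" for w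
    using cores_trace_bounds[OF A Sc[OF that]] defect[OF Sc[OF that]] by auto
  have "expectation ?t \<le> real K"
    using b(4) by (intro integral_le_const It AE_I2) auto
  \<comment> \<open>As t \<le> K, Stein's identity bounds E m by itself, in terms of N and K
    alone.\<close>
  have low: "expectation (\<lambda>w. ?m w * (real N - ?t w)) \<ge> expectation (\<lambda>w. (real N - real K) * ?m w)"
  proof (rule integral_mono[OF _ Imt])
    show "integrable M (\<lambda>w. (real N - real K) * ?m w)" using Im by simp
    fix w assume "w \<in> space M"
    from b[OF this] show "(real N - real K) * ?m w \<le> ?m w * (real N - ?t w)"
      by (subst mult.commute) (intro mult_left_mono, auto)
  qed
  then have low': "(real N - real K) * expectation ?m \<le> real N * expectation ?t"
    unfolding stein using N by simp
  also have "\<dots> \<le> real N * real K" using \<open>expectation ?t \<le> real K\<close> by (intro mult_left_mono) auto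
  finally have "expectation ?m * (real N - real K) \<le> real N * real K" by (simp add: mult.commute)
  then have Em: "expectation ?m \<le> real N * real K / (real N - real K)"
    using KN by (simp add: pos_le_divide_eq)
  \<comment> \<open>The same inequality, taken before E t is estimated, also controls the difference
    E m - E t.\<close>
  have "real N * (expectation ?m - expectation ?t) \<le> real K * expectation ?m" using low' by (simp add: algebra_simps)
  also have "\<dots> \<le> real K * (real N * real K / (real N - real K))" by (intro mult_left_mono Em) simp
  also have "\<dots> = real N * ((real K)\<^sup>2 / (real N - real K))" by (simp add: power2_eq_square)
  finally have lower: "expectation ?m - expectation ?t \<le> (real K)\<^sup>2 / (real N - real K)"
    by (rule mult_left_le_imp_le) (use N in simp)
  note lb = ln_det_gram_bounds[OF A Sc, folded C_def]
  have meas: "?L \<in> borel_measurable M"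
    using det_measurable[OF mat_measurable_add[OF mat_measurable_const[OF one_carrier_mat] mat_measurable_gram[OF A Sm]]]
    by (intro borel_measurable_ln borel_measurable_Re[THEN measurable_compose_rev])
  \<comment> \<open>The two-sided bounds dominate the logarithm. Here m is replaced by tr (A^H A), a
    constant that does not reach the final estimate.\<close>
  show IL: "integrable M ?L"
  proof (rule Bochner_Integration.integrable_bound[OF _ meas])
    show "integrable M (\<lambda>w. \<bar>?l\<bar> + Re (mat_trace (mat_adjoint A * A)) + \<bar>Re (mat_trace C)\<bar> + \<bar>W w\<bar>)"
      using IW by simp
    show "AE w in M. norm (?L w) \<le> norm (\<bar>?l\<bar> + Re (mat_trace (mat_adjoint A * A)) + \<bar>Re (mat_trace C)\<bar> + \<bar>W w\<bar>)"
    proof (rule AE_I2)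
      fix w assume w: "w \<in> space M"
      show "norm (?L w) \<le> norm (\<bar>?l\<bar> + Re (mat_trace (mat_adjoint A * A)) + \<bar>Re (mat_trace C)\<bar> + \<bar>W w\<bar>)"
        using lb[OF w] b[OF w] by (simp add: W_def[symmetric])
    qed
  qed
  have "?l + (expectation ?t - expectation ?m) = expectation (\<lambda>w. ?l + (?t w - ?m w))"
    using It Im by (simp add: prob_space)
  also have "\<dots> \<le> expectation ?L"
    using It Im IL lb(1) by (intro integral_mono) auto
  finally have 1: "?l - (real K)\<^sup>2 / (real N - real K) \<le> expectation ?L" using lower by linarith
  \<comment> \<open>On this side there is no error at all, as in Jensen's inequality, because the
    correction has mean zero.\<close>
  have "expectation ?L \<le> expectation (\<lambda>w. ?l + (W w - Re (mat_trace C)))"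
    using IW IL lb(2)[folded W_def] by (intro integral_mono) auto
  also have "\<dots> = ?l" using IW by (simp add: EW prob_space)
  finally have 2: "expectation ?L \<le> ?l" .
  have "0 \<le> (real K)\<^sup>2 / (real N - real K)" using KN by simp
  with 1 2 show "\<bar>expectation ?L - ?l\<bar> \<le> (real K)\<^sup>2 / (real N - real K)" by linarith
qed

text \<open>Each eigenvalue of \<open>RR\<close> costs the error twice, once on the random and once
  on the deterministic side; all \<open>NR\<close> eigenvalues are counted, zeros included.\<close>

lemma sensing_mi_approx:
  assumes prob: "prob_space M" and s2: "0 < s2" and RR: "hermitian_psd NR RR" and rR: "vec_space.rank NR RR \<le> K"
    and F: "F \<in> carrier_mat n n" and RT: "hermitian_psd n RT" and rT: "vec_space.rank n RT \<le> K"
    and S: "iid_gaussian_mat M (1 / real N) n N S" and KN: "K < N"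
  shows "\<bar>sensing_mi M s2 RR RT F S - (\<Sum>j<K. rho_bar N (T_mat RT (F * mat_adjoint F))
      (largest_eigenvalues K (complex_of_real (1 / s2) \<cdot>\<^sub>m RR) ! j))\<bar>
    \<le> real NR * (2 * ((real K)\<^sup>2 / (real N - real K)))"
proof -
  interpret prob_space M by (rule prob)
  obtain U d where U: "unitary_mat NR U" and RU: "RR = U * diagm NR d * mat_adjoint U" and d: "\<And>i. i < NR \<Longrightarrow> 0 \<le> d i"
    using hermitian_psd_spectral[OF RR] by blast
  note Sc = mat_measurableD(1)[OF iid_gaussian_matD(1)[OF S]]
  define B where "B = psd_sqrt RT"
  have Bp: "hermitian_psd n B" and BB: "B * B = RT" using psd_sqrt[OF RT] by (auto simp: B_def)
  note [simp] = hermitian_psd_carrier[OF Bp] carrier_matD[OF hermitian_psd_carrier[OF Bp]] F carrier_matD[OF F]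
    hermitian_psd_adjoint[OF Bp] carrier_matD[OF hermitian_psd_carrier[OF RR]] carrier_matD[OF hermitian_psd_carrier[OF RT]]
  \<comment> \<open>The eigenvalue is absorbed into the matrix in front of S, so that one estimate
    covers all eigenvalues.\<close>
  define A where "A l = complex_of_real (sqrt l) \<cdot>\<^sub>m (B * F)" for l
  have BF: "B * F \<in> carrier_mat n n" by (rule carrier_matI) simp_all
  have A [simp]: "A l \<in> carrier_mat n n" "dim_row (A l) = n" "dim_col (A l) = n" for l
    using BF by (auto simp: A_def)
  let ?T = "T_mat RT (F * mat_adjoint F)"
  have T: "?T = (B * F) * mat_adjoint (B * F)"
    by (simp add: T_mat_def B_def[symmetric] mat_adjoint_mult_dim assoc_mult_dim)
  have Tp: "hermitian_psd n ?T" unfolding T by (rule hermitian_psd_mult_adjoint[OF BF])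
  have aA: "mat_adjoint (A l) = complex_of_real (sqrt l) \<cdot>\<^sub>m mat_adjoint (B * F)" for l
    unfolding A_def by (simp add: mat_adjoint_smult)
  have smult_mult: "(complex_of_real (sqrt l) \<cdot>\<^sub>m X) * (complex_of_real (sqrt l) \<cdot>\<^sub>m Y) = complex_of_real l \<cdot>\<^sub>m (X * Y)"
    if "0 \<le> l" "dim_col X = dim_row Y" for l X Y
  proof -
    have "X \<in> carrier_mat (dim_row X) (dim_col X)" "Y \<in> carrier_mat (dim_col X) (dim_col Y)"
      using that by (auto intro!: carrier_matI)
    then have "(complex_of_real (sqrt l) \<cdot>\<^sub>m X) * (complex_of_real (sqrt l) \<cdot>\<^sub>m Y)
        = complex_of_real (sqrt l) \<cdot>\<^sub>m (complex_of_real (sqrt l) \<cdot>\<^sub>m (X * Y))"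
      using mult_smult_assoc_mat[of X _ _ "complex_of_real (sqrt l) \<cdot>\<^sub>m Y"] mult_smult_distrib[of X _ _ Y]
      by (metis smult_carrier_mat)
    also have "\<dots> = (complex_of_real (sqrt l) * complex_of_real (sqrt l)) \<cdot>\<^sub>m (X * Y)"
      by (rule eq_matI) auto
    also have "complex_of_real (sqrt l) * complex_of_real (sqrt l) = complex_of_real l"
      using that by (simp flip: of_real_mult)
    finally show ?thesis .
  qed
  have AA: "A l * mat_adjoint (A l) = complex_of_real l \<cdot>\<^sub>m ?T" if "0 \<le> l" for l
    unfolding aA T unfolding A_def using that by (intro smult_mult) simp_all
  define G where "G R = gram_mat (B * F) R" for R
  have AG: "gram_mat (A l) R = complex_of_real l \<cdot>\<^sub>m G R" if "0 \<le> l" "R \<in> carrier_mat n N" for l R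
  proof -
    have "A l * R * mat_adjoint R = complex_of_real (sqrt l) \<cdot>\<^sub>m (B * F * R * mat_adjoint R)"
      using that BF by (simp add: A_def mult_smult_assoc_mat[of _ n n _ N] mult_smult_assoc_mat[of _ n N _ n]
          mult_carrier_mat[of _ n n _ N])
    then show ?thesis unfolding gram_mat_def aA G_def using that by (simp add: smult_mult)
  qed
  \<comment> \<open>Since |B v|^2 = <RT v, v>, every matrix with right factor B vanishes on the
    kernel of \<open>RT\<close>. This covers the multiples of T as well as the random Gram matrices,
    whatever \<open>F\<close> is.\<close>
  have ker: "H *\<^sub>v v = 0\<^sub>v n" if H: "H = X * B" "X \<in> carrier_mat n n" and v: "v \<in> carrier_vec n" "RT *\<^sub>v v = 0\<^sub>v n" for H X v
  proof -
    have Bv: "B *\<^sub>v v \<in> carrier_vec n" by (rule mult_mat_vec_carrier[of _ n n]) (use v in simp_all)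
    have "(B *\<^sub>v v) \<bullet>c (B *\<^sub>v v) = (B *\<^sub>v (B *\<^sub>v v)) \<bullet>c v"
      using cscalar_prod_adjoint[of B n n "B *\<^sub>v v" v] Bv v by simp
    also have "B *\<^sub>v (B *\<^sub>v v) = 0\<^sub>v n"
      using v BB assoc_mult_mat_vec[of B n n B n v] by simp
    finally have "B *\<^sub>v v = 0\<^sub>v n" using v by (intro cscalar_prod_self_eq_0[OF Bv]) simp
    moreover have "X *\<^sub>v 0\<^sub>v n = 0\<^sub>v n" using that(2) by (intro eq_vecI) (simp_all add: scalar_prod_def)
    ultimately show ?thesis unfolding H(1) using assoc_mult_mat_vec[OF H(2) _ v(1), of B] by simp
  qed
  have tr: "Re (mat_trace (1\<^sub>m n - minv (1\<^sub>m n + H))) \<le> real K"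
    if "hermitian_psd n H" "H = X * B" "X \<in> carrier_mat n n" for H X
    using trace_one_minus_minv_le_rank[OF RT that(1) ker[OF that(2,3)]] rT by simp
  have BFa: "mat_adjoint (B * F) = mat_adjoint F * B" by (simp add: mat_adjoint_mult_dim)
  have trT: "Re (mat_trace (1\<^sub>m n - minv (1\<^sub>m n + complex_of_real a \<cdot>\<^sub>m ?T))) \<le> real K" if "0 \<le> a" for a
  proof (rule tr[OF hermitian_psd_smult[OF Tp that]])
    show "complex_of_real a \<cdot>\<^sub>m ?T = complex_of_real a \<cdot>\<^sub>m (B * F * mat_adjoint F) * B"
      unfolding T BFa using mult_smult_assoc_mat[of "B * F * mat_adjoint F" n n B n "complex_of_real a"]
      by (simp add: assoc_mult_dim carrier_matI)
  qed (simp add: carrier_matI)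
  have defect: "res_defect (A l) R \<le> real K" if l: "0 \<le> l" and R: "R \<in> carrier_mat n N" for l R
  proof -
    have "Re (mat_trace (1\<^sub>m n - minv (1\<^sub>m n + gram_mat (A l) R))) \<le> real K"
    proof (rule tr[OF gram_mat_psd[OF A(1) R]])
      have "gram_mat (A l) R = (A l * R * mat_adjoint R) * (complex_of_real (sqrt l) \<cdot>\<^sub>m mat_adjoint F * B)"
        unfolding gram_mat_def aA BFa by (simp add: mult_smult_assoc_mat[of _ n n _ n])
      then show "gram_mat (A l) R = (A l * R * mat_adjoint R * (complex_of_real (sqrt l) \<cdot>\<^sub>m mat_adjoint F)) * B"
        by (subst assoc_mult_dim) (simp_all add: carrier_matD[OF R])
    qed (rule carrier_matI, simp_all add: carrier_matD[OF R])
    then show ?thesis by (simp add: res_defect_def res_mat_def)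
  qed
  let ?e = "(real K)\<^sup>2 / (real N - real K)"
  define l where "l i = 1 / s2 * d i" for i
  have l0: "0 \<le> l i" if "i < NR" for i using d[OF that] s2 by (simp add: l_def)
  have "sensing_mi M s2 RR RT F S = expectation (\<lambda>w. \<Sum>i<NR. ln_det_one_plus n (gram_mat (A (l i)) (S w)))"
    unfolding sensing_mi_def
  proof (intro Bochner_Integration.integral_cong refl)
    fix w assume w: "w \<in> space M"
    note R = Sc[OF w]
    have "psd_sqrt RT * F * S w * mat_adjoint (S w) * mat_adjoint F * psd_sqrt RT = G (S w)"
      using R by (simp add: G_def gram_mat_def B_def[symmetric] BFa assoc_mult_dim)
    moreover have "hermitian_psd n (G (S w))" unfolding G_def by (rule gram_mat_psd[OF BF R])
    moreover have "0 \<le> 1 / s2" using s2 by simp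
    ultimately show "ln (Re (Determinant.det (1\<^sub>m (dim_row RR * dim_row RT) + complex_of_real (1 / s2) \<cdot>\<^sub>m
          kronecker RR (psd_sqrt RT * F * S w * mat_adjoint (S w) * mat_adjoint F * psd_sqrt RT))))
        = (\<Sum>i<NR. ln_det_one_plus n (gram_mat (A (l i)) (S w)))"
      using ln_det_kronecker[OF U RU d, of n "G (S w)" "1 / s2"] AG[OF l0 R] by (simp add: l_def)
  qed
  also have "\<dots> = (\<Sum>i<NR. expectation (\<lambda>w. ln_det_one_plus n (gram_mat (A (l i)) (S w))))"
    using expected_ln_det_gram(1)[OF S KN A(1) defect[OF l0]] by (intro Bochner_Integration.integral_sum) simp
  finally have mi: "sensing_mi M s2 RR RT F S = (\<Sum>i<NR. expectation (\<lambda>w. ln_det_one_plus n (gram_mat (A (l i)) (S w))))" .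
  \<comment> \<open>Makes the zeros that pad the list of eigenvalues harmless; at 0 every occurrence
    of \<open>delta\<close> is multiplied by 0.\<close>
  have rho0: "rho_bar N ?T 0 = 0"
  proof -
    have "complex_of_real 0 \<cdot>\<^sub>m ?T = 0\<^sub>m n n"
      using hermitian_psd_carrier[OF Tp] by (intro eq_matI) auto
    then have "1\<^sub>m (dim_row ?T) + 0 \<cdot>\<^sub>m ?T = 1\<^sub>m n" using carrier_matD[OF hermitian_psd_carrier[OF Tp]] by simp
    then show ?thesis by (simp add: rho_bar_def)
  qed
  have "(\<Sum>j<K. rho_bar N ?T (largest_eigenvalues K (complex_of_real (1 / s2) \<cdot>\<^sub>m RR) ! j)) = (\<Sum>i<NR. rho_bar N ?T (l i))"
    unfolding l_def using s2 by (intro sum_largest_eigenvalues(1)[OF U RU d rR] rho0) simp_all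
  then have "sensing_mi M s2 RR RT F S - (\<Sum>j<K. rho_bar N ?T (largest_eigenvalues K (complex_of_real (1 / s2) \<cdot>\<^sub>m RR) ! j))
    = (\<Sum>i<NR. expectation (\<lambda>w. ln_det_one_plus n (gram_mat (A (l i)) (S w))) - rho_bar N ?T (l i))"
    by (simp add: mi sum_subtractf)
  also have "\<bar>\<dots>\<bar> \<le> (\<Sum>i<NR. 2 * ?e)"
  proof (intro order.trans[OF sum_abs] sum_mono)
    fix i assume "i \<in> {..<NR}"
    then have li: "0 \<le> l i" using l0 by simp
    have "\<bar>expectation (\<lambda>w. ln_det_one_plus n (gram_mat (A (l i)) (S w))) - ln_det_one_plus n (complex_of_real (l i) \<cdot>\<^sub>m ?T)\<bar> \<le> ?e"
      using expected_ln_det_gram(2)[OF S KN A(1) defect[OF li]] unfolding AA[OF li] .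
    moreover have "\<bar>rho_bar N ?T (l i) - ln_det_one_plus n (complex_of_real (l i) \<cdot>\<^sub>m ?T)\<bar> \<le> ?e"
      by (rule rho_bar_approx[OF Tp li KN trT])
    ultimately show "\<bar>expectation (\<lambda>w. ln_det_one_plus n (gram_mat (A (l i)) (S w))) - rho_bar N ?T (l i)\<bar> \<le> 2 * ?e"
      by linarith
  qed
  finally show ?thesis by simp
qed

theorem proposition1:
  fixes c s2 :: real and K NR :: nat and RR :: "complex mat"
    and NT NS :: "nat \<Rightarrow> nat" and F RT :: "nat \<Rightarrow> complex mat"
    and M :: "nat \<Rightarrow> 'a measure" and S :: "nat \<Rightarrow> 'a \<Rightarrow> complex mat"
  assumes "c > 0" and "s2 > 0"
    and "hermitian_psd NR RR" and "vec_space.rank NR RR \<le> K"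
    and "filterlim NS at_top sequentially" and "filterlim NT at_top sequentially"
    and "\<And>n. real (NS n) / real (NT n) = c" and "\<And>n. NT n \<le> NS n"
    and "\<And>n. F n \<in> carrier_mat (NT n) (NT n)"
    and "\<And>n. hermitian_psd (NT n) (RT n)" and "\<And>n. vec_space.rank (NT n) (RT n) \<le> K"
    and "\<And>n. prob_space (M n)"
    and "\<And>n. iid_gaussian_mat (M n) (1 / real (NS n)) (NT n) (NS n) (S n)"
  shows "(\<lambda>n. sensing_mi (M n) s2 RR (RT n) (F n) (S n)
            - (\<Sum>j<K. rho_bar (NS n) (T_mat (RT n) (F n * mat_adjoint (F n)))
                 (largest_eigenvalues K (complex_of_real (1 / s2) \<cdot>\<^sub>m RR) ! j)))
         \<in> O(\<lambda>n. 1 / real (NS n))"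
proof (rule landau_o.bigI)
  \<comment> \<open>The error 2 K^2 / (N - K) per eigenvalue is at most 4 K^2 / N for large N; the
    added 1 keeps the constant positive when \<open>NR\<close> or \<open>K\<close> is 0.\<close>
  show "0 < 4 * real NR * (real K)\<^sup>2 + 1" by (intro add_nonneg_pos) auto
  \<comment> \<open>N \<ge> 2 K + 1 gives N - K \<ge> N / 2 and, also for K = 0, N > 0.\<close>
  have "eventually (\<lambda>n. 2 * K + 1 \<le> NS n) sequentially"
    using assms(5) by (simp add: filterlim_at_top)
  then show "eventually (\<lambda>n. norm (sensing_mi (M n) s2 RR (RT n) (F n) (S n)
            - (\<Sum>j<K. rho_bar (NS n) (T_mat (RT n) (F n * mat_adjoint (F n)))
                 (largest_eigenvalues K (complex_of_real (1 / s2) \<cdot>\<^sub>m RR) ! j)))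
       \<le> (4 * real NR * (real K)\<^sup>2 + 1) * norm (1 / real (NS n))) sequentially"
  proof eventually_elim
    case (elim n)
    then have KN: "K < NS n" and half: "real (NS n) / 2 \<le> real (NS n) - real K" and N: "0 < real (NS n)" by auto
    have "(real K)\<^sup>2 / (real (NS n) - real K) \<le> (real K)\<^sup>2 / (real (NS n) / 2)"
      using half N by (intro divide_left_mono mult_pos_pos) auto
    then have "real NR * (2 * ((real K)\<^sup>2 / (real (NS n) - real K))) \<le> real NR * (2 * ((real K)\<^sup>2 / (real (NS n) / 2)))"
      by (intro mult_left_mono) auto
    also have "\<dots> \<le> (4 * real NR * (real K)\<^sup>2 + 1) * norm (1 / real (NS n))"
      using N by (simp add: divide_simps)
    finally show ?case
      using sensing_mi_approx[OF assms(12,2,3,4,9,10,11,13) KN] by simp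
  qed
qed

end
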